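(* Let $1<p<\infty$ and let $u:M\times[a,b]\to\mathbb{R}$ be a smooth function, with $u(\cdot,t)\not\equiv0$ for every $t\in[a,b]$, which solves the nonlinear weighted $p$-heat-type equation $$|u(x,t)|^{p-2}u_t(x,t)-\Delta_{f,p}u(x,t)=\eta(t)\,|u(x,t)|^{p-2}u(x,t)\quad\text{on } M\times[a,b],$$ where $\eta$ is a smooth function of $t\in[a,b]$. Then $U_p(t)=D_p(t)/I_p(t)$ is a nondecreasing function of $t\in[a,b]$. Moreover, if $U_p$ is constant, then $u$ is an eigenfunction of $\Delta_{f,p}$ (for each $t$, $u(\cdot,t)$ is an eigenfunction of $\Delta_{f,p}$) and $$u(x,t)|u(x,t)|^{p-2}=e^{(p-1)(U_p(t)t-U_p(a)a)}\,u(x,a)|u(x,a)|^{p-2}\exp\left\{(p-1)\int_a^t\eta(s)\,ds\right\}$$ for all $x\in M$, $t\in[a,b]$. Also, if $\eta$ is a nondecreasing function, then $\log I_p$ is convex on $[a,b]$.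
   Context: $(M,g)$ is a closed (compact, without boundary) Riemannian manifold with Riemannian volume form $d\nu$, $f\in C^\infty(M)$ is a real-valued function, and $d\mu=e^{-f}d\nu$ is the weighted measure. The weighted $p$-Laplacian is $$\Delta_{f,p}u=\mathrm{div}_f(|\nabla u|^{p-2}\nabla u)=e^{f}\,\mathrm{div}(e^{-f}|\nabla u|^{p-2}\nabla u),$$ acting in the $M$-variable, where $|\nabla u|^{p-2}\nabla u$ and $|u|^{p-2}u$ are read as $0$ where $\nabla u=0$, respectively $u=0$. For a function $u$ on $M\times[a,b]$, $$D_p(t)=\int_M u\,\Delta_{f,p}u\,d\mu=-\int_M|\nabla u|^p\,d\mu,\qquad I_p(t)=\int_M|u|^p\,d\mu,\qquad U_p(t)=\frac{D_p(t)}{I_p(t)}.$$ An eigenfunction of $\Delta_{f,p}$ is a nonzero function $w$ on $M$ with $\Delta_{f,p}w=\lambda|w|^{p-2}w$ for some constant $\lambda$. *)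

theory Defs
  imports "HOL-Analysis.Analysis"
begin

section \<open>Smooth functions\<close>

text \<open>Intended for open \<open>S\<close>, where \<^term>\<open>at y\<close> and \<^term>\<open>at y within S\<close> coincide.\<close>

primrec Ck_on :: "nat \<Rightarrow> 'a::euclidean_space set \<Rightarrow> ('a \<Rightarrow> 'b::real_normed_vector) \<Rightarrow> bool" where
  "Ck_on 0 S h \<longleftrightarrow> continuous_on S h"
| "Ck_on (Suc k) S h \<longleftrightarrow>
     (\<forall>y\<in>S. h differentiable (at y)) \<and>
     (\<forall>v\<in>Basis. Ck_on k S (\<lambda>y. frechet_derivative h (at y) v))"

text \<open>Smoothness on an arbitrary set means local extendability to a smooth function on an open
  set. On open sets this is ordinary smoothness; on sets such as \<open>V \<times> {a..b}\<close> it is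
  smoothness up to the boundary.\<close>

definition smooth_on :: "'a::euclidean_space set \<Rightarrow> ('a \<Rightarrow> 'b::real_normed_vector) \<Rightarrow> bool" where
  "smooth_on S h \<longleftrightarrow>
     (\<forall>y\<in>S. \<exists>V k. open V \<and> y \<in> V \<and> (\<forall>n. Ck_on n V k) \<and> (\<forall>z\<in>S \<inter> V. h z = k z))"


section \<open>Closed Riemannian manifolds\<close>

text \<open>The manifold is the whole type \<open>'m\<close>, with a smooth structure given by an atlas. A chart is
  a pair of its domain and its coordinate map. Tensor fields are given by their
  components in each chart: \<open>X c x\<close> is the coordinate vector of the tangent vector \<open>X\<close> at \<open>x\<close>
  with respect to the chart \<open>c\<close>, and \<open>g c x\<close> is the Gram matrix of the metric at \<open>x\<close>.\<close>

type_synonym ('m, 'n) chart = "'m set \<times> ('m \<Rightarrow> real ^ 'n)"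

abbreviation chart_img :: "('m, 'n::finite) chart \<Rightarrow> (real ^ 'n) set" where
  "chart_img c \<equiv> snd c ` fst c"

abbreviation chart_inv :: "('m, 'n::finite) chart \<Rightarrow> real ^ 'n \<Rightarrow> 'm" where
  "chart_inv c \<equiv> inv_into (fst c) (snd c)"

definition jacobian ::
    "('m, 'n::finite) chart \<Rightarrow> ('m, 'n) chart \<Rightarrow> 'm \<Rightarrow> real ^ 'n ^ 'n" where
  "jacobian c d x = matrix (frechet_derivative (snd d \<circ> chart_inv c) (at (snd c x)))"

locale closed_riemannian_manifold =
  fixes A :: "('m::t2_space, 'n::finite) chart set"
    and g :: "('m, 'n) chart \<Rightarrow> 'm \<Rightarrow> real ^ 'n ^ 'n"
    and vol :: "'m measure"
  assumes compact_UNIV: "compact (UNIV :: 'm set)"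
    and charts_cover: "(\<Union>c\<in>A. fst c) = UNIV"
    and chart_open: "c \<in> A \<Longrightarrow> open (fst c) \<and> open (chart_img c)"
    and chart_homeomorphism:
      "c \<in> A \<Longrightarrow> homeomorphism (fst c) (chart_img c) (snd c) (chart_inv c)"
    and transition_smooth:
      "c \<in> A \<Longrightarrow> d \<in> A \<Longrightarrow> smooth_on (snd c ` (fst c \<inter> fst d)) (snd d \<circ> chart_inv c)"
    and metric_symmetric: "c \<in> A \<Longrightarrow> x \<in> fst c \<Longrightarrow> transpose (g c x) = g c x"
    and metric_positive: "c \<in> A \<Longrightarrow> x \<in> fst c \<Longrightarrow> v \<noteq> 0 \<Longrightarrow> v \<bullet> (g c x *v v) > 0"
    and metric_smooth: "c \<in> A \<Longrightarrow> smooth_on (chart_img c) (\<lambda>y. g c (chart_inv c y))"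
    and metric_transform:
      "c \<in> A \<Longrightarrow> d \<in> A \<Longrightarrow> x \<in> fst c \<inter> fst d \<Longrightarrow>
         g c x = transpose (jacobian c d x) ** g d x ** jacobian c d x"
    \<comment> \<open>\<open>vol\<close> is the Riemannian volume: the Borel measure with density \<open>sqrt (det g)\<close> with respect
        to Lebesgue measure in every chart. These conditions determine it uniquely.\<close>
    and sets_vol: "sets vol = sets borel"
    and emeasure_vol:
      "c \<in> A \<Longrightarrow> B \<in> sets borel \<Longrightarrow> B \<subseteq> fst c \<Longrightarrow>
         emeasure vol B =
           (\<integral>\<^sup>+ y \<in> snd c ` B. ennreal (sqrt (det (g c (chart_inv c y)))) \<partial>lborel)"

definition smooth_function :: "('m, 'n::finite) chart set \<Rightarrow> ('m \<Rightarrow> real) \<Rightarrow> bool" where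
  "smooth_function A h \<longleftrightarrow> (\<forall>c\<in>A. smooth_on (chart_img c) (h \<circ> chart_inv c))"

definition smooth_spacetime ::
    "('m, 'n::finite) chart set \<Rightarrow> real set \<Rightarrow> ('m \<Rightarrow> real \<Rightarrow> real) \<Rightarrow> bool" where
  "smooth_spacetime A T u \<longleftrightarrow>
     (\<forall>c\<in>A. smooth_on (chart_img c \<times> T) (\<lambda>(y, t). u (chart_inv c y) t))"

definition chart_at :: "('m, 'n::finite) chart set \<Rightarrow> 'm \<Rightarrow> ('m, 'n) chart" where
  "chart_at A x = (SOME c. c \<in> A \<and> x \<in> fst c)"

text \<open>The partial derivative at \<open>x\<close> of a function on the manifold along the \<open>i\<close>-th coordinate
  of the chart \<open>c\<close>.\<close>

definition coord_deriv :: "('m, 'n::finite) chart \<Rightarrow> 'n \<Rightarrow> ('m \<Rightarrow> real) \<Rightarrow> 'm \<Rightarrow> real" where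
  "coord_deriv c i h x = frechet_derivative (h \<circ> chart_inv c) (at (snd c x)) (axis i 1)"


section \<open>The weighted p-Laplacian\<close>

text \<open>Since \<open>0 powr 0 = 0\<close> in the library, the exponent \<open>0\<close> is treated separately, so that the
  case \<open>p = 2\<close> is the usual linear one. For \<open>r < 0\<close> the value at \<open>0\<close> is \<open>0\<close>.\<close>

definition abs_pow :: "real \<Rightarrow> real \<Rightarrow> real" where
  "abs_pow z r = (if r = 0 then 1 else \<bar>z\<bar> powr r)"

context
  fixes A :: "('m, 'n::finite) chart set"
    and g :: "('m, 'n) chart \<Rightarrow> 'm \<Rightarrow> real ^ 'n ^ 'n"
begin

definition grad :: "('m \<Rightarrow> real) \<Rightarrow> ('m, 'n) chart \<Rightarrow> 'm \<Rightarrow> real ^ 'n" where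
  "grad h c x = matrix_inv (g c x) *v (\<chi> i. coord_deriv c i h x)"

definition metric_norm :: "('m, 'n) chart \<Rightarrow> 'm \<Rightarrow> real ^ 'n \<Rightarrow> real" where
  "metric_norm c x v = sqrt (v \<bullet> (g c x *v v))"

definition p_flux :: "real \<Rightarrow> ('m \<Rightarrow> real) \<Rightarrow> ('m, 'n) chart \<Rightarrow> 'm \<Rightarrow> real ^ 'n" where
  "p_flux p h c x = abs_pow (metric_norm c x (grad h c x)) (p - 2) *\<^sub>R grad h c x"

definition divergence :: "(('m, 'n) chart \<Rightarrow> 'm \<Rightarrow> real ^ 'n) \<Rightarrow> 'm \<Rightarrow> real" where
  "divergence X x =
     (let c = chart_at A x
      in (\<Sum>i\<in>UNIV. coord_deriv c i (\<lambda>z. sqrt (det (g c z)) * X c z $ i) x)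
           / sqrt (det (g c x)))"

definition weighted_div ::
    "('m \<Rightarrow> real) \<Rightarrow> (('m, 'n) chart \<Rightarrow> 'm \<Rightarrow> real ^ 'n) \<Rightarrow> 'm \<Rightarrow> real" where
  "weighted_div f X x = exp (f x) * divergence (\<lambda>c z. exp (- f z) *\<^sub>R X c z) x"

definition p_laplacian :: "('m \<Rightarrow> real) \<Rightarrow> real \<Rightarrow> ('m \<Rightarrow> real) \<Rightarrow> 'm \<Rightarrow> real" where
  "p_laplacian f p h = weighted_div f (p_flux p h)"

text \<open>The functions whose p-Laplacian makes sense classically: \<open>h\<close> and the vector field
  \<open>|grad h|^(p-2) grad h\<close> are continuously differentiable. For \<open>p \<ge> 2\<close> every smooth \<open>h\<close>
  has this property; for \<open>p < 2\<close> the vector field can fail to be differentiable at critical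
  points of \<open>h\<close>.\<close>

definition p_laplacian_dom :: "real \<Rightarrow> ('m \<Rightarrow> real) \<Rightarrow> bool" where
  "p_laplacian_dom p h \<longleftrightarrow>
     (\<forall>c\<in>A. Ck_on 1 (chart_img c) (h \<circ> chart_inv c) \<and>
            Ck_on 1 (chart_img c) (p_flux p h c \<circ> chart_inv c))"

definition p_eigenfunction :: "('m \<Rightarrow> real) \<Rightarrow> real \<Rightarrow> ('m \<Rightarrow> real) \<Rightarrow> bool" where
  "p_eigenfunction f p w \<longleftrightarrow>
     (\<exists>x. w x \<noteq> 0) \<and> p_laplacian_dom p w \<and>
     (\<exists>lam. \<forall>x. p_laplacian f p w x = lam * abs_pow (w x) (p - 2) * w x)"

text \<open>For \<open>p < 2\<close> the coefficient \<open>|u|^(p-2)\<close> of the time derivative is singular where \<open>u = 0\<close>,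
  so the equation is then required only where \<open>u\<close> does not vanish. Membership of the domain of
  the p-Laplacian is demanded only for \<open>p < 2\<close>, being automatic for smooth \<open>u\<close> otherwise.\<close>

definition p_heat_solution ::
    "('m \<Rightarrow> real) \<Rightarrow> real \<Rightarrow> real \<Rightarrow> real \<Rightarrow> (real \<Rightarrow> real) \<Rightarrow> ('m \<Rightarrow> real \<Rightarrow> real) \<Rightarrow> bool" where
  "p_heat_solution f p a b \<eta> u \<longleftrightarrow>
     (\<forall>t\<in>{a..b}. p < 2 \<longrightarrow> p_laplacian_dom p (\<lambda>x. u x t)) \<and>
     (\<forall>t\<in>{a..b}. \<forall>x. p \<ge> 2 \<or> u x t \<noteq> 0 \<longrightarrow>
        abs_pow (u x t) (p - 2) * vector_derivative (u x) (at t within {a..b})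
          - p_laplacian f p (\<lambda>z. u z t) x
        = \<eta> t * abs_pow (u x t) (p - 2) * u x t)"

end


section \<open>The parabolic frequency\<close>

definition weighted_measure :: "'m measure \<Rightarrow> ('m \<Rightarrow> real) \<Rightarrow> 'm measure" where
  "weighted_measure vol f = density vol (\<lambda>x. ennreal (exp (- f x)))"

definition D_energy ::
    "('m, 'n::finite) chart set \<Rightarrow> (('m, 'n) chart \<Rightarrow> 'm \<Rightarrow> real ^ 'n ^ 'n) \<Rightarrow> 'm measure \<Rightarrow>
     ('m \<Rightarrow> real) \<Rightarrow> real \<Rightarrow> ('m \<Rightarrow> real \<Rightarrow> real) \<Rightarrow> real \<Rightarrow> real" where
  "D_energy A g vol f p u t =
     (\<integral>x. u x t * p_laplacian A g f p (\<lambda>z. u z t) x \<partial>weighted_measure vol f)"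

definition I_mass ::
    "'m measure \<Rightarrow> ('m \<Rightarrow> real) \<Rightarrow> real \<Rightarrow> ('m \<Rightarrow> real \<Rightarrow> real) \<Rightarrow> real \<Rightarrow> real" where
  "I_mass vol f p u t = (\<integral>x. \<bar>u x t\<bar> powr p \<partial>weighted_measure vol f)"

definition U_freq ::
    "('m, 'n::finite) chart set \<Rightarrow> (('m, 'n) chart \<Rightarrow> 'm \<Rightarrow> real ^ 'n ^ 'n) \<Rightarrow> 'm measure \<Rightarrow>
     ('m \<Rightarrow> real) \<Rightarrow> real \<Rightarrow> ('m \<Rightarrow> real \<Rightarrow> real) \<Rightarrow> real \<Rightarrow> real" where
  "U_freq A g vol f p u t = D_energy A g vol f p u t / I_mass vol f p u t"

end

theory Submission
  imports Defs
begin

text \<open>Put \<open>w = |u|^(p-2)\<close> and \<open>v = u\<^sub>t - \<eta> u\<close>, so that the equation reads \<open>\<Delta>u = w v\<close>, where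
  \<open>\<Delta>\<close> is the weighted p-Laplacian. Let \<open>Q = \<integral> v \<Delta>u d\<mu>\<close>. Then
  \<open>I = \<integral> w u\<^sup>2\<close>, \<open>D = \<integral> w u v\<close> and \<open>Q = \<integral> w v\<^sup>2\<close>, and formally
  \<open>I' = p (D + \<eta> I)\<close> and \<open>D' = p \<integral> u\<^sub>t \<Delta>u = p (Q + \<eta> D)\<close>. The terms with \<open>\<eta>\<close> cancel in the
  derivative of the quotient: \<open>I\<^sup>2 U' = p (Q I - D\<^sup>2)\<close>, which is nonnegative by the Cauchy--Schwarz inequality
  for the weight \<open>w\<close>. If \<open>U\<close> is a constant \<open>k\<close>, equality holds, so \<open>v = k u\<close> wherever \<open>u \<noteq> 0\<close>.
  For fixed \<open>t\<close> this is the eigenvalue equation \<open>\<Delta>u = k w u\<close>; for fixed \<open>x\<close> it is the linear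
  differential equation \<open>u\<^sub>t = (k + \<eta>) u\<close>, whose solution is the asserted formula. Finally
  \<open>(log I)' = p (U + \<eta>)\<close> is nondecreasing when \<open>\<eta>\<close> is.

  The derivative of \<open>D\<close> is never computed. Since \<open>|\<xi>|^p\<close> is a convex function of \<open>\<xi>\<close>, Green's
  formula gives \<open>D(s) \<le> D(t) + p \<integral> (u(s) - u(t)) \<Delta>u(t) d\<mu>\<close> for all \<open>s\<close> and \<open>t\<close>
  (\<open>D_upper_bound\<close>). The right-hand side touches \<open>D\<close> at \<open>s = t\<close> and has the derivative
  \<open>p (Q + \<eta> D)\<close> there. Thus \<open>U\<close> is touched from above at every \<open>t\<close> by a function with nonnegative
  derivative at \<open>t\<close>, and a continuous function with this property is nondecreasing
  (\<open>mono_on_of_upper_support\<close>). If \<open>U\<close> is constant, the touching function has a minimum at \<open>t\<close>,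
  which yields \<open>Q I = D\<^sup>2\<close>. In this way no second derivatives in mixed variables appear, and
  \<open>\<Delta>u\<close> enters at one time only; for \<open>p < 2\<close> its dependence on time would be hard to control at
  the zeros of \<open>u\<close>. Continuity of \<open>D\<close> is read off from \<open>D = \<integral> w u v\<close>, because \<open>|z|^(p-2) z\<close> is
  continuous in \<open>z\<close> for \<open>p > 1\<close>.

  For \<open>p < 2\<close> nothing is prescribed at the zeros of \<open>u\<close>, yet \<open>v \<Delta>u = 0\<close> there (\<open>v_Lap\<close>):
  in the interior of the zero set \<open>\<Delta>u\<close> vanishes, and any other zero is a limit of points at which
  \<open>v = |u|^(2-p) \<Delta>u\<close>, so that \<open>v\<close> vanishes.

  Green's formula (\<open>integration_by_parts\<close>) rests on translation invariance of Lebesgue measure in one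
  chart and on a partition of unity. That the operator does not depend on the chart is a
  consequence: its weak form involves only the inner product of gradients, which is visibly
  invariant. For \<open>p \<ge> 2\<close> the field \<open>|\<nabla>u|^(p-2) \<nabla>u\<close> has to be shown to be of class \<open>C\<^sup>1\<close>
  (\<open>C1_on_norm_power_scaleR\<close>).\<close>

section \<open>Functions of class C1 on Euclidean space\<close>

text \<open>An opaque name for the case \<open>k = 1\<close>. It is used through \<open>C1_onI\<close> and \<open>C1_onE\<close>, which allow an
  arbitrary description of the derivative.\<close>

definition C1_on :: "'a::euclidean_space set \<Rightarrow> ('a \<Rightarrow> 'b::real_normed_vector) \<Rightarrow> bool" where
  "C1_on S h \<longleftrightarrow> Ck_on 1 S h"

lemma C1_onI:
  assumes "\<And>y. y \<in> S \<Longrightarrow> (h has_derivative h' y) (at y)"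
    and "\<And>v. continuous_on S (\<lambda>y. h' y v)"
  shows "C1_on S h"
proof -
  have "frechet_derivative h (at y) = h' y" if "y \<in> S" for y
    using assms(1)[OF that] frechet_derivative_at by metis
  then have "continuous_on S (\<lambda>y. frechet_derivative h (at y) v)" for v
    using assms(2)[of v] continuous_on_cong[of S S "\<lambda>y. frechet_derivative h (at y) v" "\<lambda>y. h' y v"] by auto
  then show ?thesis using assms(1) by (auto simp: C1_on_def differentiable_def)
qed

lemma C1_onE:
  assumes "C1_on S h"
  obtains h' where "\<And>y. y \<in> S \<Longrightarrow> (h has_derivative h' y) (at y)"
    "\<And>v. continuous_on S (\<lambda>y. h' y v)" "h' = (\<lambda>y. frechet_derivative h (at y))"
proof -
  let ?h' = "\<lambda>y. frechet_derivative h (at y)"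
  have d: "(h has_derivative ?h' y) (at y)" if "y \<in> S" for y
    using assms that by (auto simp: C1_on_def frechet_derivative_works)
  have c: "continuous_on S (\<lambda>y. ?h' y b)" if "b \<in> Basis" for b
    using assms that by (auto simp: C1_on_def)
  have "continuous_on S (\<lambda>y. ?h' y v)" for v
  proof -
    have "?h' y v = (\<Sum>b\<in>Basis. (v \<bullet> b) *\<^sub>R ?h' y b)" if "y \<in> S" for y
    proof -
      interpret linear "?h' y" using d[OF that] has_derivative_linear by blast
      have "?h' y v = ?h' y (\<Sum>b\<in>Basis. (v \<bullet> b) *\<^sub>R b)" by (simp add: euclidean_representation)
      then show ?thesis by (simp add: sum scale)
    qed
    then show ?thesis
      using c by (subst continuous_on_cong[OF refl]) (auto intro!: continuous_intros)
  qed
  then show ?thesis using d by (intro that[of ?h']) auto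
qed

lemma C1_on_has_derivative:
  "C1_on S h \<Longrightarrow> y \<in> S \<Longrightarrow> (h has_derivative frechet_derivative h (at y)) (at y)"
  by (auto elim!: C1_onE)

lemma C1_on_continuous_derivative:
  "C1_on S h \<Longrightarrow> continuous_on S (\<lambda>y. frechet_derivative h (at y) v)"
  by (auto elim!: C1_onE)

lemma C1_on_imp_continuous_on:
  assumes "C1_on S h" shows "continuous_on S h"
  using assms by (auto simp: C1_on_def intro!: differentiable_imp_continuous_on
      differentiable_at_imp_differentiable_on)

lemma C1_on_subset: "C1_on S h \<Longrightarrow> T \<subseteq> S \<Longrightarrow> C1_on T h"
  by (auto simp: C1_on_def intro: continuous_on_subset)

lemma C1_on_const [simp]: "C1_on S (\<lambda>y. c)"
  by (rule C1_onI[where h' = "\<lambda>y v. 0"]) auto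

text \<open>Both differentiability and continuity of the partial derivatives are local on an open set.
  This is how regularity passes from charts to transplanted functions and from local extensions to
  the functions that they extend.\<close>

lemma C1_on_local:
  assumes "open S"
    and "\<And>y. y \<in> S \<Longrightarrow> \<exists>V k. open V \<and> y \<in> V \<and> C1_on V k \<and> (\<forall>z\<in>S \<inter> V. h z = k z)"
  shows "C1_on S h"
proof -
  have loc: "\<exists>W k. open W \<and> y \<in> W \<and> W \<subseteq> S \<and> C1_on W k \<and> (\<forall>z\<in>W. h z = k z) \<and>
      (\<forall>z\<in>W. (h has_derivative frechet_derivative k (at z)) (at z))" if y: "y \<in> S" for y
  proof -
    obtain V k where V: "open V" "y \<in> V" "C1_on V k" "\<forall>z\<in>S \<inter> V. h z = k z"
      using assms(2)[OF y] by blast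
    have "(h has_derivative frechet_derivative k (at z)) (at z)" if "z \<in> S \<inter> V" for z
      by (rule has_derivative_transform_within_open[OF C1_on_has_derivative[OF V(3)] open_Int[OF assms(1) V(1)]])
        (use that V assms(1) in auto)
    then show ?thesis using V assms(1) y
      by (intro exI[of _ "S \<inter> V"] exI[of _ k]) (auto intro: C1_on_subset)
  qed
  show ?thesis
  proof (rule C1_onI)
    fix y assume "y \<in> S"
    then show "(h has_derivative frechet_derivative h (at y)) (at y)"
      using loc[of y] frechet_derivative_at by (metis)
  next
    fix v
    show "continuous_on S (\<lambda>y. frechet_derivative h (at y) v)"
    proof (rule continuous_at_imp_continuous_on, rule ballI)
      fix y assume y: "y \<in> S"
      obtain W k where W: "open W" "y \<in> W" "C1_on W k"
        "\<forall>z\<in>W. (h has_derivative frechet_derivative k (at z)) (at z)" using loc[OF y] by blast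
      have eq: "frechet_derivative k (at z) v = frechet_derivative h (at z) v" if "z \<in> W" for z
        using W(4) that frechet_derivative_at by metis
      have "continuous_on W (\<lambda>y. frechet_derivative h (at y) v)"
        using C1_on_continuous_derivative[OF W(3), of v] eq
        continuous_on_cong[of W W "\<lambda>y. frechet_derivative k (at y) v" "\<lambda>y. frechet_derivative h (at y) v"]
      by simp
      then show "isCont (\<lambda>y. frechet_derivative h (at y) v) y"
        using W(1,2) continuous_on_eq_continuous_at by blast
    qed
  qed
qed

lemma C1_on_cong:
  assumes "open S" "\<And>y. y \<in> S \<Longrightarrow> h y = k y" "C1_on S k" shows "C1_on S h"
  using assms by (intro C1_on_local[OF assms(1)]) blast

lemma C1_on_bounded_linear:
  assumes "bounded_linear L" "C1_on S h" shows "C1_on S (\<lambda>y. L (h y))"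
proof (rule C1_onE[OF assms(2)], rule C1_onI)
  fix h' assume h: "\<And>y. y \<in> S \<Longrightarrow> (h has_derivative h' y) (at y)" "\<And>v. continuous_on S (\<lambda>y. h' y v)"
  show "((\<lambda>y. L (h y)) has_derivative (\<lambda>v. L (h' y v))) (at y)" if "y \<in> S" for y
    using bounded_linear.has_derivative[OF assms(1) h(1)[OF that]] .
  show "continuous_on S (\<lambda>y. L (h' y v))" for v
    using bounded_linear.continuous_on[OF assms(1) h(2)] .
qed

lemma C1_on_add:
  assumes "C1_on S h" "C1_on S k" shows "C1_on S (\<lambda>y. h y + k y)"
proof -
  obtain h' where h: "\<And>y. y \<in> S \<Longrightarrow> (h has_derivative h' y) (at y)" "\<And>v. continuous_on S (\<lambda>y. h' y v)"
    using C1_onE[OF assms(1)] by metis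
  obtain k' where k: "\<And>y. y \<in> S \<Longrightarrow> (k has_derivative k' y) (at y)" "\<And>v. continuous_on S (\<lambda>y. k' y v)"
    using C1_onE[OF assms(2)] by metis
  show ?thesis
    by (rule C1_onI[where h' = "\<lambda>y v. h' y v + k' y v"])
      (auto intro!: derivative_eq_intros continuous_intros h k)
qed

lemma C1_on_sum:
  assumes "\<And>i. i \<in> I \<Longrightarrow> C1_on S (h i)" shows "C1_on S (\<lambda>y. \<Sum>i\<in>I. h i y)"
  using assms by (induction I rule: infinite_finite_induct) (auto intro: C1_on_add)

lemma C1_on_scaleR:
  assumes "C1_on S h" "C1_on S k" shows "C1_on S (\<lambda>y. h y *\<^sub>R k y)"
proof -
  obtain h' where h: "\<And>y. y \<in> S \<Longrightarrow> (h has_derivative h' y) (at y)" "\<And>v. continuous_on S (\<lambda>y. h' y v)"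
    using C1_onE[OF assms(1)] by metis
  obtain k' where k: "\<And>y. y \<in> S \<Longrightarrow> (k has_derivative k' y) (at y)" "\<And>v. continuous_on S (\<lambda>y. k' y v)"
    using C1_onE[OF assms(2)] by metis
  show ?thesis
  proof (rule C1_onI[where h' = "\<lambda>y v. h y *\<^sub>R k' y v + h' y v *\<^sub>R k y"])
    show "continuous_on S (\<lambda>y. h y *\<^sub>R k' y v + h' y v *\<^sub>R k y)" for v
      by (intro continuous_intros h k C1_on_imp_continuous_on assms)
  qed (auto intro!: derivative_eq_intros h k)
qed

lemma C1_on_mult:
  fixes h k :: "'a::euclidean_space \<Rightarrow> real"
  shows "C1_on S h \<Longrightarrow> C1_on S k \<Longrightarrow> C1_on S (\<lambda>y. h y * k y)"
  using C1_on_scaleR[of S h k] by simp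

lemma C1_on_minus:
  fixes h :: "'a::euclidean_space \<Rightarrow> 'b::real_normed_vector"
  shows "C1_on S h \<Longrightarrow> C1_on S (\<lambda>y. - h y)"
  using C1_on_bounded_linear[OF bounded_linear_minus[OF bounded_linear_ident]] by blast

lemma C1_on_diff:
  fixes h :: "'a::euclidean_space \<Rightarrow> 'b::real_normed_vector"
  shows "C1_on S h \<Longrightarrow> C1_on S k \<Longrightarrow> C1_on S (\<lambda>y. h y - k y)"
  using C1_on_add[OF _ C1_on_minus] by fastforce

lemma C1_on_prod:
  fixes h :: "'i \<Rightarrow> 'a::euclidean_space \<Rightarrow> real"
  assumes "\<And>i. i \<in> I \<Longrightarrow> C1_on S (h i)" shows "C1_on S (\<lambda>y. \<Prod>i\<in>I. h i y)"
  using assms by (induction I rule: infinite_finite_induct) (auto intro: C1_on_mult)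

lemma C1_on_compose_real:
  fixes h :: "'a::euclidean_space \<Rightarrow> real"
  assumes "C1_on S h" "\<And>y. y \<in> S \<Longrightarrow> (\<psi> has_real_derivative \<psi>' (h y)) (at (h y))"
    "continuous_on (h ` S) \<psi>'"
  shows "C1_on S (\<lambda>y. \<psi> (h y))"
proof -
  obtain h' where h: "\<And>y. y \<in> S \<Longrightarrow> (h has_derivative h' y) (at y)" "\<And>v. continuous_on S (\<lambda>y. h' y v)"
    using C1_onE[OF assms(1)] by metis
  have c: "continuous_on S (\<lambda>y. \<psi>' (h y))"
    using continuous_on_compose[OF C1_on_imp_continuous_on[OF assms(1)] assms(3)] by (simp add: o_def)
  show ?thesis
  proof (rule C1_onI[where h' = "\<lambda>y v. \<psi>' (h y) * h' y v"])
    show "((\<lambda>y. \<psi> (h y)) has_derivative (\<lambda>v. \<psi>' (h y) * h' y v)) (at y)" if "y \<in> S" for y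
      using has_derivative_compose[OF h(1)[OF that] has_field_derivative_imp_has_derivative[OF assms(2)[OF that]]]
      by (simp add: o_def)
  qed (auto intro!: continuous_intros c h)
qed

lemma C1_on_divide:
  fixes h k :: "'a::euclidean_space \<Rightarrow> real"
  assumes "C1_on S h" "C1_on S k" "\<And>y. y \<in> S \<Longrightarrow> k y \<noteq> 0"
  shows "C1_on S (\<lambda>y. h y / k y)"
proof -
  have "C1_on S (\<lambda>y. inverse (k y))"
    by (rule C1_on_compose_real[OF assms(2), where \<psi>' = "\<lambda>z. - inverse z * inverse z"])
      (use assms(3) in \<open>auto intro!: derivative_eq_intros continuous_intros\<close>)
  from C1_on_mult[OF assms(1) this] show ?thesis by (simp add: divide_inverse)
qed

lemma C1_on_sqrt:
  assumes "C1_on S h" "\<And>y. y \<in> S \<Longrightarrow> h y > 0" shows "C1_on S (\<lambda>y. sqrt (h y))"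
  by (rule C1_on_compose_real[OF assms(1), where \<psi>' = "\<lambda>z. inverse (sqrt z) / 2"])
    (use assms(2) in \<open>force intro!: DERIV_real_sqrt continuous_intros\<close>)+

lemma C1_on_exp:
  fixes h :: "'a::euclidean_space \<Rightarrow> real"
  assumes "C1_on S h" shows "C1_on S (\<lambda>y. exp (h y))"
  by (rule C1_on_compose_real[OF assms, where \<psi>' = exp])
    (auto intro!: derivative_eq_intros continuous_intros)

lemma C1_on_compose:
  fixes G :: "'a::euclidean_space \<Rightarrow> 'b::euclidean_space" and F :: "'b \<Rightarrow> 'c::real_normed_vector"
  assumes "C1_on S G" "C1_on T F" "G ` S \<subseteq> T"
  shows "C1_on S (\<lambda>y. F (G y))"
proof -
  obtain G' where G: "\<And>y. y \<in> S \<Longrightarrow> (G has_derivative G' y) (at y)" "\<And>v. continuous_on S (\<lambda>y. G' y v)"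
    using C1_onE[OF assms(1)] by metis
  obtain F' where F: "\<And>y. y \<in> T \<Longrightarrow> (F has_derivative F' y) (at y)" "\<And>v. continuous_on T (\<lambda>y. F' y v)"
    using C1_onE[OF assms(2)] by metis
  have c: "continuous_on S (\<lambda>y. F' (G y) v)" for v
    using continuous_on_compose[OF C1_on_imp_continuous_on[OF assms(1)] continuous_on_subset[OF F(2) assms(3)]]
    by (simp add: o_def)
  show ?thesis
  proof (rule C1_onI[where h' = "\<lambda>y v. F' (G y) (G' y v)"])
    show "((\<lambda>y. F (G y)) has_derivative (\<lambda>v. F' (G y) (G' y v))) (at y)" if "y \<in> S" for y
      using has_derivative_compose[OF G(1)[OF that] F(1)] that assms(3) by auto
    fix v
    have "F' (G y) (G' y v) = (\<Sum>b\<in>Basis. (G' y v \<bullet> b) *\<^sub>R F' (G y) b)" if "y \<in> S" for y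
    proof -
      interpret linear "F' (G y)" using F(1)[of "G y"] that assms(3) has_derivative_linear by blast
      have "F' (G y) (G' y v) = F' (G y) (\<Sum>b\<in>Basis. (G' y v \<bullet> b) *\<^sub>R b)" by (simp add: euclidean_representation)
      then show ?thesis by (simp add: sum scale)
    qed
    then show "continuous_on S (\<lambda>y. F' (G y) (G' y v))"
      using c G(2) by (subst continuous_on_cong[OF refl]) (auto intro!: continuous_intros)
  qed
qed

lemma C1_on_vec_nth: "C1_on S F \<Longrightarrow> C1_on S (\<lambda>y. F y $ i)"
  by (rule C1_on_bounded_linear[OF bounded_linear_vec_nth])

lemma C1_on_vecI:
  fixes F :: "'a::euclidean_space \<Rightarrow> real ^ 'n::finite"
  assumes "\<And>i. C1_on S (\<lambda>y. F y $ i)" shows "C1_on S F"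
proof -
  have "\<exists>h'. (\<forall>y\<in>S. ((\<lambda>y. F y $ i) has_derivative h' y) (at y)) \<and> (\<forall>v. continuous_on S (\<lambda>y. h' y v))" for i
    using C1_onE[OF assms[of i]] by metis
  then obtain h' where h: "\<And>i y. y \<in> S \<Longrightarrow> ((\<lambda>y. F y $ i) has_derivative h' i y) (at y)"
     "\<And>i v. continuous_on S (\<lambda>y. h' i y v)" by metis
  show ?thesis
  proof (rule C1_onI[where h' = "\<lambda>y v. \<chi> i. h' i y v"])
    show "(F has_derivative (\<lambda>v. \<chi> i. h' i y v)) (at y)" if "y \<in> S" for y
      unfolding has_derivative_componentwise_within[of F]
      using h(1)[OF that] by (auto simp: Basis_vec_def inner_axis)
    show "continuous_on S (\<lambda>y. \<chi> i. h' i y v)" for v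
      by (rule continuous_on_vec_lambda) (rule h(2))
  qed
qed

lemma C1_on_det:
  fixes M :: "'a::euclidean_space \<Rightarrow> real ^ 'n ^ 'n::finite"
  assumes "\<And>i j. C1_on S (\<lambda>y. M y $ i $ j)" shows "C1_on S (\<lambda>y. det (M y))"
  unfolding det_def by (intro C1_on_sum C1_on_mult C1_on_prod C1_on_const assms)

lemma invertible_matrix_inv_mult:
  fixes B :: "real ^ 'n ^ 'n::finite"
  assumes "det B \<noteq> 0" shows "B ** matrix_inv B = mat 1" "matrix_inv B ** B = mat 1"
proof -
  have "\<exists>C. B ** C = mat 1 \<and> C ** B = mat 1" using assms by (simp add: invertible_det_nz[symmetric] invertible_def)
  from someI_ex[OF this] show "B ** matrix_inv B = mat 1" "matrix_inv B ** B = mat 1"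
    by (auto simp: matrix_inv_def)
qed

text \<open>By Cramer's rule the components are quotients of determinants.\<close>

lemma C1_on_matrix_inv_mult_vec:
  fixes M :: "'a::euclidean_space \<Rightarrow> real ^ 'n ^ 'n::finite" and b :: "'a \<Rightarrow> real ^ 'n"
  assumes "open S" "\<And>i j. C1_on S (\<lambda>y. M y $ i $ j)" "\<And>i. C1_on S (\<lambda>y. b y $ i)"
    "\<And>y. y \<in> S \<Longrightarrow> det (M y) \<noteq> 0"
  shows "C1_on S (\<lambda>y. matrix_inv (M y) *v b y)"
proof (rule C1_on_vecI, rule C1_on_cong[OF assms(1)])
  fix k y assume y: "y \<in> S"
  have "M y *v (matrix_inv (M y) *v b y) = b y"
    using invertible_matrix_inv_mult[OF assms(4)[OF y]] by (simp add: matrix_vector_mul_assoc)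
  then show "(matrix_inv (M y) *v b y) $ k = det (\<chi> i j. if j = k then b y $ i else M y $ i $ j) / det (M y)"
    using cramer[OF assms(4)[OF y]] by simp
next
  fix k
  show "C1_on S (\<lambda>y. det (\<chi> i j. if j = k then b y $ i else M y $ i $ j) / det (M y))"
  proof (intro C1_on_divide C1_on_det)
    show "C1_on S (\<lambda>y. (\<chi> i j. if j = k then b y $ i else M y $ i $ j) $ i' $ j')" for i' j'
      using assms by (cases "j' = k") auto
  qed (use assms in auto)
qed

lemma smooth_on_imp_C1_on:
  assumes "open S" "smooth_on S h" shows "C1_on S h"
  by (rule C1_on_local[OF assms(1)]) (use assms(2) in \<open>unfold smooth_on_def C1_on_def, meson\<close>)

section \<open>Integrals depending on a parameter\<close>

text \<open>The mean value theorem bounds all difference quotients by \<open>B\<close>, so dominated convergence applies.\<close>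

lemma has_derivative_integral_dominated:
  fixes F G :: "'x \<Rightarrow> real \<Rightarrow> real"
  assumes S: "convex S" "t \<in> S"
    and int: "\<And>s. s \<in> S \<Longrightarrow> integrable M (\<lambda>x. F x s)"
    and der: "\<And>x s. s \<in> S \<Longrightarrow> (F x has_real_derivative G x s) (at s within S)"
    and bound: "\<And>x s. s \<in> S \<Longrightarrow> \<bar>G x s\<bar> \<le> B x" "integrable M B"
    and meas: "(\<lambda>x. G x t) \<in> borel_measurable M"
  shows "((\<lambda>s. \<integral>x. F x s \<partial>M) has_real_derivative (\<integral>x. G x t \<partial>M)) (at t within S)"
  unfolding has_field_derivative_iff tendsto_at_iff_sequentially
proof (intro allI impI)
  fix X assume X: "\<forall>i. X i \<in> S - {t}" "X \<longlonglongrightarrow> t"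
  let ?q = "\<lambda>i x. (F x (X i) - F x t) / (X i - t)"
  have "(\<lambda>i. \<integral>x. ?q i x \<partial>M) \<longlonglongrightarrow> (\<integral>x. G x t \<partial>M)"
  proof (rule integral_dominated_convergence[where w = B])
    show "AE x in M. (\<lambda>i. ?q i x) \<longlonglongrightarrow> G x t"
    proof (rule AE_I2)
      fix x
      have "((\<lambda>s. (F x s - F x t) / (s - t)) \<longlongrightarrow> G x t) (at t within S)"
        using der[OF S(2)] by (simp add: has_field_derivative_iff)
      then show "(\<lambda>i. ?q i x) \<longlonglongrightarrow> G x t"
        using X by (auto simp: tendsto_at_iff_sequentially o_def)
    qed
    show "AE x in M. norm (?q i x) \<le> B x" for i
    proof (rule AE_I2)
      fix x
      have "norm (F x (X i) - F x t) \<le> B x * norm (X i - t)"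
        by (rule field_differentiable_bound[OF S(1) der]) (use X S bound in auto)
      then show "norm (?q i x) \<le> B x" using X(1) by (auto simp: divide_simps)
    qed
    show "?q i \<in> borel_measurable M" for i
      using int[of "X i"] int[OF S(2)] X by (auto intro!: borel_measurable_divide borel_measurable_diff)
  qed (use bound meas in auto)
  moreover have "(\<integral>x. ?q i x \<partial>M) = ((\<integral>x. F x (X i) \<partial>M) - (\<integral>x. F x t \<partial>M)) / (X i - t)" for i
    using int[of "X i"] int[OF S(2)] X by (simp add: Bochner_Integration.integral_diff)
  ultimately show "((\<lambda>y. ((\<integral>x. F x y \<partial>M) - (\<integral>x. F x t \<partial>M)) / (y - t)) \<circ> X) \<longlonglongrightarrow> (\<integral>x. G x t \<partial>M)"
    by (simp only: o_def)
qed

lemma integrable_lborel_compact_support: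
  fixes F :: "'a::euclidean_space \<Rightarrow> real"
  assumes "compact K" "continuous_on UNIV F" "\<And>y. y \<notin> K \<Longrightarrow> F y = 0"
  shows "integrable lborel F"
proof -
  have "integrable lborel (\<lambda>x. indicator K x *\<^sub>R F x)"
    by (rule borel_integrable_compact) (use assms in \<open>auto intro: continuous_on_subset\<close>)
  moreover have "(\<lambda>x. indicator K x *\<^sub>R F x) = F"
    using assms(3) by (auto simp: indicator_def fun_eq_iff)
  ultimately show ?thesis by simp
qed

text \<open>The fundamental theorem of calculus without boundary terms, from translation invariance of
  Lebesgue measure: the integral of \<open>F (y + s e)\<close> does not depend on \<open>s\<close>.\<close>

lemma integral_directional_derivative_compact_support:
  fixes F :: "'a::euclidean_space \<Rightarrow> real"
  assumes C1: "C1_on UNIV F" and K: "compact K" "\<And>y. y \<notin> K \<Longrightarrow> F y = 0"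
  shows "integrable lborel (\<lambda>y. frechet_derivative F (at y) e)"
    and "(\<integral>y. frechet_derivative F (at y) e \<partial>lborel) = 0"
proof -
  let ?D = "\<lambda>y. frechet_derivative F (at y) e"
  have der: "(F has_derivative frechet_derivative F (at y)) (at y)" for y
    using C1_on_has_derivative[OF C1] by simp
  have contD: "continuous_on UNIV ?D" by (rule C1_on_continuous_derivative[OF C1])
  have contF: "continuous_on UNIV F" by (rule C1_on_imp_continuous_on[OF C1])
  have D0: "?D y = 0" if "y \<notin> K" for y
  proof -
    have "(F has_derivative (\<lambda>v. 0)) (at y)"
      by (rule has_derivative_transform_within_open[OF has_derivative_const[of 0]  _ , where s = "- K"])
        (use that K in \<open>auto simp: compact_imp_closed open_Compl\<close>)
    then show ?thesis using frechet_derivative_at by metis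
  qed
  show D: "integrable lborel ?D"
    by (rule integrable_lborel_compact_support[OF K(1) contD D0])
  obtain C where C: "\<And>y. \<bar>?D y\<bar> \<le> C" "C \<ge> 0"
  proof -
    have "bounded (?D ` K)"
      by (intro compact_imp_bounded compact_continuous_image K continuous_on_subset[OF contD]) auto
    then obtain C where "\<forall>y\<in>K. \<bar>?D y\<bar> \<le> C" unfolding bounded_iff by auto
    then have "\<bar>?D y\<bar> \<le> max C 0" for y using D0[of y] by (cases "y \<in> K") force+
    then show ?thesis using that[of "max C 0"] by auto
  qed
  obtain R where R: "\<And>y. y \<in> K \<Longrightarrow> norm y \<le> R"
    using compact_imp_bounded[OF K(1)] by (auto simp: bounded_iff)
  let ?B = "\<lambda>y::'a. C * indicator (cball 0 (R + norm e)) y :: real"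
  have shift: "(\<integral>y. F (y + s *\<^sub>R e) \<partial>lborel) = (\<integral>y. F y \<partial>lborel)"
    and shift_int: "integrable lborel (\<lambda>y. F (y + s *\<^sub>R e))" for s
  proof -
    have m: "F \<in> borel_measurable borel" using contF by (rule borel_measurable_continuous_onI)
    have i: "integrable lborel F" by (rule integrable_lborel_compact_support[OF K(1) contF K(2)])
    have "(\<integral>y. F y \<partial>distr lborel borel ((+) (s *\<^sub>R e))) = (\<integral>y. F (s *\<^sub>R e + y) \<partial>lborel)"
      by (rule integral_distr) (use m in auto)
    then show "(\<integral>y. F (y + s *\<^sub>R e) \<partial>lborel) = (\<integral>y. F y \<partial>lborel)"
      by (simp add: lborel_distr_plus add.commute)
    have "integrable (distr lborel borel ((+) (s *\<^sub>R e))) F" using i by (simp add: lborel_distr_plus)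
    then show "integrable lborel (\<lambda>y. F (y + s *\<^sub>R e))"
      by (subst (asm) integrable_distr_eq) (use m in \<open>auto simp: add.commute\<close>)
  qed
  have "((\<lambda>s. \<integral>y. F (y + s *\<^sub>R e) \<partial>lborel) has_real_derivative
      (\<integral>y. frechet_derivative F (at (y + 0 *\<^sub>R e)) e \<partial>lborel)) (at 0 within {-1..1})"
  proof (rule has_derivative_integral_dominated[where B = ?B])
    fix y s assume s: "s \<in> {-1..1::real}"
    have lin: "linear (frechet_derivative F (at (y + s *\<^sub>R e)))" using der has_derivative_linear by blast
    have "((\<lambda>s. F (y + s *\<^sub>R e)) has_derivative (\<lambda>h. frechet_derivative F (at (y + s *\<^sub>R e)) (h *\<^sub>R e)))
        (at s within {-1..1})"
      by (rule has_derivative_compose[OF _ der]) (auto intro!: derivative_eq_intros)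
    then show "((\<lambda>s. F (y + s *\<^sub>R e)) has_real_derivative frechet_derivative F (at (y + s *\<^sub>R e)) e)
        (at s within {-1..1})"
      using lin by (simp add: has_field_derivative_def linear_scale mult.commute[of _ "frechet_derivative F _ _"])
    show "\<bar>frechet_derivative F (at (y + s *\<^sub>R e)) e\<bar> \<le> ?B y"
    proof (cases "y + s *\<^sub>R e \<in> K")
      case True
      have "norm y \<le> norm (y + s *\<^sub>R e) + norm (s *\<^sub>R e)" using norm_triangle_ineq4[of "y + s *\<^sub>R e" "s *\<^sub>R e"] by simp
      also have "norm (s *\<^sub>R e) \<le> norm e" using s by (simp add: mult_left_le_one_le abs_le_iff)
      finally show ?thesis using R[OF True] C by (simp add: indicator_def)
    next
      case False then show ?thesis using D0 C by (simp add: indicator_def)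
    qed
  next
    show "integrable lborel ?B"
      using emeasure_lborel_cball_finite[of "0 :: 'a" "R + norm e"]
      by (intro integrable_mult_right integrable_real_indicator) (auto simp: infinity_ennreal_def)
    show "(\<lambda>y. frechet_derivative F (at (y + 0 *\<^sub>R e)) e) \<in> borel_measurable lborel" using D by auto
  qed (use shift_int in auto)
  then have "((\<lambda>s. \<integral>y. F y \<partial>lborel) has_real_derivative (\<integral>y. ?D y \<partial>lborel)) (at 0 within {-1..1})"
    by (simp add: shift)
  moreover have "((\<lambda>s. \<integral>y. F y \<partial>lborel) has_real_derivative 0) (at 0 within {-1..1::real})" by simp
  ultimately show "(\<integral>y. ?D y \<partial>lborel) = 0"
    by (intro DERIV_unique[of "\<lambda>s. \<integral>y. F y \<partial>lborel" _ 0]) (simp_all add: at_within_Icc_at)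
qed

section \<open>Gradients in charts\<close>

text \<open>The segment from the identity to \<open>G\<close> consists of positive definite, hence invertible, matrices, so
  the determinant cannot change sign along it.\<close>

lemma posdef_det_pos:
  fixes G :: "real ^ 'n ^ 'n::finite"
  assumes pos: "\<And>v. v \<noteq> 0 \<Longrightarrow> v \<bullet> (G *v v) > 0"
  shows "det G > 0"
proof -
  define H where "H s = (1 - s) *\<^sub>R mat 1 + s *\<^sub>R G" for s :: real
  have nz: "det (H s) \<noteq> 0" if s: "0 \<le> s" "s \<le> 1" for s
  proof -
    have "v = 0" if "H s *v v = 0" for v
    proof (rule ccontr)
      assume v: "v \<noteq> 0"
      have "v \<bullet> (H s *v v) = (1 - s) * (v \<bullet> v) + s * (v \<bullet> (G *v v))"
        by (simp add: H_def matrix_vector_mult_add_rdistrib scaleR_matrix_vector_assoc[symmetric] inner_add_right)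
      moreover have "(1 - s) * (v \<bullet> v) \<ge> 0" "s * (v \<bullet> (G *v v)) \<ge> 0"
        using s pos[OF v] by auto
      moreover have "(1 - s) * (v \<bullet> v) > 0 \<or> s * (v \<bullet> (G *v v)) > 0"
        using s pos[OF v] v by (cases "s = 1") auto
      ultimately show False using that by auto
    qed
    then have "invertible (H s)"
      by (metis invertible_left_inverse matrix_left_invertible_ker)
    then show ?thesis by (simp add: invertible_det_nz)
  qed
  have cont: "continuous_on {0..1} (\<lambda>s. det (H s))"
    unfolding det_def H_def by (auto intro!: continuous_intros)
  show ?thesis
  proof (rule ccontr)
    assume "\<not> det G > 0"
    then have "det (H 1) \<le> 0" "0 \<le> det (H 0)" by (auto simp: H_def)
    then obtain s where "0 \<le> s" "s \<le> 1" "det (H s) = 0"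
      using IVT2'[of "\<lambda>s. det (H s)" 1 0 0] cont by auto
    with nz show False by blast
  qed
qed

lemma posdef_inverse:
  fixes G :: "real ^ 'n ^ 'n::finite"
  assumes sym: "transpose G = G" and pos: "\<And>v. v \<noteq> 0 \<Longrightarrow> v \<bullet> (G *v v) > 0"
  shows "transpose (matrix_inv G) = matrix_inv G"
    and "v \<noteq> 0 \<Longrightarrow> v \<bullet> (matrix_inv G *v v) > 0"
proof -
  let ?B = "matrix_inv G"
  note B = invertible_matrix_inv_mult[of G, OF less_imp_neq[OF posdef_det_pos[OF pos], symmetric]]
  have "transpose ?B = transpose ?B ** (G ** ?B)" using B by simp
  also have "\<dots> = (transpose ?B ** transpose G) ** ?B" by (simp add: sym matrix_mul_assoc)
  also have "\<dots> = transpose (G ** ?B) ** ?B" by (simp add: matrix_transpose_mul)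
  finally show "transpose ?B = ?B" using B by (simp add: transpose_mat)
  assume v: "v \<noteq> 0"
  have v_eq: "G *v (?B *v v) = v" using B by (simp add: matrix_vector_mul_assoc)
  then have "?B *v v \<noteq> 0" using v by auto
  from pos[OF this] show "v \<bullet> (?B *v v) > 0" by (simp add: v_eq inner_commute)
qed

lemma symmetric_inner_commute:
  fixes G :: "real ^ 'n ^ 'n::finite"
  assumes "transpose G = G" shows "v \<bullet> (G *v w) = w \<bullet> (G *v v)"
  by (metis assms dot_lmul_matrix inner_commute transpose_matrix_vector)

lemma posdef_Cauchy_Schwarz:
  fixes G :: "real ^ 'n ^ 'n::finite"
  assumes sym: "transpose G = G" and pos: "\<And>v. v \<noteq> 0 \<Longrightarrow> v \<bullet> (G *v v) > 0"
  shows "(v \<bullet> (G *v w))\<^sup>2 \<le> (v \<bullet> (G *v v)) * (w \<bullet> (G *v w))"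
proof (cases "w = 0")
  case False
  let ?W = "w \<bullet> (G *v w)"
  define z where "z = ?W *\<^sub>R v - (v \<bullet> (G *v w)) *\<^sub>R w"
  have "0 \<le> z \<bullet> (G *v z)" using pos[of z] by (cases "z = 0") auto
  also have "\<dots> = ?W * (?W * (v \<bullet> (G *v v)) - (v \<bullet> (G *v w))\<^sup>2)"
    using symmetric_inner_commute[OF sym, of w v]
    by (simp add: z_def matrix_vector_mult_diff_distrib matrix_vector_mult_scaleR
        inner_diff_left inner_diff_right power2_eq_square algebra_simps)
  finally show ?thesis using pos[OF False] by (simp add: zero_le_mult_iff mult.commute)
qed simp

definition coord_grad :: "('m, 'n::finite) chart \<Rightarrow> ('m \<Rightarrow> real) \<Rightarrow> 'm \<Rightarrow> real ^ 'n" where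
  "coord_grad c h x = (\<chi> i. coord_deriv c i h x)"

text \<open>The inner product of the two gradients, computed in the chart \<open>c\<close>.\<close>

definition grad_inner ::
    "(('m, 'n::finite) chart \<Rightarrow> 'm \<Rightarrow> real ^ 'n ^ 'n) \<Rightarrow> ('m, 'n) chart \<Rightarrow> ('m \<Rightarrow> real) \<Rightarrow> ('m \<Rightarrow> real) \<Rightarrow> 'm \<Rightarrow> real"
  where "grad_inner g c h k x = coord_grad c h x \<bullet> (matrix_inv (g c x) *v coord_grad c k x)"

definition C1_function :: "('m, 'n::finite) chart set \<Rightarrow> ('m \<Rightarrow> real) \<Rightarrow> bool" where
  "C1_function A h \<longleftrightarrow> (\<forall>c\<in>A. C1_on (chart_img c) (\<lambda>y. h (chart_inv c y)))"

lemma grad_eq: "grad g h c x = matrix_inv (g c x) *v coord_grad c h x"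
  by (simp add: grad_def coord_grad_def)

context closed_riemannian_manifold
begin

lemma open_chart: "c \<in> A \<Longrightarrow> open (fst c)" "c \<in> A \<Longrightarrow> open (chart_img c)"
  using chart_open by auto

lemma chart_inv_chart [simp]: "c \<in> A \<Longrightarrow> x \<in> fst c \<Longrightarrow> chart_inv c (snd c x) = x"
  using chart_homeomorphism unfolding homeomorphism_def by blast

lemma chart_chart_inv: "c \<in> A \<Longrightarrow> y \<in> chart_img c \<Longrightarrow> snd c (chart_inv c y) = y"
  using chart_homeomorphism unfolding homeomorphism_def by blast

lemma chart_inv_in: "c \<in> A \<Longrightarrow> y \<in> chart_img c \<Longrightarrow> chart_inv c y \<in> fst c"
  using chart_homeomorphism unfolding homeomorphism_def by blast

lemma continuous_on_chart: "c \<in> A \<Longrightarrow> continuous_on (fst c) (snd c)"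
  "c \<in> A \<Longrightarrow> continuous_on (chart_img c) (chart_inv c)"
  using chart_homeomorphism unfolding homeomorphism_def by blast+

lemma open_chart_image:
  assumes c: "c \<in> A" and "open W" "W \<subseteq> fst c" shows "open (snd c ` W)"
proof -
  have "snd c ` W = chart_img c \<inter> chart_inv c -` W"
  proof (intro equalityI subsetI)
    show "y \<in> snd c ` W" if "y \<in> chart_img c \<inter> chart_inv c -` W" for y
      using that chart_chart_inv[OF c, of y] by (intro image_eqI[of _ _ "chart_inv c y"]) auto
  qed (use assms(3) chart_inv_chart[OF c] in auto)
  then show ?thesis
    using continuous_open_preimage[OF continuous_on_chart(2)[OF c] open_chart(2)[OF c] assms(2)] by simp
qed

lemma open_chart_inv_image:
  assumes c: "c \<in> A" and "open V" "V \<subseteq> chart_img c" shows "open (chart_inv c ` V)"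
proof -
  have "chart_inv c ` V = fst c \<inter> snd c -` V"
  proof (intro equalityI subsetI)
    show "x \<in> chart_inv c ` V" if "x \<in> fst c \<inter> snd c -` V" for x
      using that chart_inv_chart[OF c, of x] by (intro image_eqI[of _ _ "snd c x"]) auto
  qed (use assms(3) chart_chart_inv[OF c] chart_inv_in[OF c] in force)
  then show ?thesis
    using continuous_open_preimage[OF continuous_on_chart(1)[OF c] open_chart(1)[OF c] assms(2)] by simp
qed

lemma chart_at_in: "chart_at A x \<in> A" "x \<in> fst (chart_at A x)"
proof -
  have "\<exists>c. c \<in> A \<and> x \<in> fst c" using charts_cover by blast
  from someI_ex[OF this] show "chart_at A x \<in> A" "x \<in> fst (chart_at A x)" by (auto simp: chart_at_def)
qed

lemma continuous_on_chartwise: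
  assumes "\<And>c. c \<in> A \<Longrightarrow> continuous_on (chart_img c) (\<lambda>y. F (chart_inv c y))"
  shows "continuous_on UNIV F"
proof -
  have "continuous_on (fst c) F" if c: "c \<in> A" for c
  proof -
    have "continuous_on (fst c) (\<lambda>x. F (chart_inv c (snd c x)))"
      using continuous_on_compose[OF continuous_on_chart(1)[OF c] assms[OF c]] by (simp add: o_def)
    then show ?thesis using c by (subst (asm) continuous_on_cong[OF refl, of _ _ F]) auto
  qed
  then have "continuous_on (\<Union>c\<in>A. fst c) F"
    using open_chart by (intro continuous_on_open_UN) auto
  then show ?thesis by (simp add: charts_cover)
qed

lemma C1_function_continuous: "C1_function A h \<Longrightarrow> continuous_on UNIV h"
  by (intro continuous_on_chartwise C1_on_imp_continuous_on) (auto simp: C1_function_def)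

lemma smooth_function_C1: "smooth_function A h \<Longrightarrow> C1_function A h"
  unfolding smooth_function_def C1_function_def o_def
  using smooth_on_imp_C1_on open_chart by blast

lemma C1_on_metric: "c \<in> A \<Longrightarrow> C1_on (chart_img c) (\<lambda>y. g c (chart_inv c y) $ i $ j)"
proof -
  assume c: "c \<in> A"
  have "C1_on (chart_img c) (\<lambda>y. g c (chart_inv c y))"
    by (rule smooth_on_imp_C1_on[OF open_chart(2)[OF c] metric_smooth[OF c]])
  from C1_on_bounded_linear[OF bounded_linear_vec_nth this]
  show ?thesis by (rule C1_on_vec_nth)
qed

lemma metric_det_pos: "c \<in> A \<Longrightarrow> x \<in> fst c \<Longrightarrow> det (g c x) > 0"
  using posdef_det_pos metric_positive by blast

lemma C1_on_volume_density:
  assumes c: "c \<in> A" shows "C1_on (chart_img c) (\<lambda>y. sqrt (det (g c (chart_inv c y))))"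
  by (intro C1_on_sqrt C1_on_det C1_on_metric c metric_det_pos chart_inv_in)

lemma metric_inv_left: "c \<in> A \<Longrightarrow> x \<in> fst c \<Longrightarrow> matrix_inv (g c x) ** g c x = mat 1"
  and metric_inv_right: "c \<in> A \<Longrightarrow> x \<in> fst c \<Longrightarrow> g c x ** matrix_inv (g c x) = mat 1"
  by (rule invertible_matrix_inv_mult; use metric_det_pos[of c x] in simp)+

lemma C1_function_has_derivative:
  assumes "C1_function A h" "c \<in> A" "y \<in> chart_img c"
  shows "((\<lambda>y. h (chart_inv c y)) has_derivative (\<lambda>v. v \<bullet> coord_grad c h (chart_inv c y))) (at y)"
proof -
  let ?D = "frechet_derivative (\<lambda>y. h (chart_inv c y)) (at y)"
  have d: "((\<lambda>y. h (chart_inv c y)) has_derivative ?D) (at y)"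
    by (rule C1_on_has_derivative) (use assms in \<open>auto simp: C1_function_def\<close>)
  interpret linear ?D using d has_derivative_linear by blast
  have "?D v = v \<bullet> coord_grad c h (chart_inv c y)" for v
  proof -
    have "?D v = ?D (\<Sum>i\<in>UNIV. v $ i *\<^sub>R axis i 1)"
      using basis_expansion[of v] by (simp add: scalar_mult_eq_scaleR)
    also have "\<dots> = (\<Sum>i\<in>UNIV. v $ i * ?D (axis i 1))" by (simp add: sum scale)
    also have "\<dots> = v \<bullet> coord_grad c h (chart_inv c y)"
      using assms by (simp add: coord_grad_def coord_deriv_def inner_vec_def chart_chart_inv o_def)
    finally show ?thesis .
  qed
  then have "?D = (\<lambda>v. v \<bullet> coord_grad c h (chart_inv c y))" by (rule ext)
  then show ?thesis using d by simp
qed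

lemma continuous_on_coord_grad:
  assumes "C1_function A h" "c \<in> A"
  shows "continuous_on (chart_img c) (\<lambda>y. coord_grad c h (chart_inv c y))"
  unfolding coord_grad_def
proof (rule continuous_on_vec_lambda)
  fix i
  have "continuous_on (chart_img c) (\<lambda>y. frechet_derivative (\<lambda>y. h (chart_inv c y)) (at y) (axis i 1))"
    by (rule C1_on_continuous_derivative) (use assms in \<open>auto simp: C1_function_def\<close>)
  then show "continuous_on (chart_img c) (\<lambda>y. coord_deriv c i h (chart_inv c y))"
    using assms by (subst continuous_on_cong[OF refl]) (auto simp: coord_deriv_def chart_chart_inv o_def)
qed

text \<open>The chain rule for the transition map: coordinate gradients transform as covectors.\<close>

lemma coord_grad_change:
  assumes h: "C1_function A h" and c: "c \<in> A" and d: "d \<in> A" and x: "x \<in> fst c \<inter> fst d"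
  shows "coord_grad c h x = transpose (jacobian c d x) *v coord_grad d h x"
proof -
  let ?T = "\<lambda>y. snd d (chart_inv c y)" and ?S = "snd c ` (fst c \<inter> fst d)"
  let ?y = "snd c x"
  have S: "open ?S" using open_chart_image[OF c open_Int] open_chart c d by blast
  have T: "(?T has_derivative frechet_derivative ?T (at ?y)) (at ?y)"
    using C1_on_has_derivative[OF smooth_on_imp_C1_on[OF S transition_smooth[OF c d]], of ?y] x
    by (simp add: o_def)
  then have lin: "linear (frechet_derivative ?T (at ?y))" using has_derivative_linear by blast
  have Ty: "?T ?y = snd d x" using x c by simp
  have "((\<lambda>y. h (chart_inv d (?T y))) has_derivative
      (\<lambda>v. frechet_derivative ?T (at ?y) v \<bullet> coord_grad d h x)) (at ?y)"
    using has_derivative_compose[OF T C1_function_has_derivative[OF h d, unfolded Ty]] x d Ty by auto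
  moreover have "h (chart_inv d (?T y)) = h (chart_inv c y)" if "y \<in> ?S" for y
    using that c d by auto
  ultimately have "((\<lambda>y. h (chart_inv c y)) has_derivative
      (\<lambda>v. frechet_derivative ?T (at ?y) v \<bullet> coord_grad d h x)) (at ?y)"
    using S x by (auto elim!: has_derivative_transform_within_open)
  moreover have "((\<lambda>y. h (chart_inv c y)) has_derivative (\<lambda>v. v \<bullet> coord_grad c h x)) (at ?y)"
    using C1_function_has_derivative[OF h c, of ?y] x c by auto
  ultimately have eq: "frechet_derivative ?T (at ?y) v \<bullet> coord_grad d h x = v \<bullet> coord_grad c h x" for v
    using has_derivative_unique by metis
  have "v \<bullet> (transpose (jacobian c d x) *v coord_grad d h x) = v \<bullet> coord_grad c h x" for v
  proof -
    have "v \<bullet> (transpose (jacobian c d x) *v coord_grad d h x) = (jacobian c d x *v v) \<bullet> coord_grad d h x"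
      by (metis dot_lmul_matrix inner_commute transpose_matrix_vector transpose_transpose)
    also have "jacobian c d x *v v = frechet_derivative ?T (at ?y) v"
      using lin by (simp add: jacobian_def o_def matrix_works)
    finally show ?thesis using eq by simp
  qed
  then show ?thesis by (metis vector_eq_rdot inner_commute)
qed

text \<open>The transformation rules of the metric and of covectors cancel.\<close>

lemma grad_inner_change:
  assumes h: "C1_function A h" and k: "C1_function A k"
    and c: "c \<in> A" and d: "d \<in> A" and x: "x \<in> fst c \<inter> fst d"
  shows "grad_inner g c h k x = grad_inner g d h k x"
proof -
  define J where "J = jacobian c d x"
  let ?B = "matrix_inv (g c x)" and ?C = "matrix_inv (g d x)"
  have gJ: "g c x = transpose J ** g d x ** J" unfolding J_def using metric_transform c d x by blast
  have "det J \<noteq> 0" using metric_det_pos[OF c, of x] x by (auto simp: gJ det_mul)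
  note J = invertible_matrix_inv_mult[OF this]
  have "J ** ?B ** transpose J ** g d x = (J ** ?B ** transpose J ** g d x) ** (J ** matrix_inv J)"
    using J by simp
  also have "\<dots> = J ** (?B ** g c x) ** matrix_inv J" by (simp add: gJ matrix_mul_assoc)
  also have "\<dots> = mat 1" using metric_inv_left[OF c, of x] x J by simp
  finally have "J ** ?B ** transpose J ** (g d x ** ?C) = ?C" by (simp add: matrix_mul_assoc)
  then have C: "?C = J ** ?B ** transpose J" using metric_inv_right[OF d, of x] x by simp
  have "grad_inner g c h k x = (transpose J *v coord_grad d h x) \<bullet> (?B *v (transpose J *v coord_grad d k x))"
    unfolding grad_inner_def J_def using coord_grad_change[OF h c d x] coord_grad_change[OF k c d x] by simp
  also have "\<dots> = coord_grad d h x \<bullet> (J *v (?B *v (transpose J *v coord_grad d k x)))"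
    by (metis dot_lmul_matrix transpose_matrix_vector)
  also have "\<dots> = grad_inner g d h k x"
    unfolding grad_inner_def C by (simp only: matrix_vector_mul_assoc matrix_mul_assoc)
  finally show ?thesis .
qed

abbreviation ginner :: "('m \<Rightarrow> real) \<Rightarrow> ('m \<Rightarrow> real) \<Rightarrow> 'm \<Rightarrow> real" where
  "ginner h k x \<equiv> grad_inner g (chart_at A x) h k x"

lemma ginner_eq:
  assumes "C1_function A h" "C1_function A k" "c \<in> A" "x \<in> fst c"
  shows "ginner h k x = grad_inner g c h k x"
  using grad_inner_change[OF assms(1,2) chart_at_in(1) assms(3), of x] chart_at_in(2) assms(4) by blast

lemma continuous_on_matrix_inv_metric:
  assumes c: "c \<in> A" and v: "continuous_on (chart_img c) v"
  shows "continuous_on (chart_img c) (\<lambda>y. matrix_inv (g c (chart_inv c y)) *v v y)"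
proof -
  have col: "continuous_on (chart_img c) (\<lambda>y. matrix_inv (g c (chart_inv c y)) *v axis i 1)" for i
    by (rule C1_on_imp_continuous_on, rule C1_on_matrix_inv_mult_vec)
      (use open_chart[OF c] C1_on_metric[OF c] less_imp_neq[OF metric_det_pos[OF c chart_inv_in[OF c]]] in \<open>auto simp: axis_def\<close>)
  have "matrix_inv (g c (chart_inv c y)) *v v y
      = (\<Sum>i\<in>UNIV. v y $ i *\<^sub>R (matrix_inv (g c (chart_inv c y)) *v axis i 1))" for y
  proof -
    have "v y = (\<Sum>i\<in>UNIV. v y $ i *\<^sub>R axis i 1)"
      using basis_expansion[of "v y"] by (simp add: scalar_mult_eq_scaleR)
    then have "matrix_inv (g c (chart_inv c y)) *v v y =
        matrix_inv (g c (chart_inv c y)) *v (\<Sum>i\<in>UNIV. v y $ i *\<^sub>R axis i 1)" by simp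
    then show ?thesis by (simp only:
       linear_sum[OF matrix_vector_mul_linear] linear_scale[OF matrix_vector_mul_linear])
  qed
  then show ?thesis using col v by (auto intro!: continuous_intros)
qed

lemma continuous_on_ginner:
  assumes h: "C1_function A h" and k: "C1_function A k"
  shows "continuous_on UNIV (ginner h k)"
proof (rule continuous_on_chartwise)
  fix c assume c: "c \<in> A"
  have "continuous_on (chart_img c) (\<lambda>y. grad_inner g c h k (chart_inv c y))"
    unfolding grad_inner_def
    by (intro continuous_on_inner continuous_on_matrix_inv_metric continuous_on_coord_grad c h k)
  then show "continuous_on (chart_img c) (\<lambda>y. ginner h k (chart_inv c y))"
    using ginner_eq[OF h k c chart_inv_in[OF c]] by (subst continuous_on_cong[OF refl]) auto
qed

lemma metric_inv_posdef:
  assumes "c \<in> A" "x \<in> fst c"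
  shows "transpose (matrix_inv (g c x)) = matrix_inv (g c x)"
    and "v \<noteq> 0 \<Longrightarrow> v \<bullet> (matrix_inv (g c x) *v v) > 0"
  using posdef_inverse[of "g c x"] metric_symmetric metric_positive assms by blast+

lemma ginner_self_nonneg: "ginner h h x \<ge> 0"
  using metric_inv_posdef(2)[OF chart_at_in, of "coord_grad (chart_at A x) h x" x]
  by (cases "coord_grad (chart_at A x) h x = 0") (auto simp: grad_inner_def)

lemma ginner_Cauchy_Schwarz: "(ginner h k x)\<^sup>2 \<le> ginner h h x * ginner k k x"
  unfolding grad_inner_def using posdef_Cauchy_Schwarz metric_inv_posdef[OF chart_at_in] by blast

lemma metric_norm_grad:
  assumes "c \<in> A" "x \<in> fst c"
  shows "metric_norm g c x (grad g h c x) = sqrt (grad_inner g c h h x)"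
  using metric_inv_right[OF assms]
  by (simp add: metric_norm_def grad_eq grad_inner_def matrix_vector_mul_assoc inner_commute)

lemma grad_inner_eq_grad:
  assumes "c \<in> A" "x \<in> fst c"
  shows "grad_inner g c h k x = grad g h c x \<bullet> coord_grad c k x"
  unfolding grad_inner_def grad_eq
  using symmetric_inner_commute[OF metric_inv_posdef(1)[OF assms]] by (metis inner_commute)

end

section \<open>The weighted measure\<close>

lemma continuous_on_zero_outside:
  fixes h :: "'a::topological_space \<Rightarrow> real"
  assumes "open U" "closed K" "K \<subseteq> U" "continuous_on U h" "\<And>y. y \<notin> K \<Longrightarrow> h y = 0"
  shows "continuous_on UNIV h"
proof -
  have "continuous_on (- K) h"
    using assms(5) by (subst continuous_on_cong[OF refl, of _ _ "\<lambda>_. 0"]) auto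
  then have "continuous_on (U \<union> - K) h"
    using assms by (intro continuous_on_open_Un) auto
  moreover have "U \<union> - K = UNIV" using assms by auto
  ultimately show ?thesis by simp
qed

text \<open>The density of the weighted measure is smooth and positive in every chart. Two consequences are
  used: continuous functions are integrable, and a nonnegative continuous function with integral
  zero vanishes everywhere.\<close>

locale weighted_closed_manifold = closed_riemannian_manifold A g vol
  for A :: "('m::t2_space, 'n::finite) chart set" and g vol +
  fixes f :: "'m \<Rightarrow> real"
  assumes weight_smooth: "smooth_function A f"
begin

abbreviation "\<mu> \<equiv> weighted_measure vol f"

definition density_in :: "('m, 'n) chart \<Rightarrow> real ^ 'n \<Rightarrow> real" where
  "density_in c y = sqrt (det (g c (chart_inv c y))) * exp (- f (chart_inv c y))"

lemma weight_C1: "C1_function A f"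
  by (rule smooth_function_C1[OF weight_smooth])

lemma weight_continuous: "continuous_on UNIV f"
  by (rule C1_function_continuous[OF weight_C1])

lemma density_in_C1: "c \<in> A \<Longrightarrow> C1_on (chart_img c) (density_in c)"
  unfolding density_in_def
  by (intro C1_on_mult C1_on_volume_density C1_on_exp C1_on_minus) (use weight_C1 in \<open>auto simp: C1_function_def\<close>)

lemma density_in_pos: "c \<in> A \<Longrightarrow> y \<in> chart_img c \<Longrightarrow> density_in c y > 0"
  using metric_det_pos chart_inv_in by (auto simp: density_in_def)

lemma borel_chart: "c \<in> A \<Longrightarrow> fst c \<in> sets borel" "c \<in> A \<Longrightarrow> chart_img c \<in> sets borel"
  using open_chart by auto

lemma space_vol: "space vol = UNIV"
  using sets_eq_imp_space_eq[OF sets_vol] by simp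

lemma sets_weighted: "sets \<mu> = sets borel"
  by (simp add: weighted_measure_def sets_vol)

lemma space_weighted: "space \<mu> = UNIV"
  using sets_eq_imp_space_eq[OF sets_weighted] by simp

lemma borel_measurable_continuous: "continuous_on UNIV (F :: 'm \<Rightarrow> real) \<Longrightarrow> F \<in> borel_measurable \<mu>"
  using borel_measurable_continuous_onI measurable_cong_sets[OF sets_weighted refl] by blast

lemma borel_measurable_weight: "(\<lambda>x. exp (- f x)) \<in> borel_measurable vol"
proof -
  have "(\<lambda>x. exp (- f x)) \<in> borel_measurable borel"
    by (intro borel_measurable_continuous_onI continuous_intros weight_continuous)
  then show ?thesis using measurable_cong_sets[OF sets_vol refl] by blast
qed

lemma chart_inv_measurable:
  assumes c: "c \<in> A"
  shows "chart_inv c \<in> measurable (restrict_space lborel (chart_img c)) (restrict_space borel (fst c))"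
  by (rule measurable_restrict_space2)
    (use chart_inv_in[OF c] borel_measurable_continuous_on_restrict[OF continuous_on_chart(2)[OF c]] in
      \<open>auto simp: space_restrict_space cong: measurable_cong_sets restrict_space_sets_cong\<close>)

lemma volume_density_measurable:
  assumes c: "c \<in> A"
  shows "(\<lambda>y. sqrt (det (g c (chart_inv c y)))) \<in> borel_measurable (restrict_space lborel (chart_img c))"
  using borel_measurable_continuous_on_restrict[OF C1_on_imp_continuous_on[OF C1_on_volume_density[OF c]]]
  by (auto cong: measurable_cong_sets restrict_space_sets_cong)

lemma vol_in_chart:
  assumes c: "c \<in> A"
  shows "restrict_space vol (fst c) =
    distr (density (restrict_space lborel (chart_img c)) (\<lambda>y. ennreal (sqrt (det (g c (chart_inv c y))))))
      (restrict_space borel (fst c)) (chart_inv c)" (is "_ = distr (density ?R ?w) _ _")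
proof (rule measure_eqI)
  note inv = chart_inv_measurable[OF c]
  have w: "?w \<in> borel_measurable ?R" using volume_density_measurable[OF c] by simp
  show "sets (restrict_space vol (fst c)) = sets (distr (density ?R ?w) (restrict_space borel (fst c)) (chart_inv c))"
    by (simp add: sets_restrict_space_cong[OF sets_vol])
  fix B assume "B \<in> sets (restrict_space vol (fst c))"
  then have B: "B \<in> sets borel" "B \<subseteq> fst c" "B \<in> sets (restrict_space borel (fst c))"
    using borel_chart[OF c] by (auto simp: sets_restrict_space_iff space_vol sets_vol)
  let ?P = "chart_inv c -` B \<inter> chart_img c"
  have P: "?P = snd c ` B"
    using B c by (auto simp: image_iff chart_chart_inv)
  have Pm: "?P \<in> sets ?R"
    using measurable_sets[OF inv B(3)] by (simp add: space_restrict_space)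
  have "emeasure (restrict_space vol (fst c)) B = emeasure vol B"
    using borel_chart[OF c] B by (intro emeasure_restrict_space) (auto simp: sets_vol space_vol)
  also have "\<dots> = (\<integral>\<^sup>+ y. ?w y * indicator (snd c ` B) y \<partial>lborel)"
    using emeasure_vol[OF c B(1,2)] by simp
  also have "\<dots> = (\<integral>\<^sup>+ y. ?w y * indicator ?P y * indicator (chart_img c) y \<partial>lborel)"
    unfolding P using B(2) by (intro nn_integral_cong) (auto simp: indicator_def)
  also have "\<dots> = (\<integral>\<^sup>+ y. ?w y * indicator ?P y \<partial>?R)"
    using borel_chart[OF c] by (subst nn_integral_restrict_space) auto
  also have "\<dots> = emeasure (density ?R ?w) ?P"
    by (rule emeasure_density[symmetric, OF w Pm])
  also have "\<dots> = emeasure (distr (density ?R ?w) (restrict_space borel (fst c)) (chart_inv c)) B"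
    using inv B(3) by (subst emeasure_distr) (auto simp: space_restrict_space)
  finally show "emeasure (restrict_space vol (fst c)) B = \<dots>" .
qed

lemma integral_in_chart:
  fixes F :: "'m \<Rightarrow> real"
  assumes c: "c \<in> A" and F: "F \<in> borel_measurable borel" and supp: "\<And>x. x \<notin> fst c \<Longrightarrow> F x = 0"
  shows "(\<integral>x. F x \<partial>\<mu>) = (\<integral>y. indicator (chart_img c) y * (density_in c y * F (chart_inv c y)) \<partial>lborel)"
proof -
  let ?R = "restrict_space lborel (chart_img c)" and ?w = "\<lambda>y. sqrt (det (g c (chart_inv c y)))"
  define E where "E x = exp (- f x) * F x" for x
  have expf: "(\<lambda>x. exp (- f x)) \<in> borel_measurable borel"
    by (intro borel_measurable_continuous_onI continuous_intros weight_continuous)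
  have E: "E \<in> borel_measurable borel" unfolding E_def using expf F by measurable
  have Ec: "E \<in> borel_measurable (restrict_space borel (fst c))"
    by (rule measurable_restrict_space1[OF E])
  note inv = chart_inv_measurable[OF c] and w = volume_density_measurable[OF c]
  have Einv: "(\<lambda>y. E (chart_inv c y)) \<in> borel_measurable ?R"
    using measurable_compose[OF inv Ec] .
  have "(\<integral>x. F x \<partial>\<mu>) = (\<integral>x. E x \<partial>vol)"
    unfolding weighted_measure_def E_def
    by (subst integral_density) (use F expf measurable_cong_sets[OF sets_vol refl] in auto)
  also have "\<dots> = (\<integral>x. indicator (fst c) x *\<^sub>R E x \<partial>vol)"
    using supp by (intro Bochner_Integration.integral_cong) (auto simp: E_def indicator_def)
  also have "\<dots> = (\<integral>x. E x \<partial>restrict_space vol (fst c))"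
    using borel_chart[OF c] by (subst integral_restrict_space) (auto simp: sets_vol space_vol)
  also have "\<dots> = (\<integral>y. E (chart_inv c y) \<partial>density ?R (\<lambda>y. ennreal (?w y)))"
    unfolding vol_in_chart[OF c] by (rule integral_distr) (use inv Ec in auto)
  also have "\<dots> = (\<integral>y. ?w y *\<^sub>R E (chart_inv c y) \<partial>?R)"
    by (rule integral_density[OF Einv w])
      (use metric_det_pos[OF c chart_inv_in[OF c]] borel_chart[OF c] in \<open>auto intro!: AE_I2 simp: space_restrict_space less_imp_le\<close>)
  also have "\<dots> = (\<integral>y. indicator (chart_img c) y *\<^sub>R (?w y *\<^sub>R E (chart_inv c y)) \<partial>lborel)"
    using borel_chart[OF c] by (subst integral_restrict_space) auto
  finally show ?thesis by (simp add: E_def density_in_def mult.assoc)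
qed

text \<open>The density is bounded on closed coordinate balls, and finitely many of these cover the manifold.\<close>

lemma finite_weighted_measure: "finite_measure \<mu>"
proof -
  have loc: "\<exists>W. open W \<and> x \<in> W \<and> emeasure vol W < \<infinity>" for x
  proof -
    let ?c = "chart_at A x"
    let ?w = "\<lambda>y. sqrt (det (g ?c (chart_inv ?c y)))"
    note c = chart_at_in(1)[of x] and x = chart_at_in(2)[of x]
    obtain r where r: "r > 0" "cball (snd ?c x) r \<subseteq> chart_img ?c"
      using open_chart(2)[OF c] x open_contains_cball by blast
    let ?V = "ball (snd ?c x) r"
    let ?W = "chart_inv ?c ` ?V"
    have V: "?V \<subseteq> chart_img ?c" using r ball_subset_cball by blast
    have W: "open ?W" "?W \<subseteq> fst ?c" "snd ?c ` ?W = ?V"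
      using open_chart_inv_image[OF c _ V] V chart_inv_in[OF c] chart_chart_inv[OF c]
      by (auto simp: image_image subset_eq cong: image_cong_simp)
    have xW: "x \<in> ?W" using r chart_inv_chart[OF c x] by (intro image_eqI[of _ _ "snd ?c x"]) auto
    have "continuous_on (cball (snd ?c x) r) ?w"
      using C1_on_imp_continuous_on[OF C1_on_volume_density[OF c]] r continuous_on_subset by blast
    then have "bounded (?w ` cball (snd ?c x) r)"
      by (intro compact_imp_bounded compact_continuous_image) auto
    then obtain C where "\<forall>z\<in>?w ` cball (snd ?c x) r. norm z \<le> C" unfolding bounded_iff by blast
    then have "norm (?w y) \<le> C" if "y \<in> cball (snd ?c x) r" for y using that by blast
    then have C: "?w y \<le> C" if "y \<in> cball (snd ?c x) r" for y
      using that by (metis abs_le_D1 real_norm_def)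
    have "emeasure vol ?W = (\<integral>\<^sup>+ y. ennreal (?w y) * indicator ?V y \<partial>lborel)"
      using emeasure_vol[OF c, of ?W] W by simp
    also have "\<dots> \<le> (\<integral>\<^sup>+ y. ennreal C * indicator ?V y \<partial>lborel)"
      using C by (intro nn_integral_mono) (auto simp: indicator_def intro!: ennreal_leI)
    also have "\<dots> = ennreal C * emeasure lborel ?V" by (simp add: nn_integral_cmult_indicator)
    also have "\<dots> < \<infinity>" using emeasure_lborel_ball_finite[of "snd ?c x" r] by (simp add: ennreal_mult_less_top)
    finally show ?thesis using W(1) xW by blast
  qed
  then obtain W where W: "\<And>x. open (W x)" "\<And>x. x \<in> W x" "\<And>x. emeasure vol (W x) < \<infinity>" by metis
  obtain D where D: "finite D" "UNIV \<subseteq> (\<Union>x\<in>D. W x)"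
  proof (rule compactE_image[OF compact_UNIV, of UNIV W])
    show "UNIV \<subseteq> (\<Union>x\<in>UNIV. W x)" using W(2) by blast
  qed (use W(1) in blast)+
  have Wm: "W x \<in> sets vol" for x using W by (simp add: sets_vol)
  have "emeasure vol UNIV \<le> emeasure vol (\<Union>x\<in>D. W x)"
    using D Wm by (intro emeasure_mono) auto
  also have "\<dots> \<le> (\<Sum>x\<in>D. emeasure vol (W x))"
    by (rule emeasure_subadditive_finite) (use D Wm in auto)
  also have "\<dots> < \<infinity>" using W D by simp
  finally have vol_fin: "emeasure vol UNIV < \<infinity>" .
  have cont: "continuous_on UNIV (\<lambda>x. exp (- f x))" by (intro continuous_intros weight_continuous)
  obtain C where C: "\<And>x. exp (- f x) \<le> C"
    using compact_imp_bounded[OF compact_continuous_image[OF cont compact_UNIV]] unfolding bounded_iff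
    by auto
  have "emeasure \<mu> UNIV = (\<integral>\<^sup>+ x. ennreal (exp (- f x)) * indicator UNIV x \<partial>vol)"
    unfolding weighted_measure_def
    by (rule emeasure_density) (use borel_measurable_weight in \<open>auto simp: sets_vol\<close>)
  also have "\<dots> \<le> (\<integral>\<^sup>+ x. ennreal C * indicator UNIV x \<partial>vol)"
    using C by (intro nn_integral_mono) (auto intro!: ennreal_leI)
  also have "\<dots> = ennreal C * emeasure vol UNIV"
    by (rule nn_integral_cmult_indicator) (simp add: sets_vol)
  also have "\<dots> < \<infinity>" using vol_fin by (simp add: ennreal_mult_less_top)
  finally show ?thesis by (intro finite_measureI) (auto simp: space_weighted)
qed

lemma continuous_bounded:
  fixes F :: "'m \<Rightarrow> real"
  assumes "continuous_on UNIV F" obtains C where "\<And>x. \<bar>F x\<bar> \<le> C"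
  using compact_imp_bounded[OF compact_continuous_image[OF assms compact_UNIV]] unfolding bounded_iff by auto

lemma integrable_continuous:
  fixes F :: "'m \<Rightarrow> real"
  assumes "continuous_on UNIV F" shows "integrable \<mu> F"
proof -
  interpret finite_measure \<mu> by (rule finite_weighted_measure)
  obtain C where "\<And>x. \<bar>F x\<bar> \<le> C" using continuous_bounded[OF assms] by blast
  then show ?thesis by (intro integrable_const_bound[of _ C] borel_measurable_continuous assms) auto
qed

lemma open_emeasure_pos:
  assumes "open W" "W \<noteq> {}" shows "emeasure vol W \<noteq> 0"
proof -
  obtain x where x: "x \<in> W" using assms by auto
  let ?c = "chart_at A x"
  let ?w = "\<lambda>y. sqrt (det (g ?c (chart_inv ?c y)))"
  note c = chart_at_in(1)[of x] and xc = chart_at_in(2)[of x]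
  let ?U = "W \<inter> fst ?c"
  have U: "open ?U" "?U \<subseteq> fst ?c" "x \<in> ?U" using assms open_chart[OF c] x xc by auto
  have V: "open (snd ?c ` ?U)" by (rule open_chart_image[OF c U(1,2)])
  have img: "snd ?c ` ?U \<subseteq> chart_img ?c" by auto
  have wm: "(\<lambda>y. ennreal (?w y) * indicator (snd ?c ` ?U) y) \<in> borel_measurable lborel"
  proof -
    have "continuous_on (snd ?c ` ?U) ?w"
      using C1_on_imp_continuous_on[OF C1_on_volume_density[OF c]] img continuous_on_subset by blast
    then have "(\<lambda>y. ennreal (indicator (snd ?c ` ?U) y *\<^sub>R ?w y)) \<in> borel_measurable borel"
      using V by (intro measurable_compose[OF borel_measurable_continuous_on_indicator measurable_ennreal]) auto
    also have "(\<lambda>y. ennreal (indicator (snd ?c ` ?U) y *\<^sub>R ?w y)) = (\<lambda>y. ennreal (?w y) * indicator (snd ?c ` ?U) y)"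
      by (auto simp: indicator_def fun_eq_iff)
    finally show ?thesis by simp
  qed
  have "emeasure vol ?U \<noteq> 0"
  proof
    assume "emeasure vol ?U = 0"
    then have "(\<integral>\<^sup>+ y. ennreal (?w y) * indicator (snd ?c ` ?U) y \<partial>lborel) = 0"
      using emeasure_vol[OF c, of ?U] U by simp
    then have "AE y in lborel. ennreal (?w y) * indicator (snd ?c ` ?U) y = 0"
      using wm by (simp add: nn_integral_0_iff_AE)
    moreover have "ennreal (?w y) * indicator (snd ?c ` ?U) y = 0 \<longleftrightarrow> y \<notin> snd ?c ` ?U" for y
      using metric_det_pos[OF c chart_inv_in[OF c], of y] img by (auto simp: indicator_def)
    ultimately have "AE y in lborel. y \<notin> snd ?c ` ?U" by simp
    then have "emeasure lborel (snd ?c ` ?U) = 0" using V by (subst (asm) AE_iff_measurable[OF _ refl]) auto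
    then have "snd ?c ` ?U \<in> null_sets (completion lborel)" using V by (intro null_sets_completionI null_setsI) auto
    then show False using V U open_not_negligible[of "snd ?c ` ?U"] by (auto simp: negligible_iff_null_sets)
  qed
  moreover have "emeasure vol ?U \<le> emeasure vol W"
    using assms by (intro emeasure_mono) (auto simp: sets_vol)
  ultimately show ?thesis by auto
qed

lemma continuous_nonneg_integral_zero:
  fixes F :: "'m \<Rightarrow> real"
  assumes cont: "continuous_on UNIV F" and nonneg: "\<And>x. F x \<ge> 0" and int: "(\<integral>x. F x \<partial>\<mu>) = 0"
  shows "F x = 0"
proof (rule ccontr)
  assume "F x \<noteq> 0"
  define E where "E x = exp (- f x) * F x" for x
  have Ec: "continuous_on UNIV E" unfolding E_def by (intro continuous_intros weight_continuous cont)
  let ?W = "E -` {0<..}"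
  have W: "open ?W" using Ec by (intro open_vimage) auto
  have "x \<in> ?W" using \<open>F x \<noteq> 0\<close> nonneg[of x] by (simp add: E_def)
  have "AE x in \<mu>. F x = 0"
    using integral_nonneg_eq_0_iff_AE[OF integrable_continuous[OF cont]] nonneg int by auto
  then have "AE x in vol. F x = 0"
    unfolding weighted_measure_def
    by (subst (asm) AE_density)
      (use borel_measurable_weight in auto)
  then have "AE x in vol. x \<notin> ?W" by eventually_elim (simp add: E_def)
  moreover have "{x \<in> space vol. \<not> x \<notin> ?W} = ?W" "?W \<in> sets vol" using W by (auto simp: sets_vol space_vol)
  ultimately have "emeasure vol ?W = 0" using AE_iff_measurable[of ?W vol "\<lambda>x. x \<notin> ?W"] by blast
  then show False using open_emeasure_pos[OF W] \<open>x \<in> ?W\<close> by blast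
qed

end

section \<open>Green's formula in a chart\<close>

lemma C1_on_zero_extension:
  fixes h :: "'a::euclidean_space \<Rightarrow> real"
  assumes "open U" "closed K" "K \<subseteq> U" "C1_on U h" "\<And>y. y \<in> U - K \<Longrightarrow> h y = 0"
  shows "C1_on UNIV (\<lambda>y. if y \<in> U then h y else 0)"
proof (rule C1_on_local)
  fix y :: 'a
  show "\<exists>V k. open V \<and> y \<in> V \<and> C1_on V k \<and> (\<forall>z\<in>UNIV \<inter> V. (if z \<in> U then h z else 0) = k z)"
  proof (cases "y \<in> U")
    case True
    then show ?thesis using assms by (intro exI[of _ U] exI[of _ h]) auto
  next
    case False
    then show ?thesis using assms by (intro exI[of _ "- K"] exI[of _ "\<lambda>_. 0"]) auto
  qed
qed simp

text \<open>The product \<open>\<phi> Y\<close>, extended by zero, is continuously differentiable with compact support, so its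
  directional derivative has integral zero.\<close>

lemma integration_by_parts_compact_support:
  fixes \<phi> Y :: "'a::euclidean_space \<Rightarrow> real"
  assumes U: "open U" and K: "compact K" "K \<subseteq> U"
    and \<phi>: "C1_on U \<phi>" "\<And>y. y \<in> U - K \<Longrightarrow> \<phi> y = 0" and Y: "C1_on U Y"
  shows "integrable lborel (\<lambda>y. indicator U y * (\<phi> y * frechet_derivative Y (at y) e))" (is "integrable _ ?L")
    and "integrable lborel (\<lambda>y. indicator U y * (Y y * frechet_derivative \<phi> (at y) e))" (is "integrable _ ?R")
    and "(\<integral>y. indicator U y * (\<phi> y * frechet_derivative Y (at y) e) \<partial>lborel)
       = - (\<integral>y. indicator U y * (Y y * frechet_derivative \<phi> (at y) e) \<partial>lborel)"
proof -
  \<comment> \<open>The two integrands add up to a directional derivative of this function.\<close>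
  define F where "F y = (if y \<in> U then \<phi> y * Y y else 0)" for y
  note clK = compact_imp_closed[OF K(1)]
  have F: "C1_on UNIV F"
    unfolding F_def by (rule C1_on_zero_extension[OF U clK K(2)]) (use \<phi> Y in \<open>auto intro: C1_on_mult\<close>)
  have F0: "F y = 0" if "y \<notin> K" for y using that \<phi>(2) by (auto simp: F_def)
  have dF: "frechet_derivative F (at y) e = \<phi> y * frechet_derivative Y (at y) e + Y y * frechet_derivative \<phi> (at y) e"
    if y: "y \<in> U" for y
  proof -
    have "((\<lambda>y. \<phi> y * Y y) has_derivative
        (\<lambda>v. \<phi> y * frechet_derivative Y (at y) v + frechet_derivative \<phi> (at y) v * Y y)) (at y)"
      using C1_on_has_derivative[OF \<phi>(1) y] C1_on_has_derivative[OF Y y] by (rule has_derivative_mult)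
    then have "(F has_derivative (\<lambda>v. \<phi> y * frechet_derivative Y (at y) v + frechet_derivative \<phi> (at y) v * Y y)) (at y)"
      by (rule has_derivative_transform_within_open[OF _ U y]) (simp add: F_def)
    from frechet_derivative_at[OF this, symmetric] show ?thesis by (simp add: mult.commute)
  qed
  have F1: "frechet_derivative F (at y) e = 0" if "y \<notin> K" for y
  proof -
    have "(F has_derivative (\<lambda>v. 0)) (at y)"
      by (rule has_derivative_transform_within_open[OF has_derivative_const[of 0] _ , where s = "- K"])
        (use that F0 clK in auto)
    from frechet_derivative_at[OF this, symmetric] show ?thesis by simp
  qed
  show L: "integrable lborel ?L"
  proof (rule integrable_lborel_compact_support[OF K(1)])
    have "continuous_on U ?L"
      using C1_on_imp_continuous_on[OF \<phi>(1)] C1_on_continuous_derivative[OF Y]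
      by (subst continuous_on_cong[OF refl, of _ _ "\<lambda>y. \<phi> y * frechet_derivative Y (at y) e"])
        (auto intro!: continuous_intros)
    then show "continuous_on UNIV ?L"
      by (rule continuous_on_zero_outside[OF U clK K(2)]) (use \<phi> in \<open>auto simp: indicator_def\<close>)
  qed (use \<phi> in \<open>auto simp: indicator_def\<close>)
  have sum: "?L y + ?R y = frechet_derivative F (at y) e" for y
    using dF[of y] F1[of y] K(2) by (auto simp: indicator_def)
  note FI = integral_directional_derivative_compact_support[OF F K(1) F0, of e]
  have R_eq: "?R = (\<lambda>y. frechet_derivative F (at y) e - ?L y)"
    using sum by (simp add: fun_eq_iff algebra_simps)
  show "integrable lborel ?R" unfolding R_eq using FI(1) L by (rule Bochner_Integration.integrable_diff)
  show "integral\<^sup>L lborel ?L = - integral\<^sup>L lborel ?R"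
    unfolding R_eq using FI L by (simp add: Bochner_Integration.integral_diff)
qed

context weighted_closed_manifold
begin

text \<open>The divergence is defined with a chart chosen separately at every point. For integrals and for
  continuity the chart has to stay the same in a neighbourhood; \<open>chart_laplacian_unique\<close> will show
  that the value is the same.\<close>

definition chart_laplacian :: "real \<Rightarrow> ('m \<Rightarrow> real) \<Rightarrow> ('m, 'n) chart \<Rightarrow> 'm \<Rightarrow> real" where
  "chart_laplacian p h c x = exp (f x) *
     ((\<Sum>i\<in>UNIV. coord_deriv c i (\<lambda>z. sqrt (det (g c z)) * (exp (- f z) *\<^sub>R p_flux g p h c z) $ i) x)
       / sqrt (det (g c x)))"

lemma p_laplacian_chart_at: "p_laplacian A g f p h x = chart_laplacian p h (chart_at A x) x"
  by (simp add: p_laplacian_def weighted_div_def divergence_def chart_laplacian_def Let_def)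

text \<open>The inner product of \<open>|\<nabla>h|^(p-2) \<nabla>h\<close> with \<open>\<nabla>\<phi>\<close>.\<close>

definition flux_pairing :: "real \<Rightarrow> ('m \<Rightarrow> real) \<Rightarrow> ('m \<Rightarrow> real) \<Rightarrow> 'm \<Rightarrow> real" where
  "flux_pairing p h \<phi> x = abs_pow (sqrt (ginner h h x)) (p - 2) * ginner h \<phi> x"

lemma p_laplacian_dom_iff:
  "p_laplacian_dom A g p h \<longleftrightarrow>
    C1_function A h \<and> (\<forall>c\<in>A. C1_on (chart_img c) (\<lambda>y. p_flux g p h c (chart_inv c y)))"
  by (auto simp: p_laplacian_dom_def C1_function_def C1_on_def o_def)

lemma flux_pairing_in_chart:
  assumes h: "C1_function A h" and k: "C1_function A k" and c: "c \<in> A" and x: "x \<in> fst c"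
  shows "flux_pairing p h k x = p_flux g p h c x \<bullet> coord_grad c k x"
  unfolding flux_pairing_def ginner_eq[OF h h c x] ginner_eq[OF h k c x] p_flux_def metric_norm_grad[OF c x]
  using grad_inner_eq_grad[OF c x] by simp

lemma continuous_flux_pairing:
  assumes h: "p_laplacian_dom A g p h" and k: "C1_function A k"
  shows "continuous_on UNIV (flux_pairing p h k)"
proof (rule continuous_on_chartwise)
  fix c assume c: "c \<in> A"
  have "continuous_on (chart_img c) (\<lambda>y. p_flux g p h c (chart_inv c y) \<bullet> coord_grad c k (chart_inv c y))"
    using h k c by (intro continuous_on_inner continuous_on_coord_grad C1_on_imp_continuous_on)
      (auto simp: p_laplacian_dom_iff)
  then show "continuous_on (chart_img c) (\<lambda>y. flux_pairing p h k (chart_inv c y))"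
    using flux_pairing_in_chart[OF _ k c chart_inv_in[OF c]] h
    by (subst continuous_on_cong[OF refl]) (auto simp: p_laplacian_dom_iff)
qed

text \<open>The coordinate divergence of these components is the p-Laplacian times the density of the
  measure (\<open>chart_laplacian_weighted_flux\<close>), which turns integrals over the chart into Lebesgue
  integrals of a divergence.\<close>

definition weighted_flux :: "real \<Rightarrow> ('m \<Rightarrow> real) \<Rightarrow> ('m, 'n) chart \<Rightarrow> 'n \<Rightarrow> real ^ 'n \<Rightarrow> real" where
  "weighted_flux p h c i y = density_in c y * p_flux g p h c (chart_inv c y) $ i"

lemma weighted_flux_C1:
  assumes "p_laplacian_dom A g p h" "c \<in> A" shows "C1_on (chart_img c) (weighted_flux p h c i)"
  unfolding weighted_flux_def
  by (intro C1_on_mult density_in_C1 C1_on_vec_nth assms) (use assms in \<open>auto simp: p_laplacian_dom_iff\<close>)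

lemma chart_laplacian_weighted_flux:
  assumes "c \<in> A" "y \<in> chart_img c"
  shows "density_in c y * chart_laplacian p h c (chart_inv c y) =
    (\<Sum>i\<in>UNIV. frechet_derivative (weighted_flux p h c i) (at y) (axis i 1))"
proof -
  have "(\<lambda>z. sqrt (det (g c z)) * (exp (- f z) *\<^sub>R p_flux g p h c z) $ i) \<circ> chart_inv c = weighted_flux p h c i" for i
    by (simp add: weighted_flux_def[abs_def] density_in_def o_def mult.assoc)
  then show ?thesis
    using metric_det_pos[OF assms(1) chart_inv_in[OF assms]]
    by (simp add: chart_laplacian_def density_in_def coord_deriv_def chart_chart_inv[OF assms] exp_minus)
qed

lemma continuous_on_chart_laplacian:
  assumes h: "p_laplacian_dom A g p h" and c: "c \<in> A"
  shows "continuous_on (fst c) (chart_laplacian p h c)"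
proof -
  have "continuous_on (chart_img c)
      (\<lambda>y. (\<Sum>i\<in>UNIV. frechet_derivative (weighted_flux p h c i) (at y) (axis i 1)) / density_in c y)"
    using C1_on_continuous_derivative[OF weighted_flux_C1[OF h c]] C1_on_imp_continuous_on[OF density_in_C1[OF c]]
      density_in_pos[OF c] by (intro continuous_intros) force+
  then have "continuous_on (chart_img c) (\<lambda>y. chart_laplacian p h c (chart_inv c y))"
    by (rule continuous_on_cong[THEN iffD1, OF refl, rotated])
      (use chart_laplacian_weighted_flux[OF c] density_in_pos[OF c] in \<open>force simp: divide_simps mult.commute\<close>)
  then have "continuous_on (fst c) (\<lambda>x. chart_laplacian p h c (chart_inv c (snd c x)))"
    using continuous_on_compose2[OF _ continuous_on_chart(1)[OF c]] by blast
  then show ?thesis using c by (subst (asm) continuous_on_cong[OF refl, of _ _ "chart_laplacian p h c"]) auto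
qed

lemma compact_chart_image: "c \<in> A \<Longrightarrow> compact K \<Longrightarrow> K \<subseteq> fst c \<Longrightarrow> compact (snd c ` K)"
  by (rule compact_continuous_image[OF continuous_on_subset[OF continuous_on_chart(1)]])

lemma integration_by_parts_in_chart:
  assumes h: "p_laplacian_dom A g p h" and \<phi>: "C1_function A \<phi>" and c: "c \<in> A"
    and K: "compact K" "K \<subseteq> fst c" and supp: "\<And>x. x \<notin> K \<Longrightarrow> \<phi> x = 0"
  shows "continuous_on UNIV (\<lambda>x. \<phi> x * chart_laplacian p h c x)"
    and "(\<integral>x. \<phi> x * chart_laplacian p h c x \<partial>\<mu>) = - (\<integral>x. flux_pairing p h \<phi> x \<partial>\<mu>)"
proof -
  let ?U = "chart_img c" and ?\<phi> = "\<lambda>y. \<phi> (chart_inv c y)" and ?Y = "weighted_flux p h c"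
  have clK: "closed K" using K(1) by (rule compact_imp_closed)
  have h1: "C1_function A h" using h by (simp add: p_laplacian_dom_iff)
  show cont: "continuous_on UNIV (\<lambda>x. \<phi> x * chart_laplacian p h c x)"
    by (rule continuous_on_zero_outside[OF open_chart(1)[OF c] clK K(2)])
      (use supp continuous_on_chart_laplacian[OF h c] continuous_on_subset[OF C1_function_continuous[OF \<phi>]]
        in \<open>auto intro!: continuous_intros\<close>)
  have suppU: "?\<phi> y = 0" if "y \<in> ?U - snd c ` K" for y
  proof (rule supp)
    show "chart_inv c y \<notin> K"
    proof
      assume "chart_inv c y \<in> K"
      then have "snd c (chart_inv c y) \<in> snd c ` K" by blast
      with that show False using chart_chart_inv[OF c, of y] by simp
    qed
  qed
  have \<phi>1: "C1_on ?U ?\<phi>" using \<phi> c by (simp add: C1_function_def)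
  have KU: "snd c ` K \<subseteq> ?U" using K(2) by blast
  note ibp = integration_by_parts_compact_support
    [OF open_chart(2)[OF c] compact_chart_image[OF c K] KU \<phi>1 suppU weighted_flux_C1[OF h c]]
  \<comment> \<open>The pairing vanishes off the support of \<open>\<phi>\<close>, so that its integral can be computed in \<open>c\<close>.\<close>
  have pairing0: "flux_pairing p h \<phi> x = 0" if "x \<notin> K" for x
  proof -
    let ?d = "chart_at A x"
    let ?V = "snd ?d ` (fst ?d - K)"
    note d = chart_at_in[of x]
    have V: "open ?V" using open_chart_image[OF d(1) open_Diff[OF open_chart(1)[OF d(1)] clK]] by blast
    have z: "\<phi> (chart_inv ?d y) = 0" if "y \<in> ?V" for y
      using that d(1) supp by auto
    have "((\<lambda>y. \<phi> (chart_inv ?d y)) has_derivative (\<lambda>v. 0)) (at (snd ?d x))"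
      by (rule has_derivative_transform_within_open[OF has_derivative_const[of 0] V]) (use that d z in auto)
    from frechet_derivative_at[OF this, symmetric]
    have "coord_grad ?d \<phi> x = 0" by (simp add: coord_grad_def coord_deriv_def o_def vec_eq_iff)
    then show ?thesis by (simp add: flux_pairing_def grad_inner_def)
  qed
  have "(\<integral>x. \<phi> x * chart_laplacian p h c x \<partial>\<mu>)
      = (\<integral>y. indicator ?U y * (density_in c y * (?\<phi> y * chart_laplacian p h c (chart_inv c y))) \<partial>lborel)"
    by (rule integral_in_chart[OF c borel_measurable_continuous_onI[OF cont]]) (use supp K(2) in auto)
  also have "\<dots> = (\<integral>y. (\<Sum>i\<in>UNIV. indicator ?U y * (?\<phi> y * frechet_derivative (?Y i) (at y) (axis i 1))) \<partial>lborel)"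
  proof (intro Bochner_Integration.integral_cong refl)
    fix y
    show "indicator ?U y * (density_in c y * (?\<phi> y * chart_laplacian p h c (chart_inv c y)))
       = (\<Sum>i\<in>UNIV. indicator ?U y * (?\<phi> y * frechet_derivative (?Y i) (at y) (axis i 1)))"
      using chart_laplacian_weighted_flux[OF c, of y p h]
      by (cases "y \<in> ?U") (auto simp: sum_distrib_left[symmetric] mult.left_commute)
  qed
  also have "\<dots> = (\<Sum>i\<in>UNIV. - (\<integral>y. indicator ?U y * (?Y i y * frechet_derivative ?\<phi> (at y) (axis i 1)) \<partial>lborel))"
    using ibp by (subst Bochner_Integration.integral_sum) auto
  also have "\<dots> = - (\<integral>y. (\<Sum>i\<in>UNIV. indicator ?U y * (?Y i y * frechet_derivative ?\<phi> (at y) (axis i 1))) \<partial>lborel)"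
    using ibp by (subst Bochner_Integration.integral_sum) (auto simp: sum_negf)
  also have "(\<integral>y. (\<Sum>i\<in>UNIV. indicator ?U y * (?Y i y * frechet_derivative ?\<phi> (at y) (axis i 1))) \<partial>lborel)
      = (\<integral>y. indicator ?U y * (density_in c y * flux_pairing p h \<phi> (chart_inv c y)) \<partial>lborel)"
  proof (intro Bochner_Integration.integral_cong refl)
    fix y
    show "(\<Sum>i\<in>UNIV. indicator ?U y * (?Y i y * frechet_derivative ?\<phi> (at y) (axis i 1)))
      = indicator ?U y * (density_in c y * flux_pairing p h \<phi> (chart_inv c y))"
    proof (cases "y \<in> ?U")
      case True
      have "frechet_derivative ?\<phi> (at y) (axis i 1) = coord_grad c \<phi> (chart_inv c y) $ i" for i
        using chart_chart_inv[OF c True] by (simp add: coord_grad_def coord_deriv_def o_def)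
      then show ?thesis using True
        by (simp add: flux_pairing_in_chart[OF h1 \<phi> c chart_inv_in[OF c True]] weighted_flux_def inner_vec_def
            sum_distrib_left mult.assoc)
    qed simp
  qed
  also have "\<dots> = (\<integral>x. flux_pairing p h \<phi> x \<partial>\<mu>)"
    by (rule integral_in_chart[OF c borel_measurable_continuous_onI[OF continuous_flux_pairing[OF h \<phi>]], symmetric])
      (use pairing0 K(2) in auto)
  finally show "(\<integral>x. \<phi> x * chart_laplacian p h c x \<partial>\<mu>) = - (\<integral>x. flux_pairing p h \<phi> x \<partial>\<mu>)" .
qed

end

section \<open>Green's formula on the manifold\<close>

lemma has_derivative_pos_part_square:
  "((\<lambda>s::real. (max 0 s)\<^sup>2) has_real_derivative 2 * max 0 s) (at s)"
proof -
  consider "s < 0" | "s > 0" | "s = 0" by linarith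
  then show ?thesis
  proof cases
    case 1
    have "((\<lambda>s::real. 0) has_real_derivative 2 * max 0 s) (at s)" using 1 by simp
    then show ?thesis by (rule has_field_derivative_transform_within_open[of _ _ _ "{..<0}"]) (use 1 in auto)
  next
    case 2
    have "((\<lambda>s::real. s\<^sup>2) has_real_derivative 2 * max 0 s) (at s)"
      using 2 by (auto intro!: derivative_eq_intros)
    then show ?thesis by (rule has_field_derivative_transform_within_open[of _ _ _ "{0<..}"]) (use 2 in auto)
  next
    case 3
    have "((\<lambda>h::real. (max 0 h)\<^sup>2 / h) \<longlongrightarrow> 0) (at 0)"
    proof (rule Lim_null_comparison[of _ "\<lambda>h. \<bar>h\<bar>"])
      show "\<forall>\<^sub>F h::real in at 0. norm ((max 0 h)\<^sup>2 / h) \<le> \<bar>h\<bar>"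
        by (auto simp: max_def power2_eq_square intro!: always_eventually)
      show "((\<lambda>h::real. \<bar>h\<bar>) \<longlongrightarrow> 0) (at 0)" using tendsto_rabs[OF tendsto_ident_at[of "0::real" UNIV]] by simp
    qed
    then show ?thesis using 3 by (simp add: DERIV_def)
  qed
qed

context closed_riemannian_manifold
begin

lemma C1_function_mult: "C1_function A h \<Longrightarrow> C1_function A k \<Longrightarrow> C1_function A (\<lambda>x. h x * k x)"
  by (auto simp: C1_function_def intro: C1_on_mult)

lemma C1_function_diff: "C1_function A h \<Longrightarrow> C1_function A k \<Longrightarrow> C1_function A (\<lambda>x. h x - k x)"
  by (auto simp: C1_function_def intro: C1_on_diff)

lemma C1_function_sum: "(\<And>i. i \<in> I \<Longrightarrow> C1_function A (h i)) \<Longrightarrow> C1_function A (\<lambda>x. \<Sum>i\<in>I. h i x)"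
  unfolding C1_function_def by (intro ballI C1_on_sum) blast

lemma C1_function_divide:
  "C1_function A h \<Longrightarrow> C1_function A k \<Longrightarrow> (\<And>x. k x \<noteq> 0) \<Longrightarrow> C1_function A (\<lambda>x. h x / k x)"
  by (auto simp: C1_function_def intro: C1_on_divide)

lemma coord_grad_eqI:
  assumes "C1_function A h" "c \<in> A" "x \<in> fst c"
    and "((\<lambda>y. h (chart_inv c y)) has_derivative (\<lambda>v. v \<bullet> w)) (at (snd c x))"
  shows "coord_grad c h x = w"
proof -
  have "((\<lambda>y. h (chart_inv c y)) has_derivative (\<lambda>v. v \<bullet> coord_grad c h x)) (at (snd c x))"
    using C1_function_has_derivative[OF assms(1,2), of "snd c x"] assms(2,3) by auto
  from has_derivative_unique[OF this assms(4)] show ?thesis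
    by (metis inner_commute vector_eq_rdot)
qed

lemma coord_grad_sum:
  assumes h: "\<And>i. i \<in> I \<Longrightarrow> C1_function A (h i)" and c: "c \<in> A" and x: "x \<in> fst c"
  shows "coord_grad c (\<lambda>x. \<Sum>i\<in>I. h i x) x = (\<Sum>i\<in>I. coord_grad c (h i) x)"
proof (rule coord_grad_eqI[OF C1_function_sum c x])
  have "((\<lambda>y. h i (chart_inv c y)) has_derivative (\<lambda>v. v \<bullet> coord_grad c (h i) x)) (at (snd c x))" if "i \<in> I" for i
    using C1_function_has_derivative[OF h[OF that] c, of "snd c x"] c x by auto
  then show "((\<lambda>y. \<Sum>i\<in>I. h i (chart_inv c y)) has_derivative (\<lambda>v. v \<bullet> (\<Sum>i\<in>I. coord_grad c (h i) x))) (at (snd c x))"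
    unfolding inner_sum_right by (rule has_derivative_sum)
qed (use h in auto)

lemma coord_grad_diff:
  assumes h: "C1_function A h" and k: "C1_function A k" and c: "c \<in> A" and x: "x \<in> fst c"
  shows "coord_grad c (\<lambda>x. h x - k x) x = coord_grad c h x - coord_grad c k x"
proof (rule coord_grad_eqI[OF C1_function_diff[OF h k] c x])
  have "((\<lambda>y. h (chart_inv c y)) has_derivative (\<lambda>v. v \<bullet> coord_grad c h x)) (at (snd c x))"
    "((\<lambda>y. k (chart_inv c y)) has_derivative (\<lambda>v. v \<bullet> coord_grad c k x)) (at (snd c x))"
    using C1_function_has_derivative[OF h c, of "snd c x"] C1_function_has_derivative[OF k c, of "snd c x"] c x by auto
  then show "((\<lambda>y. h (chart_inv c y) - k (chart_inv c y)) has_derivative (\<lambda>v. v \<bullet> (coord_grad c h x - coord_grad c k x))) (at (snd c x))"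
    unfolding inner_diff_right by (rule has_derivative_diff)
qed

text \<open>A bump function of class \<open>C\<^sup>1\<close> is enough here: \<open>(max 0 (r\<^sup>2 - |y|\<^sup>2))\<^sup>2\<close>, transplanted by a chart.\<close>

lemma bump_function:
  assumes c: "c \<in> A" and W: "open W" "x\<^sub>0 \<in> W" "W \<subseteq> fst c"
  obtains \<beta> K where "C1_function A \<beta>" "compact K" "K \<subseteq> W" "\<And>x. x \<notin> K \<Longrightarrow> \<beta> x = 0"
    "\<And>x. \<beta> x \<ge> 0" "\<beta> x\<^sub>0 > 0"
proof -
  let ?y0 = "snd c x\<^sub>0"
  have "open (snd c ` W)" "?y0 \<in> snd c ` W" using open_chart_image[OF c W(1,3)] W(2) by auto
  then obtain r where r: "r > 0" "cball ?y0 r \<subseteq> snd c ` W" using open_contains_cball by blast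
  define b where "b y = (max 0 (r\<^sup>2 - (y - ?y0) \<bullet> (y - ?y0)))\<^sup>2" for y
  have "C1_on UNIV (\<lambda>y. r\<^sup>2 - (y - ?y0) \<bullet> (y - ?y0))"
    by (rule C1_onI[where h' = "\<lambda>y v. - (2 * ((y - ?y0) \<bullet> v))"])
      (auto intro!: derivative_eq_intros continuous_intros simp: inner_commute)
  then have b: "C1_on UNIV b" unfolding b_def
    by (rule C1_on_compose_real[where \<psi> = "\<lambda>s. (max 0 s)\<^sup>2" and \<psi>' = "\<lambda>s. 2 * max 0 s"])
      (auto intro!: has_derivative_pos_part_square continuous_intros)
  have b_pos: "b y > 0" if "dist ?y0 y < r" for y
    using that power_strict_mono[of "dist ?y0 y" r 2]
    by (simp add: b_def dist_norm norm_minus_commute dot_square_norm)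
  have b_zero: "b y = 0" if "y \<notin> cball ?y0 r" for y
    using that r power_mono[of r "dist ?y0 y" 2]
    by (simp add: b_def dist_norm norm_minus_commute dot_square_norm max_def)
  define \<beta> where "\<beta> x = (if x \<in> fst c then b (snd c x) else 0)" for x
  define K where "K = chart_inv c ` cball ?y0 r"
  have img: "cball ?y0 r \<subseteq> chart_img c" using r W by blast
  have K: "compact K" unfolding K_def
    by (intro compact_continuous_image continuous_on_subset[OF continuous_on_chart(2)[OF c] img]) auto
  have KW: "K \<subseteq> W" using r(2) W(3) c unfolding K_def by (force simp: subset_eq)
  have zero: "\<beta> x = 0" if "x \<notin> K" for x
  proof (cases "x \<in> fst c")
    case True
    then have "snd c x \<notin> cball ?y0 r" using that c unfolding K_def by (metis chart_inv_chart imageI)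
    then show ?thesis by (simp add: \<beta>_def b_zero)
  qed (simp add: \<beta>_def)
  have clK: "closed K" using K by (rule compact_imp_closed)
  have C1: "C1_function A \<beta>" unfolding C1_function_def
  proof (intro ballI)
    fix d assume d: "d \<in> A"
    show "C1_on (chart_img d) (\<lambda>y. \<beta> (chart_inv d y))"
    proof (rule C1_on_local[OF open_chart(2)[OF d]])
      fix y assume y: "y \<in> chart_img d"
      show "\<exists>V k. open V \<and> y \<in> V \<and> C1_on V k \<and> (\<forall>z\<in>chart_img d \<inter> V. \<beta> (chart_inv d z) = k z)"
      proof (cases "chart_inv d y \<in> fst c")
        case True
        let ?V = "snd d ` (fst d \<inter> fst c)"
        have V: "open ?V" using open_chart_image[OF d open_Int] open_chart c d by blast
        have "y \<in> ?V" using True chart_inv_in[OF d y] chart_chart_inv[OF d y]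
          by (intro image_eqI[of _ _ "chart_inv d y"]) auto
        moreover have "C1_on ?V (\<lambda>y. b (snd c (chart_inv d y)))"
          by (rule C1_on_compose[OF smooth_on_imp_C1_on[OF V transition_smooth[OF d c, unfolded o_def]] b]) auto
        moreover have "\<beta> (chart_inv d z) = b (snd c (chart_inv d z))" if "z \<in> ?V" for z
          using that d by (auto simp: \<beta>_def)
        ultimately show ?thesis using V by blast
      next
        case False
        let ?V = "snd d ` (fst d - K)"
        have V: "open ?V" using open_chart_image[OF d open_Diff[OF open_chart(1)[OF d] clK]] by blast
        have "y \<in> ?V" using False KW W(3) chart_inv_in[OF d y] chart_chart_inv[OF d y]
          by (intro image_eqI[of _ _ "chart_inv d y"]) auto
        moreover have "\<beta> (chart_inv d z) = 0" if "z \<in> ?V" for z using that d zero by auto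
        ultimately show ?thesis using V by (intro exI[of _ ?V] exI[of _ "\<lambda>_. 0"]) auto
      qed
    qed
  qed
  show ?thesis
  proof (rule that[OF C1 K KW zero])
    show "\<beta> x \<ge> 0" for x by (simp add: \<beta>_def b_def)
    show "\<beta> x\<^sub>0 > 0" using W r b_pos[of ?y0] by (auto simp: \<beta>_def)
  qed
qed

end

context weighted_closed_manifold
begin

text \<open>For test functions supported in both charts the two expressions have the same weak form. If
  they differed at a point, a bump function supported where the difference keeps its sign would
  give a nonzero integral.\<close>

lemma chart_laplacian_unique:
  assumes h: "p_laplacian_dom A g p h" and c: "c \<in> A" and d: "d \<in> A" and x: "x\<^sub>0 \<in> fst c" "x\<^sub>0 \<in> fst d"
  shows "chart_laplacian p h c x\<^sub>0 = chart_laplacian p h d x\<^sub>0"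
proof (rule ccontr)
  define E where "E x = chart_laplacian p h c x - chart_laplacian p h d x" for x
  define s where "s = sgn (E x\<^sub>0)"
  let ?O = "fst c \<inter> fst d"
  let ?W = "?O \<inter> (\<lambda>x. s * E x) -` {0<..}"
  assume "\<not> ?thesis"
  then have x0: "x\<^sub>0 \<in> ?W" using x by (auto simp: E_def s_def mult_sgn_abs[symmetric] sgn_mult sgn_if)
  have "continuous_on ?O (\<lambda>x. s * E x)" unfolding E_def
    using continuous_on_subset[OF continuous_on_chart_laplacian[OF h c]]
      continuous_on_subset[OF continuous_on_chart_laplacian[OF h d]]
    by (intro continuous_intros) auto
  then have W: "open ?W"
    by (rule continuous_open_preimage[OF _ open_Int[OF open_chart(1)[OF c] open_chart(1)[OF d]]]) simp
  obtain \<beta> K where \<beta>: "C1_function A \<beta>" "compact K" "K \<subseteq> ?W" "\<And>x. x \<notin> K \<Longrightarrow> \<beta> x = 0"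
    "\<And>x. \<beta> x \<ge> 0" "\<beta> x\<^sub>0 > 0"
    using bump_function[OF c W x0] by blast
  have Kcd: "K \<subseteq> fst c" "K \<subseteq> fst d" using \<beta>(3) by auto
  note ibp_c = integration_by_parts_in_chart[OF h \<beta>(1) c \<beta>(2) Kcd(1) \<beta>(4)]
  note ibp_d = integration_by_parts_in_chart[OF h \<beta>(1) d \<beta>(2) Kcd(2) \<beta>(4)]
  let ?F = "\<lambda>x. s * (\<beta> x * chart_laplacian p h c x - \<beta> x * chart_laplacian p h d x)"
  have F: "?F x = \<beta> x * (s * E x)" for x by (simp add: E_def algebra_simps)
  have "?F x\<^sub>0 = 0"
  proof (rule continuous_nonneg_integral_zero)
    show "continuous_on UNIV ?F" by (intro continuous_intros ibp_c(1) ibp_d(1))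
    show "?F x \<ge> 0" for x unfolding F using \<beta>(3) \<beta>(4,5)[of x] by (cases "x \<in> K") auto
    show "integral\<^sup>L \<mu> ?F = 0"
      using ibp_c(2) ibp_d(2) integrable_continuous[OF ibp_c(1)] integrable_continuous[OF ibp_d(1)]
      by (simp add: Bochner_Integration.integral_diff)
  qed
  then show False using x0 \<beta>(6) by (auto simp: F)
qed

lemma p_laplacian_in_chart:
  assumes "p_laplacian_dom A g p h" "c \<in> A" "x \<in> fst c"
  shows "p_laplacian A g f p h x = chart_laplacian p h c x"
  using chart_laplacian_unique[OF assms(1) chart_at_in(1) assms(2) chart_at_in(2) assms(3)]
  by (simp add: p_laplacian_chart_at)

lemma continuous_p_laplacian:
  assumes h: "p_laplacian_dom A g p h" shows "continuous_on UNIV (p_laplacian A g f p h)"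
proof -
  have "continuous_on (fst c) (p_laplacian A g f p h)" if c: "c \<in> A" for c
    using continuous_on_chart_laplacian[OF h c] p_laplacian_in_chart[OF h c]
    by (subst continuous_on_cong[OF refl]) auto
  then have "continuous_on (\<Union>c\<in>A. fst c) (p_laplacian A g f p h)"
    using open_chart by (intro continuous_on_open_UN) auto
  then show ?thesis by (simp add: charts_cover)
qed

text \<open>The functions \<open>\<psi> z\<close> are the parts of \<open>\<phi>\<close> given by a partition of unity built from bump functions;
  each is supported in one chart, and both sides of the formula are linear in \<open>\<phi>\<close>.\<close>

theorem integration_by_parts:
  assumes h: "p_laplacian_dom A g p h" and \<phi>: "C1_function A \<phi>"
  shows "(\<integral>x. \<phi> x * p_laplacian A g f p h x \<partial>\<mu>) = - (\<integral>x. flux_pairing p h \<phi> x \<partial>\<mu>)"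
proof -
  have "\<exists>\<beta> K. C1_function A \<beta> \<and> compact K \<and> K \<subseteq> fst (chart_at A z) \<and> (\<forall>x. x \<notin> K \<longrightarrow> \<beta> x = 0) \<and>
      (\<forall>x. \<beta> x \<ge> 0) \<and> \<beta> z > 0" for z
    by (rule bump_function[OF chart_at_in(1)[of z] open_chart(1)[OF chart_at_in(1)] chart_at_in(2) order_refl]) blast
  then obtain \<beta> K where \<beta>: "\<And>z. C1_function A (\<beta> z)" "\<And>z. compact (K z)" "\<And>z. K z \<subseteq> fst (chart_at A z)"
    "\<And>z x. x \<notin> K z \<Longrightarrow> \<beta> z x = 0" "\<And>z x. \<beta> z x \<ge> 0" "\<And>z. \<beta> z z > 0" by metis
  have "open (\<beta> z -` {0<..})" for z
    by (rule open_vimage[OF _ C1_function_continuous[OF \<beta>(1)]]) simp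
  moreover have "UNIV \<subseteq> (\<Union>z\<in>UNIV. \<beta> z -` {0<..})" using \<beta>(6) by auto
  ultimately obtain I where I: "finite I" "UNIV \<subseteq> (\<Union>z\<in>I. \<beta> z -` {0<..})"
    by (rule compactE_image[OF compact_UNIV, of UNIV "\<lambda>z. \<beta> z -` {0<..}"])
  define B where "B x = (\<Sum>z\<in>I. \<beta> z x)" for x
  have B: "B x > 0" for x
  proof -
    obtain z where "z \<in> I" "\<beta> z x > 0" using I(2) by auto
    then show ?thesis unfolding B_def using I(1) \<beta>(5) by (intro sum_pos2) auto
  qed
  define \<psi> where "\<psi> z x = \<beta> z x * \<phi> x / B x" for z x
  have \<psi>: "C1_function A (\<psi> z)" for z unfolding \<psi>_def B_def
    by (intro C1_function_divide C1_function_mult C1_function_sum \<beta>(1) \<phi>) (use less_imp_neq[OF B, symmetric] in \<open>simp add: B_def\<close>)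
  have supp: "\<psi> z x = 0" if "x \<notin> K z" for z x using \<beta>(4)[OF that] by (simp add: \<psi>_def)
  have part: "(\<Sum>z\<in>I. \<psi> z x) = \<phi> x" for x
    using B[of x] by (simp add: \<psi>_def sum_divide_distrib[symmetric] sum_distrib_right[symmetric] B_def[symmetric])
  have loc: "(\<integral>x. \<psi> z x * p_laplacian A g f p h x \<partial>\<mu>) = - (\<integral>x. flux_pairing p h (\<psi> z) x \<partial>\<mu>)" for z
  proof -
    have "(\<lambda>x. \<psi> z x * p_laplacian A g f p h x) = (\<lambda>x. \<psi> z x * chart_laplacian p h (chart_at A z) x)"
    proof
      fix x
      show "\<psi> z x * p_laplacian A g f p h x = \<psi> z x * chart_laplacian p h (chart_at A z) x"
        using p_laplacian_in_chart[OF h chart_at_in(1), of x z] supp \<beta>(3)[of z] by (cases "x \<in> K z") auto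
    qed
    then show ?thesis
      using integration_by_parts_in_chart(2)[OF h \<psi> chart_at_in(1) \<beta>(2)[of z] \<beta>(3) supp] by simp
  qed
  have int1: "integrable \<mu> (\<lambda>x. \<psi> z x * p_laplacian A g f p h x)" for z
    by (intro integrable_continuous continuous_intros C1_function_continuous[OF \<psi>] continuous_p_laplacian[OF h])
  have int2: "integrable \<mu> (flux_pairing p h (\<psi> z))" for z
    by (rule integrable_continuous[OF continuous_flux_pairing[OF h \<psi>]])
  have lin: "flux_pairing p h \<phi> x = (\<Sum>z\<in>I. flux_pairing p h (\<psi> z) x)" for x
  proof -
    have "coord_grad (chart_at A x) (\<lambda>x. \<Sum>z\<in>I. \<psi> z x) x = (\<Sum>z\<in>I. coord_grad (chart_at A x) (\<psi> z) x)"
      by (rule coord_grad_sum[OF \<psi> chart_at_in])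
    then show ?thesis unfolding part
      by (simp add: flux_pairing_def grad_inner_eq_grad[OF chart_at_in] inner_sum_right sum_distrib_left)
  qed
  have "(\<integral>x. \<phi> x * p_laplacian A g f p h x \<partial>\<mu>) = (\<integral>x. (\<Sum>z\<in>I. \<psi> z x * p_laplacian A g f p h x) \<partial>\<mu>)"
    by (simp add: part[symmetric] sum_distrib_right)
  also have "\<dots> = (\<Sum>z\<in>I. - (\<integral>x. flux_pairing p h (\<psi> z) x \<partial>\<mu>))"
    using int1 loc by (subst Bochner_Integration.integral_sum) auto
  also have "\<dots> = - (\<integral>x. (\<Sum>z\<in>I. flux_pairing p h (\<psi> z) x) \<partial>\<mu>)"
    using int2 by (subst Bochner_Integration.integral_sum) (auto simp: sum_negf)
  finally show ?thesis by (simp add: lin)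
qed

end

section \<open>Regularity of the flux for exponents at least two\<close>

text \<open>Where \<open>v\<close> vanishes, the product rule asks only for continuity of the other factor. This handles
  the critical points below.\<close>

lemma has_derivative_mult_continuous:
  fixes \<sigma> v :: "'a::euclidean_space \<Rightarrow> real"
  assumes \<sigma>: "isCont \<sigma> x" and v: "(v has_derivative D) (at x)" "v x = 0"
  shows "((\<lambda>y. \<sigma> y * v y) has_derivative (\<lambda>w. \<sigma> x * D w)) (at x)"
  unfolding has_derivative_at2
proof
  have D: "bounded_linear D" using v(1) by (rule has_derivative_bounded_linear)
  then show "bounded_linear (\<lambda>w. \<sigma> x * D w)" by (rule bounded_linear_const_mult)
  obtain K where K: "\<And>w. norm (D w) \<le> norm w * K" using bounded_linear.bounded[OF D] by auto
  have r: "((\<lambda>y. (1 / norm (y - x)) *\<^sub>R (v y - (v x + D (y - x)))) \<longlongrightarrow> 0) (at x)"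
    using v(1) by (simp add: has_derivative_at2)
  have s: "(\<sigma> \<longlongrightarrow> \<sigma> x) (at x)" using \<sigma> by (simp add: isCont_def)
  have 1: "((\<lambda>y. \<sigma> y * ((1 / norm (y - x)) *\<^sub>R (v y - (v x + D (y - x))))) \<longlongrightarrow> 0) (at x)"
    using tendsto_mult[OF s r] by simp
  have "((\<lambda>y. (\<sigma> y - \<sigma> x) * (D (y - x) / norm (y - x))) \<longlongrightarrow> 0) (at x)"
  proof (rule Lim_null_comparison[of _ "\<lambda>y. \<bar>\<sigma> y - \<sigma> x\<bar> * \<bar>K\<bar>"])
    show "((\<lambda>y. \<bar>\<sigma> y - \<sigma> x\<bar> * \<bar>K\<bar>) \<longlongrightarrow> 0) (at x)"
      using tendsto_mult_right[OF tendsto_rabs[OF tendsto_diff[OF s tendsto_const[of "\<sigma> x"]]], of "\<bar>K\<bar>"]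
      by simp
    have "\<bar>D w / norm w\<bar> \<le> \<bar>K\<bar>" for w
    proof -
      have "\<bar>D w\<bar> \<le> norm w * \<bar>K\<bar>"
        using order_trans[OF K[of w] mult_left_mono[OF abs_ge_self[of K] norm_ge_zero[of w]]] by simp
      then show ?thesis by (cases "w = 0") (auto simp: divide_simps mult.commute)
    qed
    then show "\<forall>\<^sub>F y in at x. norm ((\<sigma> y - \<sigma> x) * (D (y - x) / norm (y - x))) \<le> \<bar>\<sigma> y - \<sigma> x\<bar> * \<bar>K\<bar>"
      unfolding real_norm_def abs_mult by (intro always_eventually allI mult_left_mono) auto
  qed
  from tendsto_add_zero[OF 1 this]
  show "((\<lambda>y. (1 / norm (y - x)) *\<^sub>R (\<sigma> y * v y - (\<sigma> x * v x + \<sigma> x * D (y - x)))) \<longlongrightarrow> 0) (at x)"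
    by (rule Lim_transform_eventually) (auto simp: v(2) algebra_simps divide_inverse intro!: always_eventually)
qed

text \<open>The map \<open>v \<mapsto> |v|\<^sup>r v\<close> is continuously differentiable for \<open>r \<ge> 0\<close>, also for a length
  \<open>|v|\<close> taken in a variable inner product \<open>G\<close>. Writing \<open>q = |v|\<^sup>2\<close> and \<open>s = r / 2\<close>, the derivative
  involves the products \<open>q\<^sup>s\<^sup>-\<^sup>1 v\<^sub>i v\<^sub>k\<close>, which extend continuously by \<open>0\<close> because \<open>v\<^sub>i\<^sup>2\<close> is at most a
  locally bounded multiple of \<open>q\<close>.\<close>

lemma C1_on_norm_power_scaleR:
  fixes G :: "'a::euclidean_space \<Rightarrow> real ^ 'n ^ 'n::finite" and v :: "'a \<Rightarrow> real ^ 'n"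
  assumes U: "open U" and G: "\<And>i j. C1_on U (\<lambda>y. G y $ i $ j)" and v: "\<And>i. C1_on U (\<lambda>y. v y $ i)"
    and sym: "\<And>y. y \<in> U \<Longrightarrow> transpose (G y) = G y"
    and pos: "\<And>y w. y \<in> U \<Longrightarrow> w \<noteq> 0 \<Longrightarrow> w \<bullet> (G y *v w) > 0"
    and r: "r \<ge> 0"
  shows "C1_on U (\<lambda>y. abs_pow (sqrt (v y \<bullet> (G y *v v y))) r *\<^sub>R v y)"
proof (cases "r = 0")
  case True
  then show ?thesis using C1_on_vecI[OF v] by (simp add: abs_pow_def)
next
  case False
  define s where "s = r / 2"
  have s: "s > 0" using False r by (simp add: s_def)
  define q where "q y = (\<Sum>i\<in>UNIV. \<Sum>j\<in>UNIV. G y $ i $ j * (v y $ i * v y $ j))" for y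
  have q_eq: "v y \<bullet> (G y *v v y) = q y" for y
    by (simp add: q_def inner_vec_def matrix_vector_mult_def sum_distrib_left mult_ac)
  have q_pos: "q y \<ge> 0" "q y = 0 \<longleftrightarrow> v y = 0" if "y \<in> U" for y
    using pos[OF that, of "v y"] by (cases "v y = 0"; force simp: q_eq[symmetric])+
  have q_C1: "C1_on U q" unfolding q_def by (intro C1_on_sum C1_on_mult G v)
  have q_cont: "continuous_on U q" by (rule C1_on_imp_continuous_on[OF q_C1])
  have v_cont: "continuous_on U (\<lambda>y. v y $ i)" for i by (rule C1_on_imp_continuous_on[OF v])
  have G_cont: "continuous_on U (\<lambda>y. G y $ i $ j)" for i j by (rule C1_on_imp_continuous_on[OF G])
  have abs_pow_eq: "abs_pow (sqrt (v y \<bullet> (G y *v v y))) r = q y powr s" if "y \<in> U" for y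
    using q_pos(1)[OF that] False by (simp add: abs_pow_def q_eq s_def powr_half_sqrt[symmetric] powr_powr)
  \<comment> \<open>The diagonal of the inverse matrix: the Cauchy--Schwarz inequality for \<open>G\<close>, applied to \<open>v\<close> and to
    the image of the \<open>i\<close>-th unit vector under the inverse of \<open>G\<close>, bounds \<open>v\<^sub>i\<^sup>2\<close> by \<open>b i * q\<close>.\<close>
  define b where "b i y = (matrix_inv (G y) *v axis i 1) $ i" for i y
  have detG: "det (G y) \<noteq> 0" if "y \<in> U" for y using posdef_det_pos[OF pos[OF that]] by simp
  have b_cont: "continuous_on U (b i)" for i unfolding b_def
    by (intro C1_on_imp_continuous_on C1_on_vec_nth C1_on_matrix_inv_mult_vec[OF U G _ detG])
      (auto simp: axis_def)
  have v_bound: "(v y $ i)\<^sup>2 \<le> b i y * q y" if y: "y \<in> U" for i y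
  proof -
    let ?w = "matrix_inv (G y) *v axis i 1"
    have Gw: "G y *v ?w = axis i 1"
      using invertible_matrix_inv_mult[OF detG[OF y]] by (simp add: matrix_vector_mul_assoc)
    have "(v y \<bullet> (G y *v ?w))\<^sup>2 \<le> (v y \<bullet> (G y *v v y)) * (?w \<bullet> (G y *v ?w))"
      by (rule posdef_Cauchy_Schwarz[OF sym[OF y] pos[OF y]])
    then show ?thesis unfolding Gw q_eq by (simp add: inner_axis b_def mult.commute)
  qed
  have b_nonneg: "b i y \<ge> 0" if y: "y \<in> U" for i y
  proof -
    have "axis i (1::real) \<noteq> 0" by (simp add: axis_eq_0_iff)
    from posdef_inverse(2)[OF sym[OF y] pos[OF y] this] show ?thesis
      by (simp add: b_def inner_commute[of "axis i 1"] inner_axis)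
  qed
  \<comment> \<open>The products that extend continuously to the zeros of \<open>q\<close>; there \<open>0 powr (s - 1) = 0\<close> already
    gives the right value.\<close>
  define m where "m i k y = q y powr (s - 1) * (v y $ i * v y $ k)" for i k y
  have powr_cont: "continuous_on U (\<lambda>y. q y powr s)"
    using q_cont s q_pos by (intro continuous_on_powr') auto
  have m_bound: "\<bar>m i k y\<bar> \<le> sqrt (b i y * b k y) * q y powr s" if y: "y \<in> U" for i k y
  proof (cases "q y = 0")
    case False
    then have qy: "q y > 0" using q_pos(1)[OF y] by simp
    have "\<bar>v y $ i * v y $ k\<bar> = sqrt ((v y $ i)\<^sup>2 * (v y $ k)\<^sup>2)" by (simp add: real_sqrt_mult abs_mult)
    also have "\<dots> \<le> sqrt ((b i y * q y) * (b k y * q y))"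
      using v_bound[OF y] b_nonneg[OF y] qy by (intro real_sqrt_le_mono mult_mono) auto
    also have "\<dots> = sqrt (b i y * b k y) * q y"
      using qy by (simp add: real_sqrt_mult mult_ac)
    finally have "\<bar>m i k y\<bar> \<le> q y powr (s - 1) * (sqrt (b i y * b k y) * q y)"
      unfolding m_def abs_mult[of "_ powr _"] by (intro mult_mono) auto
    also have "\<dots> = sqrt (b i y * b k y) * q y powr s"
      using qy by (simp add: powr_diff)
    finally show ?thesis .
  qed (use q_pos[OF y] in \<open>simp add: m_def\<close>)
  have m_cont: "continuous_on U (m i k)" for i k
  proof (rule continuous_at_imp_continuous_on, rule ballI)
    fix y assume y: "y \<in> U"
    have qc: "isCont q y" and vc: "isCont (\<lambda>y. v y $ i) y" "isCont (\<lambda>y. v y $ k) y"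
      using q_cont v_cont U y continuous_on_eq_continuous_at by blast+
    show "isCont (m i k) y"
    proof (cases "q y = 0")
      case False
      then have "isCont (\<lambda>y. q y powr (s - 1)) y" using qc by (intro continuous_intros) auto
      then show ?thesis unfolding m_def by (intro isCont_mult vc)
    next
      case True
      have "isCont (\<lambda>y. sqrt (b i y * b k y) * q y powr s) y"
        using continuous_on_mult[OF continuous_on_real_sqrt[OF continuous_on_mult[OF b_cont b_cont]] powr_cont]
          U y continuous_on_eq_continuous_at by blast
      then have "((\<lambda>y. sqrt (b i y * b k y) * q y powr s) \<longlongrightarrow> 0) (at y)"
        using True by (simp add: isCont_def)
      moreover have "\<forall>\<^sub>F z in at y. norm (m i k z) \<le> sqrt (b i z * b k z) * q z powr s"
        using eventually_at_in_open'[OF U y] by eventually_elim (simp add: m_bound)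
      ultimately have "(m i k \<longlongrightarrow> 0) (at y)" by (rule Lim_null_comparison[rotated])
      then show ?thesis using True by (simp add: isCont_def m_def)
    qed
  qed
  have "\<exists>D. (\<forall>y\<in>U. ((\<lambda>y. G y $ i $ j) has_derivative D y) (at y)) \<and> (\<forall>w. continuous_on U (\<lambda>y. D y w))" for i j
    using C1_onE[OF G] by metis
  then obtain G' where G': "\<And>i j y. y \<in> U \<Longrightarrow> ((\<lambda>y. G y $ i $ j) has_derivative G' i j y) (at y)"
    "\<And>i j w. continuous_on U (\<lambda>y. G' i j y w)" by metis
  have "\<exists>D. (\<forall>y\<in>U. ((\<lambda>y. v y $ i) has_derivative D y) (at y)) \<and> (\<forall>w. continuous_on U (\<lambda>y. D y w))" for i
    using C1_onE[OF v] by metis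
  then obtain v' where v': "\<And>i y. y \<in> U \<Longrightarrow> ((\<lambda>y. v y $ i) has_derivative v' i y) (at y)"
    "\<And>i w. continuous_on U (\<lambda>y. v' i y w)" by metis
  define q' where "q' y w = (\<Sum>i\<in>UNIV. \<Sum>j\<in>UNIV. G y $ i $ j * (v y $ i * v' j y w + v' i y w * v y $ j)
      + G' i j y w * (v y $ i * v y $ j))" for y w
  have q': "(q has_derivative q' y) (at y)" if "y \<in> U" for y
    unfolding q_def[abs_def] q'_def[abs_def]
    by (intro has_derivative_sum has_derivative_mult G'(1) v'(1) that)
  \<comment> \<open>This is \<open>q powr (s - 1) * q' y w * v y $ k\<close>, with every product of two components of \<open>v\<close>
    absorbed into a continuous \<open>m\<close>.\<close>
  define T where "T k y w = (\<Sum>i\<in>UNIV. \<Sum>j\<in>UNIV. G y $ i $ j * (m i k y * v' j y w + v' i y w * m j k y)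
      + G' i j y w * (m i k y * v y $ j))" for k y w
  have T: "T k y w = q y powr (s - 1) * q' y w * v y $ k" for k y w
    by (simp add: T_def q'_def m_def sum_distrib_left sum_distrib_right algebra_simps)
  show ?thesis
  proof (rule C1_on_cong[OF U _ C1_on_vecI])
    show "abs_pow (sqrt (v y \<bullet> (G y *v v y))) r *\<^sub>R v y = q y powr s *\<^sub>R v y" if "y \<in> U" for y
      by (simp add: abs_pow_eq[OF that])
    fix k
    have "C1_on U (\<lambda>y. q y powr s * v y $ k)"
    proof (rule C1_onI[where h' = "\<lambda>y w. q y powr s * v' k y w + s * T k y w"])
      fix y assume y: "y \<in> U"
      show "((\<lambda>y. q y powr s * v y $ k) has_derivative (\<lambda>w. q y powr s * v' k y w + s * T k y w)) (at y)"
      proof (cases "q y = 0")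
        case True
        have "isCont (\<lambda>y. q y powr s) y" using powr_cont U y continuous_on_eq_continuous_at by blast
        from has_derivative_mult_continuous[OF this v'(1)[OF y]] show ?thesis
          using True q_pos(2)[OF y] by (simp add: T)
      next
        case False
        then have qy: "q y > 0" using q_pos(1)[OF y] by simp
        have "((\<lambda>y. q y powr s) has_derivative (\<lambda>w. (s * q y powr (s - 1)) * q' y w)) (at y)"
          using has_derivative_compose[OF q'[OF y] has_field_derivative_imp_has_derivative[OF has_real_derivative_powr[OF qy]]]
          by simp
        from has_derivative_mult[OF this v'(1)[OF y, of k]] show ?thesis
          by (simp add: T mult_ac)
      qed
    next
      show "continuous_on U (\<lambda>y. q y powr s * v' k y w + s * T k y w)" for w
        unfolding T_def by (intro continuous_intros powr_cont v'(2) G'(2) m_cont v_cont G_cont)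
    qed
    then show "C1_on U (\<lambda>y. (q y powr s *\<^sub>R v y) $ k)" by simp
  qed
qed

context closed_riemannian_manifold
begin

lemma p_laplacian_dom_of_twice_differentiable:
  assumes p: "p \<ge> 2" and h: "C1_function A h"
    and dh: "\<And>c i. c \<in> A \<Longrightarrow> C1_on (chart_img c) (\<lambda>y. coord_grad c h (chart_inv c y) $ i)"
  shows "p_laplacian_dom A g p h"
proof -
  have "C1_on (chart_img c) (\<lambda>y. p_flux g p h c (chart_inv c y))" if c: "c \<in> A" for c
    unfolding p_flux_def metric_norm_def
  proof (rule C1_on_norm_power_scaleR[OF open_chart(2)[OF c] C1_on_metric[OF c]])
    have "C1_on (chart_img c) (\<lambda>y. grad g h c (chart_inv c y))" unfolding grad_eq
      by (rule C1_on_matrix_inv_mult_vec[OF open_chart(2)[OF c] C1_on_metric[OF c] dh[OF c]])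
        (use metric_det_pos[OF c chart_inv_in[OF c]] in force)
    then show "C1_on (chart_img c) (\<lambda>y. grad g h c (chart_inv c y) $ i)" for i by (rule C1_on_vec_nth)
  qed (use p metric_symmetric[OF c chart_inv_in[OF c]] metric_positive[OF c chart_inv_in[OF c]] in auto)
  then show ?thesis using h by (auto simp: p_laplacian_dom_def C1_function_def C1_on_def o_def)
qed

end

section \<open>Regularity in space and time\<close>

lemma Ck_on_subset: "Ck_on n S h \<Longrightarrow> T \<subseteq> S \<Longrightarrow> Ck_on n T h"
  by (induction n arbitrary: h) (auto intro: continuous_on_subset)

lemma Pair_axis_in_Basis: "(axis i (1::real), 0::real) \<in> Basis" "(0, 1::real) \<in> Basis"
  by (auto simp: Basis_prod_def Basis_vec_def)

lemma C1_on_slice: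
  fixes k :: "'a::euclidean_space \<times> real \<Rightarrow> real"
  assumes "C1_on (V \<times> J) k" "t \<in> J" shows "C1_on V (\<lambda>y. k (y, t))"
proof (rule C1_on_compose[OF _ assms(1)])
  show "C1_on V (\<lambda>y. (y, t))"
    by (rule C1_onI[where h' = "\<lambda>y v. (v, 0)"]) (auto intro!: derivative_eq_intros continuous_intros)
qed (use assms(2) in auto)

text \<open>Local extendability, in the charts and across the ends of the time interval, to a
  continuously differentiable function.\<close>

definition C1_spacetime ::
    "('m, 'n::finite) chart set \<Rightarrow> real set \<Rightarrow> ('m \<Rightarrow> real \<Rightarrow> real) \<Rightarrow> bool" where
  "C1_spacetime A T w \<longleftrightarrow> (\<forall>c\<in>A. \<forall>y\<in>chart_img c. \<forall>t\<in>T. \<exists>V J k. open V \<and> y \<in> V \<and> V \<subseteq> chart_img c \<and>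
     open J \<and> t \<in> J \<and> C1_on (V \<times> J) k \<and> (\<forall>z\<in>V. \<forall>s\<in>J \<inter> T. w (chart_inv c z) s = k (z, s)))"

lemma C1_spacetimeE:
  assumes "C1_spacetime A T w" "c \<in> A" "y \<in> chart_img c" "t \<in> T"
  obtains V J k where "open V" "y \<in> V" "V \<subseteq> chart_img c" "open J" "t \<in> J" "C1_on (V \<times> J) k"
    "\<forall>z\<in>V. \<forall>s\<in>J \<inter> T. w (chart_inv c z) s = k (z, s)"
proof -
  have "\<exists>V J k. open V \<and> y \<in> V \<and> V \<subseteq> chart_img c \<and> open J \<and> t \<in> J \<and> C1_on (V \<times> J) k \<and>
      (\<forall>z\<in>V. \<forall>s\<in>J \<inter> T. w (chart_inv c z) s = k (z, s))"
    using assms(1)[unfolded C1_spacetime_def, THEN bspec, OF assms(2), THEN bspec, OF assms(3), THEN bspec, OF assms(4)] .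
  then show ?thesis by (elim exE conjE) (rule that)
qed

context closed_riemannian_manifold
begin

lemma smooth_spacetime_local:
  assumes u: "smooth_spacetime A T u" and c: "c \<in> A" and y: "y \<in> chart_img c" and t: "t \<in> T"
  obtains V J k where "open V" "y \<in> V" "V \<subseteq> chart_img c" "open J" "t \<in> J" "\<And>n. Ck_on n (V \<times> J) k"
    "\<And>z s. z \<in> V \<Longrightarrow> s \<in> J \<inter> T \<Longrightarrow> u (chart_inv c z) s = k (z, s)"
proof -
  let ?S = "chart_img c \<times> T"
  have "smooth_on ?S (\<lambda>(y, t). u (chart_inv c y) t)" using u c by (auto simp: smooth_spacetime_def)
  then obtain W k where W: "open W" "(y, t) \<in> W" "\<forall>n. Ck_on n W k"
    "\<forall>z\<in>?S \<inter> W. (\<lambda>(y, t). u (chart_inv c y) t) z = k z"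
    using y t unfolding smooth_on_def by (metis SigmaI)
  obtain V J where VJ: "open V" "open J" "(y, t) \<in> V \<times> J" "V \<times> J \<subseteq> W"
    using open_prod_elim[OF W(1,2)] by metis
  show ?thesis
  proof (rule that[of "V \<inter> chart_img c" J k])
    show "Ck_on n ((V \<inter> chart_img c) \<times> J) k" for n
      using W(3) VJ(4) by (blast intro: Ck_on_subset)
    show "u (chart_inv c z) s = k (z, s)" if "z \<in> V \<inter> chart_img c" "s \<in> J \<inter> T" for z s
    proof -
      have "(z, s) \<in> ?S \<inter> W" using VJ(4) that by blast
      from bspec[OF W(4) this] show ?thesis by simp
    qed
  qed (use VJ open_chart(2)[OF c] y in auto)
qed

lemma smooth_spacetime_C1: "smooth_spacetime A T u \<Longrightarrow> C1_spacetime A T u"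
  unfolding C1_spacetime_def C1_on_def
  by (intro ballI) (erule (3) smooth_spacetime_local, blast)

lemma C1_spacetime_slice:
  assumes w: "C1_spacetime A T w" and t: "t \<in> T" shows "C1_function A (\<lambda>x. w x t)"
  unfolding C1_function_def
proof (intro ballI C1_on_local)
  fix c y assume c: "c \<in> A" and y: "y \<in> chart_img c"
  obtain V J k where *: "open V" "y \<in> V" "t \<in> J" "C1_on (V \<times> J) k"
    "\<forall>z\<in>V. \<forall>s\<in>J \<inter> T. w (chart_inv c z) s = k (z, s)"
    by (rule C1_spacetimeE[OF w c y t])
  then show "\<exists>V k. open V \<and> y \<in> V \<and> C1_on V k \<and> (\<forall>z\<in>chart_img c \<inter> V. w (chart_inv c z) t = k z)"
    using t C1_on_slice[OF *(4,3)] by (intro exI[of _ V] exI[of _ "\<lambda>y. k (y, t)"]) auto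
qed (use open_chart in auto)

text \<open>Joint continuity is needed to bound the function on the compact set \<open>M \<times> [a, b]\<close>, and hence to
  differentiate integrals over \<open>M\<close>.\<close>

lemma C1_spacetime_continuous:
  assumes w: "C1_spacetime A T w" shows "continuous_on (UNIV \<times> T) (\<lambda>(x, t). w x t)"
  unfolding continuous_on_eq_continuous_within
proof
  fix z :: "'m \<times> real" assume z: "z \<in> UNIV \<times> T"
  obtain x t where z_eq: "z = (x, t)" and t: "t \<in> T" using z by auto
  let ?c = "chart_at A x"
  note c = chart_at_in[of x]
  obtain V J k where *: "open V" "snd ?c x \<in> V" "V \<subseteq> chart_img ?c" "open J" "t \<in> J" "C1_on (V \<times> J) k"
    "\<forall>z\<in>V. \<forall>s\<in>J \<inter> T. w (chart_inv ?c z) s = k (z, s)"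
    by (rule C1_spacetimeE[OF w c(1) imageI[OF c(2)] t])
  let ?W = "chart_inv ?c ` V"
  have W: "open ?W" "x \<in> ?W" "?W \<subseteq> fst ?c"
    using open_chart_inv_image[OF c(1) *(1,3)] *(2,3) c chart_inv_in[OF c(1)] by (auto simp: image_iff intro!: bexI[of _ "snd ?c x"])
  have "continuous_on (?W \<times> J) (\<lambda>q. k (snd ?c (fst q), snd q))"
  proof (rule continuous_on_compose2[OF C1_on_imp_continuous_on[OF *(6)]])
    show "continuous_on (?W \<times> J) (\<lambda>q. (snd ?c (fst q), snd q))"
      using W(3) by (intro continuous_on_Pair continuous_on_snd continuous_on_id
          continuous_on_compose2[OF continuous_on_chart(1)[OF c(1)] continuous_on_fst[OF continuous_on_id]]) auto
    show "(\<lambda>q. (snd ?c (fst q), snd q)) ` (?W \<times> J) \<subseteq> V \<times> J"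
      using chart_chart_inv[OF c(1)] *(3) by auto
  qed
  then have "isCont (\<lambda>q. k (snd ?c (fst q), snd q)) z"
  proof -
    have "z \<in> ?W \<times> J" using W(2) *(5) z_eq by simp
    then show "continuous_on (?W \<times> J) F \<Longrightarrow> isCont F z" for F :: "'m \<times> real \<Rightarrow> real"
      using continuous_on_eq_continuous_at[OF open_Times[OF W(1) *(4)], of F] by blast
  qed
  then have "continuous (at z within UNIV \<times> T) (\<lambda>q. k (snd ?c (fst q), snd q))"
    by (rule continuous_at_imp_continuous_within)
  then show "continuous (at z within UNIV \<times> T) (\<lambda>(x, t). w x t)"
  proof (rule continuous_transform_within_openin)
    show "openin (top_of_set (UNIV \<times> T)) ((?W \<times> J) \<inter> (UNIV \<times> T))"
      using W(1) *(4) by (auto simp: openin_open intro!: exI[of _ "?W \<times> J"] open_Times)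
  qed (use W *(5,7) z_eq t chart_chart_inv[OF c(1)] *(3) in auto)
qed

lemma C1_spacetime_bounded:
  assumes w: "C1_spacetime A {a..b} w"
  obtains C where "\<And>x t. t \<in> {a..b} \<Longrightarrow> \<bar>w x t\<bar> \<le> C"
proof -
  have "bounded ((\<lambda>(x, t). w x t) ` (UNIV \<times> {a..b}))"
    by (intro compact_imp_bounded compact_continuous_image C1_spacetime_continuous[OF w] compact_Times compact_UNIV compact_Icc)
  then obtain C where "\<forall>z\<in>(\<lambda>(x, t). w x t) ` (UNIV \<times> {a..b}). norm z \<le> C" unfolding bounded_iff by blast
  then show ?thesis by (intro that[of C]) force
qed

lemma C1_spacetime_continuous_time:
  assumes w: "C1_spacetime A T w" shows "continuous_on T (w x)"
proof -
  have "continuous_on T (\<lambda>t. (\<lambda>(x, t). w x t) (x, t))"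
    by (rule continuous_on_compose2[OF C1_spacetime_continuous[OF w]]) (auto intro!: continuous_intros)
  then show ?thesis by simp
qed

lemma smooth_spacetime_time_derivative:
  assumes u: "smooth_spacetime A {a..b} u" and ab: "a < b"
  shows "t \<in> {a..b} \<Longrightarrow> (u x has_real_derivative vector_derivative (u x) (at t within {a..b})) (at t within {a..b})"
    and "C1_spacetime A {a..b} (\<lambda>x t. vector_derivative (u x) (at t within {a..b}))"
proof -
  let ?T = "{a..b}"
  have key: "(u (chart_inv c z) has_real_derivative frechet_derivative k (at (z, s)) (0, 1)) (at s within ?T)"
    if k: "C1_on (V \<times> J) k" and eq: "\<And>z s. z \<in> V \<Longrightarrow> s \<in> J \<inter> ?T \<Longrightarrow> u (chart_inv c z) s = k (z, s)"
      and J: "open J" and z: "z \<in> V" "s \<in> J \<inter> ?T" for c V J k z s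
  proof -
    have D: "(k has_derivative frechet_derivative k (at (z, s))) (at (z, s))"
      using C1_on_has_derivative[OF k] z by auto
    have "((\<lambda>r. k (z, r)) has_derivative (\<lambda>h. frechet_derivative k (at (z, s)) (0, h))) (at s within ?T)"
      by (rule has_derivative_compose[where f = "\<lambda>r. (z, r)" and g = k, OF _ D])
        (auto intro!: derivative_eq_intros)
    moreover have "(\<lambda>h. frechet_derivative k (at (z, s)) (0, h)) = (*) (frechet_derivative k (at (z, s)) (0, 1))"
    proof
      fix h
      show "frechet_derivative k (at (z, s)) (0, h) = frechet_derivative k (at (z, s)) (0, 1) * h"
        using linear_scale[OF has_derivative_linear[OF D], of h "(0, 1)"] by (simp add: mult.commute)
    qed
    ultimately have d: "((\<lambda>r. k (z, r)) has_real_derivative frechet_derivative k (at (z, s)) (0, 1)) (at s within ?T)"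
      by (simp only: has_field_derivative_def)
    obtain e where e: "e > 0" "ball s e \<subseteq> J" using J z open_contains_ball by blast
    show ?thesis
      by (rule has_field_derivative_transform_within[OF d e(1)])
        (use eq z e in \<open>auto simp: subset_eq dist_commute\<close>)
  qed
  have vd: "vector_derivative F (at s within ?T) = D" if "(F has_real_derivative D) (at s within ?T)" "s \<in> ?T" for F s D
    using vector_derivative_within_cbox[of a b s F D] ab that
    by (simp add: has_real_derivative_iff_has_vector_derivative)
  show "(u x has_real_derivative vector_derivative (u x) (at t within ?T)) (at t within ?T)" if t: "t \<in> ?T"
  proof -
    let ?c = "chart_at A x"
    note c = chart_at_in[of x]
    obtain V J k where *: "open V" "snd ?c x \<in> V" "V \<subseteq> chart_img ?c" "open J" "t \<in> J" "\<And>n. Ck_on n (V \<times> J) k"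
      "\<And>z s. z \<in> V \<Longrightarrow> s \<in> J \<inter> ?T \<Longrightarrow> u (chart_inv ?c z) s = k (z, s)"
      using smooth_spacetime_local[OF u c(1) imageI[OF c(2)] t] by metis
    have "(u (chart_inv ?c (snd ?c x)) has_real_derivative frechet_derivative k (at (snd ?c x, t)) (0, 1)) (at t within ?T)"
      by (rule key[OF _ *(7,4,2)]) (use *(5,6) t in \<open>auto simp: C1_on_def\<close>)
    then show ?thesis using c vd[OF _ t] by simp
  qed
  show "C1_spacetime A ?T (\<lambda>x t. vector_derivative (u x) (at t within ?T))"
    unfolding C1_spacetime_def
  proof (intro ballI)
    fix c y t assume c: "c \<in> A" and y: "y \<in> chart_img c" and t: "t \<in> ?T"
    obtain V J k where *: "open V" "y \<in> V" "V \<subseteq> chart_img c" "open J" "t \<in> J" "\<And>n. Ck_on n (V \<times> J) k"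
      "\<And>z s. z \<in> V \<Longrightarrow> s \<in> J \<inter> ?T \<Longrightarrow> u (chart_inv c z) s = k (z, s)"
      using smooth_spacetime_local[OF u c y t] by metis
    let ?k = "\<lambda>z. frechet_derivative k (at z) (0, 1)"
    have "C1_on (V \<times> J) ?k"
      using *(6)[of "Suc 1"] Pair_axis_in_Basis(2) unfolding C1_on_def by auto
    moreover have "vector_derivative (u (chart_inv c z)) (at s within ?T) = ?k (z, s)" if "z \<in> V" "s \<in> J \<inter> ?T" for z s
      by (rule vd[OF key[OF _ *(7,4)]]) (use that *(6)[of 1] in \<open>auto simp: C1_on_def\<close>)
    ultimately show "\<exists>V J k. open V \<and> y \<in> V \<and> V \<subseteq> chart_img c \<and> open J \<and> t \<in> J \<and> C1_on (V \<times> J) k \<and>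
       (\<forall>z\<in>V. \<forall>s\<in>J \<inter> ?T. vector_derivative (u (chart_inv c z)) (at s within ?T) = k (z, s))"
      using * by blast
  qed
qed

text \<open>The space derivatives of \<open>u\<close> at time \<open>t\<close> are partial derivatives of the local extension of \<open>u\<close>.\<close>

lemma smooth_spacetime_coord_grad_C1:
  assumes u: "smooth_spacetime A T u" and t: "t \<in> T" and c: "c \<in> A"
  shows "C1_on (chart_img c) (\<lambda>y. coord_grad c (\<lambda>x. u x t) (chart_inv c y) $ i)"
proof (rule C1_on_local[OF open_chart(2)[OF c]])
  fix y assume y: "y \<in> chart_img c"
  obtain V J k where *: "open V" "y \<in> V" "V \<subseteq> chart_img c" "open J" "t \<in> J" "\<And>n. Ck_on n (V \<times> J) k"
    "\<And>z s. z \<in> V \<Longrightarrow> s \<in> J \<inter> T \<Longrightarrow> u (chart_inv c z) s = k (z, s)"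
    using smooth_spacetime_local[OF u c y t] by metis
  let ?k = "\<lambda>z. frechet_derivative k (at z) (axis i 1, 0)"
  have k: "C1_on (V \<times> J) ?k"
    using *(6)[of "Suc 1"] Pair_axis_in_Basis(1)[of i] unfolding C1_on_def by auto
  have k1: "C1_on (V \<times> J) k" using *(6) by (simp add: C1_on_def)
  have "coord_grad c (\<lambda>x. u x t) (chart_inv c z) $ i = ?k (z, t)" if z: "z \<in> V" for z
  proof -
    have D: "(k has_derivative frechet_derivative k (at (z, t))) (at (z, t))"
      using C1_on_has_derivative[OF k1] z *(5) by auto
    have "((\<lambda>z. k (z, t)) has_derivative (\<lambda>v. frechet_derivative k (at (z, t)) (v, 0))) (at z)"
      by (rule has_derivative_compose[where f = "\<lambda>z. (z, t)" and g = k, OF _ D])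
        (auto intro!: derivative_eq_intros)
    then have "((\<lambda>z. u (chart_inv c z) t) has_derivative (\<lambda>v. frechet_derivative k (at (z, t)) (v, 0))) (at z)"
      by (rule has_derivative_transform_within_open[OF _ *(1) z]) (use *(5,7) t in auto)
    from frechet_derivative_at[OF this, symmetric]
    show ?thesis using chart_chart_inv[OF c, of z] z *(3) by (auto simp: coord_grad_def coord_deriv_def o_def)
  qed
  then show "\<exists>V k. open V \<and> y \<in> V \<and> C1_on V k \<and>
      (\<forall>z\<in>chart_img c \<inter> V. coord_grad c (\<lambda>x. u x t) (chart_inv c z) $ i = k z)"
    using *(1,2) C1_on_slice[OF k *(5)] by (intro exI[of _ V] exI[of _ "\<lambda>z. ?k (z, t)"]) auto
qed

end

context weighted_closed_manifold
begin

lemma p_laplacian_locally_zero: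
  assumes W: "open W" "x \<in> W" and h: "\<And>z. z \<in> W \<Longrightarrow> h z = 0"
  shows "p_laplacian A g f p h x = 0"
proof -
  let ?c = "chart_at A x"
  note c = chart_at_in[of x]
  let ?V = "snd ?c ` (W \<inter> fst ?c)"
  have V: "open ?V" "snd ?c x \<in> ?V"
    using open_chart_image[OF c(1) open_Int[OF W(1) open_chart(1)[OF c(1)]]] W(2) c(2) by auto
  have zero: "frechet_derivative F (at y) = (\<lambda>v. 0)" if "\<And>y. y \<in> ?V \<Longrightarrow> F y = 0" "y \<in> ?V"
    for F :: "real ^ 'n \<Rightarrow> real" and y
    using frechet_derivative_at[OF has_derivative_transform_within_open[OF has_derivative_const[of 0] V(1) that(2), of F]]
      that(1) by simp
  have "coord_grad ?c h z = 0" if z: "z \<in> W \<inter> fst ?c" for z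
  proof -
    have "frechet_derivative (h \<circ> chart_inv ?c) (at (snd ?c z)) = (\<lambda>v. 0)"
      by (rule zero) (use z h c(1) in auto)
    then show ?thesis by (simp add: coord_grad_def coord_deriv_def vec_eq_iff)
  qed
  then have flux: "p_flux g p h ?c z = 0" if "z \<in> W \<inter> fst ?c" for z
    using that by (simp add: p_flux_def grad_eq)
  have "coord_deriv ?c i (\<lambda>z. sqrt (det (g ?c z)) * (exp (- f z) *\<^sub>R p_flux g p h ?c z) $ i) x = 0" for i
  proof -
    have "frechet_derivative ((\<lambda>z. sqrt (det (g ?c z)) * (exp (- f z) *\<^sub>R p_flux g p h ?c z) $ i) \<circ> chart_inv ?c)
        (at (snd ?c x)) = (\<lambda>v. 0)"
      by (rule zero) (use V(2) flux c(1) in auto)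
    then show ?thesis by (simp add: coord_deriv_def)
  qed
  then show ?thesis by (simp add: p_laplacian_chart_at chart_laplacian_def)
qed

end

section \<open>Inequalities and differential inequalities in one variable\<close>

lemma abs_pow_nonneg: "abs_pow z r \<ge> 0"
  by (simp add: abs_pow_def)

text \<open>In this form \<open>|z|^(p-2) z\<close> is visibly continuous.\<close>

lemma abs_pow_mult_self:
  assumes "1 < p"
  shows "abs_pow z (p - 2) * z = max 0 z powr (p - 1) - max 0 (- z) powr (p - 1)"
proof -
  have eq: "x powr (p - 2) * x = x powr (p - 1)" if "x > 0" for x :: real
    using that powr_add[of x "p - 2" 1] by simp
  show ?thesis
    using eq[of z] eq[of "- z"] assms by (cases "z > 0"; cases "z < 0") (auto simp: abs_pow_def max_def)
qed

lemma abs_pow_mult_square: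
  assumes "1 < p" shows "abs_pow z (p - 2) * z * z = \<bar>z\<bar> powr p"
proof -
  have eq: "x powr (p - 1) * x = x powr p" if "x > 0" for x :: real
    using that powr_add[of x "p - 1" 1] by simp
  show ?thesis
    using eq[of z] eq[of "- z"] assms by (cases "z > 0"; cases "z < 0") (auto simp: abs_pow_mult_self[OF assms] max_def)
qed

lemma continuous_on_abs_pow_mult_self:
  assumes "1 < p" "continuous_on S h" shows "continuous_on S (\<lambda>x. abs_pow (h x) (p - 2) * h x)"
  unfolding abs_pow_mult_self[OF assms(1)]
  using assms by (intro continuous_on_diff continuous_on_powr' continuous_on_max continuous_intros) auto

lemma has_real_derivative_abs_powr:
  assumes p: "1 < p"
  shows "((\<lambda>z. \<bar>z\<bar> powr p) has_real_derivative p * (abs_pow z (p - 2) * z)) (at z)"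
proof -
  consider "z > 0" | "z < 0" | "z = 0" by linarith
  then show ?thesis
  proof cases
    case 1
    have "((\<lambda>z. z powr p) has_real_derivative p * (abs_pow z (p - 2) * z)) (at z)"
      using has_real_derivative_powr[OF 1, of p] 1 p by (simp add: abs_pow_mult_self max_def)
    then show ?thesis by (rule has_field_derivative_transform_within_open[of _ _ _ "{0<..}"]) (use 1 in auto)
  next
    case 2
    have "((\<lambda>z. (- z) powr p) has_real_derivative p * (abs_pow z (p - 2) * z)) (at z)"
      using 2 p by (auto intro!: derivative_eq_intros simp: abs_pow_mult_self max_def)
    then show ?thesis by (rule has_field_derivative_transform_within_open[of _ _ _ "{..<0}"]) (use 2 in auto)
  next
    case 3
    have "((\<lambda>h::real. \<bar>h\<bar> powr p / h) \<longlongrightarrow> 0) (at 0)"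
    proof (rule Lim_null_comparison[of _ "\<lambda>h. \<bar>h\<bar> powr (p - 1)"])
      show "\<forall>\<^sub>F h::real in at 0. norm (\<bar>h\<bar> powr p / h) \<le> \<bar>h\<bar> powr (p - 1)"
        by (intro always_eventually allI) (auto simp: powr_diff)
      have "continuous_on UNIV (\<lambda>h::real. \<bar>h\<bar> powr (p - 1))"
        using p by (intro continuous_on_powr' continuous_intros) auto
      then have "isCont (\<lambda>h::real. \<bar>h\<bar> powr (p - 1)) 0"
        by (simp add: continuous_on_eq_continuous_at)
      then show "((\<lambda>h::real. \<bar>h\<bar> powr (p - 1)) \<longlongrightarrow> 0) (at 0)" by (simp add: isCont_def)
    qed
    then show ?thesis using 3 p by (simp add: DERIV_def)
  qed
qed

text \<open>The function \<open>|\<xi>|\<^sup>p\<close> lies above its tangent planes: \<open>N = |\<xi>|\<close>, \<open>M = |\<xi>'|\<close> and \<open>i\<close> is the inner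
  product of \<open>\<xi>\<close> and \<open>\<xi>'\<close>.\<close>

lemma norm_power_tangent_inequality:
  assumes p: "1 < p" and "N \<ge> 0" "M \<ge> 0" "\<bar>i\<bar> \<le> N * M"
  shows "N powr p + p * (abs_pow N (p - 2) * (i - N * N)) \<le> M powr p"
proof (cases "N = 0 \<or> M = 0")
  case True
  have "abs_pow N (p - 2) * (i - N * N) = - (N powr p)"
    using True assms abs_pow_mult_square[OF p, of N] by (auto simp: algebra_simps)
  then have "N powr p + p * (abs_pow N (p - 2) * (i - N * N)) = (1 - p) * N powr p"
    by (simp only:) (simp add: algebra_simps)
  also have "\<dots> \<le> 0" using p by (simp add: mult_nonpos_nonneg)
  finally show ?thesis by (smt (verit) powr_ge_zero)
next
  case False
  then have pos: "N > 0" "M > 0" using assms by auto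
  \<comment> \<open>Young's inequality with the exponents \<open>p\<close> and \<open>p / (p - 1)\<close>.\<close>
  have "(M powr p) powr (1 / p) * (N powr p) powr (1 - 1 / p) \<le> 1 / p * M powr p + (1 - 1 / p) * N powr p"
    using p pos by (intro Youngs_inequality_0) auto
  then have "M * N powr (p - 1) \<le> 1 / p * M powr p + (1 - 1 / p) * N powr p"
    using p pos by (simp add: powr_powr algebra_simps)
  then have young: "p * (M * N powr (p - 1)) \<le> M powr p + (p - 1) * N powr p"
    using p by (simp add: field_simps)
  have "abs_pow N (p - 2) * i \<le> abs_pow N (p - 2) * (N * M)"
    using assms(4) by (intro mult_left_mono abs_pow_nonneg) auto
  also have "\<dots> = M * N powr (p - 1)"
    using abs_pow_mult_self[OF p, of N] pos p by (simp add: max_def mult_ac)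
  finally have "p * (abs_pow N (p - 2) * i) \<le> M powr p + (p - 1) * N powr p"
    using young p mult_left_mono[of "abs_pow N (p - 2) * i" "M * N powr (p - 1)" p] by linarith
  moreover have "abs_pow N (p - 2) * (N * N) = N powr p"
    using abs_pow_mult_square[OF p, of N] pos by (simp add: mult.assoc)
  ultimately show ?thesis by (simp add: right_diff_distrib algebra_simps)
qed

text \<open>A continuous function is nondecreasing if at every point it is touched from above by a function
  with nonnegative derivative there. After adding a small positive slope, consider the first point at
  which a drop to a given lower value has occurred: just to its left the upper function, hence the
  function itself, would already be lower.\<close>

lemma mono_on_of_upper_support:
  fixes F :: "real \<Rightarrow> real"
  assumes cont: "continuous_on {a..b} F"
    and supp: "\<And>t. t \<in> {a..b} \<Longrightarrow> \<exists>V d. (V has_real_derivative d) (at t within {a..b}) \<and> d \<ge> 0 \<and>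
      V t = F t \<and> (\<forall>s\<in>{a..b}. F s \<le> V s)"
  shows "mono_on {a..b} F"
proof (rule mono_onI, rule ccontr)
  fix x y assume xy: "x \<in> {a..b}" "y \<in> {a..b}" "x \<le> y" "\<not> F x \<le> F y"
  then have "x < y" by (cases "x = y") auto
  \<comment> \<open>The added slope \<open>e\<close> makes the derivative of the upper function positive and is small enough to
    keep \<open>H y < H x\<close>.\<close>
  define e where "e = (F x - F y) / (2 * (y - x))"
  have e: "e > 0" using xy \<open>x < y\<close> by (simp add: e_def)
  define H where "H s = F s + e * (s - x)" for s
  have Hx: "H x > H y"
  proof -
    have "e * (y - x) = (F x - F y) / 2" using \<open>x < y\<close> unfolding e_def by (simp add: divide_simps)
    then show ?thesis using xy(4) by (simp add: H_def field_simps)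
  qed
  have sub: "{x..y} \<subseteq> {a..b}" using xy by auto
  have Hc: "continuous_on {x..y} H" unfolding H_def
    by (intro continuous_intros continuous_on_subset[OF cont sub])
  define S where "S = {s \<in> {x..y}. H s \<le> H y}"
  have S: "closed S" "y \<in> S" "bdd_below S" "S \<noteq> {}"
    using continuous_closed_preimage[OF Hc closed_atLeastAtMost closed_atMost[of "H y"]] \<open>x < y\<close>
    by (auto simp: S_def vimage_def Int_def intro!: bdd_belowI[of _ x])
  define t where "t = Inf S"
  have t: "t \<in> S" unfolding t_def using closed_contains_Inf S by blast
  have lt: "s \<notin> S" if "s < t" for s using that cInf_lower[OF _ S(3), of s] by (auto simp: t_def)
  have tx: "x < t" using t Hx by (cases "t = x") (auto simp: S_def)
  obtain V d where V: "(V has_real_derivative d) (at t within {a..b})" "d \<ge> 0" "V t = F t" "\<forall>s\<in>{a..b}. F s \<le> V s"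
    using supp[of t] t sub by (auto simp: S_def)
  have "((\<lambda>s. V s + e * (s - x)) has_real_derivative d + e) (at t within {a..b})"
    using V(1) by (auto intro!: derivative_eq_intros)
  then obtain r where r: "r > 0" "\<And>h. h > 0 \<Longrightarrow> t - h \<in> {a..b} \<Longrightarrow> h < r \<Longrightarrow> V (t - h) + e * (t - h - x) < V t + e * (t - x)"
    using has_real_derivative_pos_inc_left[of _ "d + e"] V(2) e by (smt (verit))
  define h where "h = min (r / 2) (t - x)"
  have h: "h > 0" "h < r" "h \<le> t - x" using r(1) tx by (auto simp: h_def)
  have mem: "t - h \<in> {x..y}" using h t by (auto simp: S_def)
  have "H (t - h) \<le> V (t - h) + e * (t - h - x)" using V(4) mem sub by (auto simp: H_def)
  also have "\<dots> < H t" using r(2)[OF h(1) _ h(2)] mem sub V(3) by (auto simp: H_def)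
  also have "\<dots> \<le> H y" using t by (simp add: S_def)
  finally have "t - h \<in> S" using mem by (simp add: S_def)
  then show False using lt[of "t - h"] h by simp
qed

lemma convex_on_of_mono_derivative:
  fixes F :: "real \<Rightarrow> real"
  assumes der: "\<And>t. t \<in> {a..b} \<Longrightarrow> (F has_real_derivative F' t) (at t within {a..b})"
    and mono: "mono_on {a..b} F'"
  shows "convex_on {a..b} F"
proof (rule convex_on_linorderI)
  fix t x y :: real assume t: "0 < t" "t < 1" and xy: "x \<in> {a..b}" "y \<in> {a..b}" "x < y"
  define z where "z = (1 - t) *\<^sub>R x + t *\<^sub>R y"
  have zx: "z - x = t * (y - x)" and yz: "y - z = (1 - t) * (y - x)" by (auto simp: z_def algebra_simps)
  have "0 < z - x" "0 < y - z" unfolding zx yz using t xy by simp_all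
  then have lt: "x < z" "z < y" by auto
  have mvt: "\<exists>\<xi>\<in>{r<..<s}. F s - F r = F' \<xi> * (s - r)" if "r < s" "{r..s} \<subseteq> {a..b}" for r s
  proof (rule mvt_simple[OF that(1)])
    fix v assume "r \<le> v" "v \<le> s"
    then have "(F has_real_derivative F' v) (at v within {r..s})"
      using DERIV_subset[OF der that(2)] that(2) by auto
    then show "(F has_derivative (*) (F' v)) (at v within {r..s})" by (simp add: has_field_derivative_def)
  qed
  obtain \<xi> where \<xi>: "\<xi> \<in> {x<..<z}" "F z - F x = F' \<xi> * (z - x)" using mvt[OF lt(1)] xy lt by auto
  obtain \<zeta> where \<zeta>: "\<zeta> \<in> {z<..<y}" "F y - F z = F' \<zeta> * (y - z)" using mvt[OF lt(2)] xy lt by auto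
  have "F' \<xi> \<le> F' \<zeta>" using mono_onD[OF mono, of \<xi> \<zeta>] \<xi>(1) \<zeta>(1) xy by auto
  then have "(t * (1 - t) * (y - x)) * F' \<xi> \<le> (t * (1 - t) * (y - x)) * F' \<zeta>"
    using t xy by (intro mult_left_mono) auto
  then have "(1 - t) * (F z - F x) \<le> t * (F y - F z)"
    unfolding \<xi>(2) \<zeta>(2) zx yz by (simp add: mult_ac)
  then show "F ((1 - t) *\<^sub>R x + t *\<^sub>R y) \<le> (1 - t) * F x + t * F y"
    unfolding z_def[symmetric] by (simp add: algebra_simps)
qed simp

lemma continuous_on_integral_dominated:
  fixes F :: "'x \<Rightarrow> real \<Rightarrow> real"
  assumes "\<And>x. continuous_on S (F x)" "\<And>s. s \<in> S \<Longrightarrow> (\<lambda>x. F x s) \<in> borel_measurable M"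
    and "\<And>x s. s \<in> S \<Longrightarrow> \<bar>F x s\<bar> \<le> B x" "integrable M B"
  shows "continuous_on S (\<lambda>s. \<integral>x. F x s \<partial>M)"
proof (rule continuous_on_sequentiallyI)
  fix X t assume X: "\<forall>n. X n \<in> S" "t \<in> S" "X \<longlonglongrightarrow> t"
  show "(\<lambda>n. \<integral>x. F x (X n) \<partial>M) \<longlonglongrightarrow> (\<integral>x. F x t \<partial>M)"
  proof (rule integral_dominated_convergence[where w = B])
    show "AE x in M. (\<lambda>n. F x (X n)) \<longlonglongrightarrow> F x t"
      using assms(1) X by (auto intro!: AE_I2 simp: continuous_on_sequentially o_def)
  qed (use assms X in auto)
qed

text \<open>If \<open>z' = \<kappa> z\<close> holds wherever \<open>z \<noteq> 0\<close>, then it holds in integrated form: the square of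
  \<open>z exp (- \<integral> \<kappa>)\<close> has derivative zero everywhere.\<close>

lemma linear_ode_off_zeros:
  fixes z :: "real \<Rightarrow> real"
  assumes der: "\<And>t. t \<in> {a..b} \<Longrightarrow> (z has_real_derivative z' t) (at t within {a..b})"
    and eq: "\<And>t. t \<in> {a..b} \<Longrightarrow> z t \<noteq> 0 \<Longrightarrow> z' t = \<kappa> t * z t"
    and K: "\<And>t. t \<in> {a..b} \<Longrightarrow> (K has_real_derivative \<kappa> t) (at t within {a..b})"
    and t: "t \<in> {a..b}"
  shows "z t = z a * exp (K t - K a)"
proof -
  define y where "y t = z t * exp (- K t)" for t
  have y: "(y has_real_derivative (z' t - \<kappa> t * z t) * exp (- K t)) (at t within {a..b})" if "t \<in> {a..b}" for t
    unfolding y_def by (auto intro!: derivative_eq_intros der[OF that] K[OF that] simp: algebra_simps)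
  have "((\<lambda>t. (y t)\<^sup>2) has_real_derivative 0) (at t within {a..b})" if "t \<in> {a..b}" for t
  proof -
    have "((\<lambda>t. (y t)\<^sup>2) has_real_derivative 2 * y t * ((z' t - \<kappa> t * z t) * exp (- K t))) (at t within {a..b})"
    proof -
      have "((\<lambda>t. (y t)\<^sup>2) has_real_derivative 2 * y t * D) (at t within {a..b})"
        if "(y has_real_derivative D) (at t within {a..b})" for D
        using that by (auto intro!: derivative_eq_intros)
      from this[OF y[OF that]] show ?thesis .
    qed
    moreover have "2 * y t * ((z' t - \<kappa> t * z t) * exp (- K t)) = 0" using eq[OF that] by (auto simp: y_def)
    ultimately show ?thesis by (simp only:)
  qed
  then obtain c where c: "\<And>t. t \<in> {a..b} \<Longrightarrow> (y t)\<^sup>2 = c"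
    using has_field_derivative_zero_constant[of "{a..b}" "\<lambda>t. (y t)\<^sup>2"] by (metis convex_real_interval(5))
  have a: "a \<in> {a..b}" using t by auto
  have "y t = y a"
  proof (cases "c = 0")
    case True then show ?thesis using c[OF t] c[OF a] by simp
  next
    case False
    then have "z t \<noteq> 0" if "t \<in> {a..b}" for t using c[OF that] by (auto simp: y_def)
    then have "(y has_real_derivative 0) (at t within {a..b})" if "t \<in> {a..b}" for t
      using y[OF that] eq[OF that] that by simp
    then obtain k where "\<And>t. t \<in> {a..b} \<Longrightarrow> y t = k"
      using has_field_derivative_zero_constant[of "{a..b}" y] by (metis convex_real_interval(5))
    then show ?thesis using t a by simp
  qed
  then have "z t * exp (- K t) * exp (K t) = z a * exp (- K a) * exp (K t)" by (simp add: y_def)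
  then show ?thesis by (simp add: mult.assoc exp_add[symmetric])
qed

section \<open>The parabolic frequency\<close>

lemma smooth_on_imp_continuous_on: "smooth_on S h \<Longrightarrow> continuous_on S h"
  unfolding continuous_on_eq_continuous_within
proof
  fix x assume h: "smooth_on S h" and x: "x \<in> S"
  obtain V k where V: "open V" "x \<in> V" "\<forall>n. Ck_on n V k" "\<forall>z\<in>S \<inter> V. h z = k z"
    using h x unfolding smooth_on_def by meson
  have "continuous_on V k" using V(3) by (metis Ck_on.simps(1))
  then have "isCont k x" using V(1,2) continuous_on_eq_continuous_at by blast
  then have "continuous (at x within S) k" by (rule continuous_at_imp_continuous_within)
  then show "continuous (at x within S) h"
    by (rule continuous_transform_within_openin[where S = "S \<inter> V"]) (use V x in \<open>auto simp: openin_open_Int\<close>)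
qed

locale p_heat_flow = weighted_closed_manifold A g vol f
  for A :: "('m::t2_space, 'n::finite) chart set" and g vol f +
  fixes p a b :: real and \<eta> :: "real \<Rightarrow> real" and u :: "'m \<Rightarrow> real \<Rightarrow> real"
  assumes p: "1 < p" and ab: "a < b" and \<eta>_smooth: "smooth_on {a..b} \<eta>"
    and u_smooth: "smooth_spacetime A {a..b} u"
    and u_nonzero: "\<forall>t\<in>{a..b}. \<exists>x. u x t \<noteq> 0"
    and heat: "p_heat_solution A g f p a b \<eta> u"
begin

definition u\<^sub>t :: "'m \<Rightarrow> real \<Rightarrow> real" where
  "u\<^sub>t x t = vector_derivative (u x) (at t within {a..b})"

abbreviation Lap :: "real \<Rightarrow> 'm \<Rightarrow> real" where
  "Lap t \<equiv> p_laplacian A g f p (\<lambda>x. u x t)"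

text \<open>Wherever the heat equation is imposed, it says \<open>\<Delta>u = |u|^(p-2) v\<close>.\<close>

definition v :: "'m \<Rightarrow> real \<Rightarrow> real" where "v x t = u\<^sub>t x t - \<eta> t * u x t"

abbreviation weight :: "'m \<Rightarrow> real \<Rightarrow> real" where "weight x t \<equiv> abs_pow (u x t) (p - 2)"

abbreviation D :: "real \<Rightarrow> real" where "D \<equiv> D_energy A g vol f p u"
abbreviation I :: "real \<Rightarrow> real" where "I \<equiv> I_mass vol f p u"
abbreviation U :: "real \<Rightarrow> real" where "U \<equiv> U_freq A g vol f p u"

text \<open>Together with \<open>D\<close> and \<open>I\<close>, this is the third entry of the Gram matrix of \<open>u\<close> and \<open>v\<close> for the weight
  \<open>|u|^(p-2)\<close>. It is written with the Laplacian because that integrand is continuous also at zeros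
  of \<open>u\<close> when \<open>p < 2\<close>.\<close>

definition Q :: "real \<Rightarrow> real" where "Q t = (\<integral>x. v x t * Lap t x \<partial>\<mu>)"

lemma u_C1_spacetime: "C1_spacetime A {a..b} u"
  by (rule smooth_spacetime_C1[OF u_smooth])

lemma u\<^sub>t_C1_spacetime: "C1_spacetime A {a..b} u\<^sub>t"
  using smooth_spacetime_time_derivative(2)[OF u_smooth ab] by (simp add: u\<^sub>t_def[abs_def])

lemma u_has_derivative: "t \<in> {a..b} \<Longrightarrow> (u x has_real_derivative u\<^sub>t x t) (at t within {a..b})"
  using smooth_spacetime_time_derivative(1)[OF u_smooth ab] by (simp add: u\<^sub>t_def)

lemmas u_C1 = C1_spacetime_slice[OF u_C1_spacetime]
lemmas u\<^sub>t_C1 = C1_spacetime_slice[OF u\<^sub>t_C1_spacetime]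
lemmas u_continuous = C1_function_continuous[OF u_C1]
lemmas u\<^sub>t_continuous = C1_function_continuous[OF u\<^sub>t_C1]
lemmas u_continuous_time = C1_spacetime_continuous_time[OF u_C1_spacetime]
lemmas u\<^sub>t_continuous_time = C1_spacetime_continuous_time[OF u\<^sub>t_C1_spacetime]

lemma \<eta>_continuous: "continuous_on {a..b} \<eta>"
  by (rule smooth_on_imp_continuous_on[OF \<eta>_smooth])

lemma v_continuous: "t \<in> {a..b} \<Longrightarrow> continuous_on UNIV (\<lambda>x. v x t)"
  unfolding v_def by (intro continuous_intros u_continuous u\<^sub>t_continuous)

lemma v_continuous_time: "continuous_on {a..b} (v x)"
  unfolding v_def[abs_def] by (intro continuous_intros u_continuous_time u\<^sub>t_continuous_time \<eta>_continuous)

lemma u_dom: "t \<in> {a..b} \<Longrightarrow> p_laplacian_dom A g p (\<lambda>x. u x t)"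
proof (cases "p < 2")
  case False
  assume t: "t \<in> {a..b}"
  show ?thesis
    by (rule p_laplacian_dom_of_twice_differentiable[OF _ u_C1[OF t] smooth_spacetime_coord_grad_C1[OF u_smooth t]])
      (use False in auto)
qed (use heat in \<open>auto simp: p_heat_solution_def\<close>)

lemmas Lap_continuous = continuous_p_laplacian[OF u_dom]

lemma heat_equation: "t \<in> {a..b} \<Longrightarrow> p \<ge> 2 \<or> u x t \<noteq> 0 \<Longrightarrow> Lap t x = weight x t * v x t"
  using heat by (auto simp: p_heat_solution_def v_def u\<^sub>t_def algebra_simps)

text \<open>This is how identities valid where \<open>u \<noteq> 0\<close> reach the zeros of \<open>u\<close>: a zero is either a limit of
  points where \<open>u \<noteq> 0\<close>, or an interior point of the zero set, where the Laplacian vanishes.\<close>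

lemma zero_by_closure:
  assumes cont: "continuous_on UNIV F" and zero: "\<And>y. u y t \<noteq> 0 \<Longrightarrow> F y = 0"
  shows "F x = (0::real) \<or> (Lap t x = 0 \<and> u x t = 0)"
proof (cases "x \<in> closure {y. u y t \<noteq> 0}")
  case True
  then show ?thesis
    using continuous_constant_on_closure[OF continuous_on_subset[OF cont], of "{y. u y t \<noteq> 0}" 0 x] zero by auto
next
  case False
  have "Lap t x = 0"
    by (rule p_laplacian_locally_zero[of "- closure {y. u y t \<noteq> 0}"])
      (use False closure_subset[of "{y. u y t \<noteq> 0}"] in auto)
  moreover have "u x t = 0" using False closure_subset[of "{y. u y t \<noteq> 0}"] by auto
  ultimately show ?thesis by blast
qed

lemma u_Lap: "t \<in> {a..b} \<Longrightarrow> u x t * Lap t x = weight x t * u x t * v x t"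
  using heat_equation[of t x] by (cases "u x t = 0") auto

text \<open>At a zero of \<open>u\<close> with \<open>p < 2\<close> both sides are zero. Off the zeros the equation can be written
  \<open>v = |u|^(2-p) \<Delta>u\<close>. Its sides are continuous, so it persists at limits of such points and gives
  \<open>v = 0\<close> there; at all other zeros \<open>\<Delta>u = 0\<close>.\<close>

lemma v_Lap:
  assumes t: "t \<in> {a..b}" shows "v x t * Lap t x = weight x t * v x t * v x t"
proof (cases "p \<ge> 2 \<or> u x t \<noteq> 0")
  case True
  then show ?thesis using heat_equation[OF t] by simp
next
  case False
  then have p2: "p < 2" and ux: "u x t = 0" by auto
  have F_cont: "continuous_on UNIV (\<lambda>y. v y t - \<bar>u y t\<bar> powr (2 - p) * Lap t y)"
    using p2 by (intro continuous_intros continuous_on_powr' v_continuous Lap_continuous u_continuous t) auto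
  have "v y t - \<bar>u y t\<bar> powr (2 - p) * Lap t y = 0" if "u y t \<noteq> 0" for y
  proof -
    have "\<bar>u y t\<bar> powr (2 - p) * weight y t = 1"
      using that p2 by (simp add: abs_pow_def powr_add[symmetric])
    then show ?thesis using heat_equation[OF t, of y] that by (simp add: mult.assoc[symmetric])
  qed
  from zero_by_closure[where t = t, OF F_cont this, where x = x] ux show ?thesis
    using p2 by (auto simp: abs_pow_def)
qed

lemma D_eq: "D t = (\<integral>x. u x t * Lap t x \<partial>\<mu>)"
  by (simp add: D_energy_def)

lemma I_eq: "I t = (\<integral>x. weight x t * u x t * u x t \<partial>\<mu>)"
  by (simp add: I_mass_def abs_pow_mult_square[OF p])

lemma weight_u_continuous: "t \<in> {a..b} \<Longrightarrow> continuous_on UNIV (\<lambda>x. weight x t * u x t)"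
  by (rule continuous_on_abs_pow_mult_self[OF p u_continuous])

lemma integrable_products:
  assumes "t \<in> {a..b}"
  shows "integrable \<mu> (\<lambda>x. v x t * Lap t x)" "integrable \<mu> (\<lambda>x. u x t * Lap t x)"
    "integrable \<mu> (\<lambda>x. weight x t * u x t * u x t)"
  using assms by (auto intro!: integrable_continuous continuous_intros weight_u_continuous u_continuous
      v_continuous Lap_continuous)

text \<open>The coefficients of this nonnegative quadratic polynomial in \<open>\<kappa>\<close> satisfy the Cauchy--Schwarz
  inequality, with equality only if the polynomial has a real zero.\<close>

lemma weighted_square:
  assumes t: "t \<in> {a..b}"
  shows "continuous_on UNIV (\<lambda>x. weight x t * (v x t - \<kappa> * u x t)\<^sup>2)"
    and "(\<integral>x. weight x t * (v x t - \<kappa> * u x t)\<^sup>2 \<partial>\<mu>) = Q t - 2 * \<kappa> * D t + \<kappa>\<^sup>2 * I t"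
proof -
  have eq: "weight x t * (v x t - \<kappa> * u x t)\<^sup>2 =
      v x t * Lap t x - 2 * \<kappa> * (u x t * Lap t x) + \<kappa>\<^sup>2 * (weight x t * u x t * u x t)" for x
    unfolding v_Lap[OF t] u_Lap[OF t] by (simp add: power2_eq_square algebra_simps)
  show "continuous_on UNIV (\<lambda>x. weight x t * (v x t - \<kappa> * u x t)\<^sup>2)" unfolding eq
    by (intro continuous_intros weight_u_continuous u_continuous v_continuous Lap_continuous t)
  show "(\<integral>x. weight x t * (v x t - \<kappa> * u x t)\<^sup>2 \<partial>\<mu>) = Q t - 2 * \<kappa> * D t + \<kappa>\<^sup>2 * I t"
    unfolding eq D_eq I_eq Q_def using integrable_products[OF t] by simp
qed

lemma I_pos: assumes t: "t \<in> {a..b}" shows "I t > 0"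
proof -
  have nonneg: "weight x t * u x t * u x t \<ge> 0" for x by (simp add: abs_pow_mult_square[OF p])
  have "I t \<ge> 0" unfolding I_eq using nonneg by simp
  moreover have "I t \<noteq> 0"
  proof
    assume "I t = 0"
    then have zero: "(\<integral>x. weight x t * u x t * u x t \<partial>\<mu>) = 0" by (simp add: I_eq)
    have "continuous_on UNIV (\<lambda>x. weight x t * u x t * u x t)"
      by (intro continuous_on_mult weight_u_continuous u_continuous t)
    from continuous_nonneg_integral_zero[OF this nonneg zero] have "weight x t * u x t * u x t = 0" for x .
    moreover obtain x where "u x t \<noteq> 0" using u_nonzero t by blast
    ultimately show False by (simp add: abs_pow_mult_square[OF p])
  qed
  ultimately show ?thesis by simp
qed

lemma Cauchy_Schwarz_deficit: assumes t: "t \<in> {a..b}" shows "(D t)\<^sup>2 \<le> Q t * I t"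
proof -
  have "0 \<le> (\<integral>x. weight x t * (v x t - D t / I t * u x t)\<^sup>2 \<partial>\<mu>)"
    by (intro integral_nonneg_AE AE_I2 mult_nonneg_nonneg abs_pow_nonneg) auto
  also have "\<dots> = Q t - (D t)\<^sup>2 / I t"
    unfolding weighted_square(2)[OF t] using I_pos[OF t] by (simp add: field_simps power2_eq_square)
  finally show ?thesis using I_pos[OF t] by (simp add: field_simps)
qed

lemma D_eq_gradient:
  assumes t: "t \<in> {a..b}"
  shows "D t = - (\<integral>x. sqrt (ginner (\<lambda>x. u x t) (\<lambda>x. u x t) x) powr p \<partial>\<mu>)"
proof -
  let ?h = "\<lambda>x. u x t"
  have "flux_pairing p ?h ?h x = sqrt (ginner ?h ?h x) powr p" for x
    using abs_pow_mult_square[OF p, of "sqrt (ginner ?h ?h x)"] ginner_self_nonneg[of x ?h]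
    by (simp add: flux_pairing_def mult.assoc)
  then have "flux_pairing p ?h ?h = (\<lambda>x. sqrt (ginner ?h ?h x) powr p)" by (rule ext)
  then show ?thesis unfolding D_eq integration_by_parts[OF u_dom[OF t] u_C1[OF t]] by simp
qed

text \<open>Integrate the tangent inequality for \<open>|\<xi>|^p\<close> at \<open>\<xi> = \<nabla>u(t)\<close>, evaluated at \<open>\<nabla>u(s)\<close>, and move the
  derivatives to \<open>u(t)\<close> by Green's formula.\<close>

lemma D_upper_bound:
  assumes t: "t \<in> {a..b}" and s: "s \<in> {a..b}"
  shows "D s \<le> D t + p * (\<integral>x. (u x s - u x t) * Lap t x \<partial>\<mu>)"
proof -
  let ?h = "\<lambda>x. u x t" and ?k = "\<lambda>x. u x s"
  let ?N = "\<lambda>x. sqrt (ginner ?h ?h x)" and ?M = "\<lambda>x. sqrt (ginner ?k ?k x)"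
  let ?J = "flux_pairing p ?h (\<lambda>x. ?k x - ?h x)"
  note h = u_C1[OF t] and k = u_C1[OF s]
  have diff: "C1_function A (\<lambda>x. ?k x - ?h x)" by (rule C1_function_diff[OF k h])
  have powr_cont: "continuous_on UNIV (\<lambda>x. sqrt (ginner e e x) powr p)" if "C1_function A e" for e
    using p ginner_self_nonneg by (intro continuous_on_powr' continuous_intros continuous_on_ginner that) auto
  have pointwise: "?N x powr p + p * ?J x \<le> ?M x powr p" for x
  proof -
    have "\<bar>ginner ?h ?k x\<bar> \<le> ?N x * ?M x"
      using real_sqrt_le_mono[OF ginner_Cauchy_Schwarz[of x ?h ?k]] by (simp add: real_sqrt_mult)
    from norm_power_tangent_inequality[OF p _ _ this] ginner_self_nonneg
    have "?N x powr p + p * (abs_pow (?N x) (p - 2) * (ginner ?h ?k x - ?N x * ?N x)) \<le> ?M x powr p" by simp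
    moreover have "ginner ?h (\<lambda>x. ?k x - ?h x) x = ginner ?h ?k x - ?N x * ?N x"
      using coord_grad_diff[OF k h chart_at_in[of x]] ginner_self_nonneg[of x ?h]
      by (simp add: grad_inner_eq_grad[OF chart_at_in] inner_diff_right)
    ultimately show ?thesis by (simp add: flux_pairing_def)
  qed
  have int: "integrable \<mu> (\<lambda>x. ?N x powr p)" "integrable \<mu> ?J" "integrable \<mu> (\<lambda>x. ?M x powr p)"
    by (intro integrable_continuous powr_cont h k continuous_flux_pairing[OF u_dom[OF t] diff])+
  have "(\<integral>x. ?N x powr p + p * ?J x \<partial>\<mu>) \<le> (\<integral>x. ?M x powr p \<partial>\<mu>)"
    using int pointwise by (intro integral_mono) auto
  then have "- D t + p * (\<integral>x. ?J x \<partial>\<mu>) \<le> - D s"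
    using int by (simp add: D_eq_gradient[OF t] D_eq_gradient[OF s])
  then show ?thesis
    using integration_by_parts[OF u_dom[OF t] diff] by simp
qed

lemma bounded_in_space_time:
  obtains C where "C \<ge> 0" "\<And>x t. t \<in> {a..b} \<Longrightarrow> \<bar>u x t\<bar> \<le> C" "\<And>x t. t \<in> {a..b} \<Longrightarrow> \<bar>u\<^sub>t x t\<bar> \<le> C"
    "\<And>x t. t \<in> {a..b} \<Longrightarrow> \<bar>v x t\<bar> \<le> C" "\<And>x t. t \<in> {a..b} \<Longrightarrow> \<bar>weight x t * u x t\<bar> \<le> C"
proof -
  obtain C1 where C1: "\<And>x t. t \<in> {a..b} \<Longrightarrow> \<bar>u x t\<bar> \<le> C1" using C1_spacetime_bounded[OF u_C1_spacetime] by blast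
  obtain C2 where C2: "\<And>x t. t \<in> {a..b} \<Longrightarrow> \<bar>u\<^sub>t x t\<bar> \<le> C2" using C1_spacetime_bounded[OF u\<^sub>t_C1_spacetime] by blast
  have "bounded (\<eta> ` {a..b})" by (intro compact_imp_bounded compact_continuous_image \<eta>_continuous compact_Icc)
  then obtain C3 where "\<forall>z\<in>\<eta> ` {a..b}. norm z \<le> C3" unfolding bounded_iff by blast
  then have C3: "\<bar>\<eta> t\<bar> \<le> C3" if "t \<in> {a..b}" for t using that by auto
  have "bounded ((\<lambda>z. abs_pow z (p - 2) * z) ` {-C1..C1})"
    by (intro compact_imp_bounded compact_continuous_image continuous_on_abs_pow_mult_self[OF p] continuous_intros compact_Icc)
  then obtain C4 where "\<forall>y\<in>(\<lambda>z. abs_pow z (p - 2) * z) ` {-C1..C1}. norm y \<le> C4" unfolding bounded_iff by blast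
  then have C4: "\<bar>abs_pow z (p - 2) * z\<bar> \<le> C4" if "z \<in> {-C1..C1}" for z using that by auto
  have at: "a \<in> {a..b}" using ab by simp
  have nn: "C1 \<ge> 0" "C2 \<ge> 0" "C3 \<ge> 0" "C4 \<ge> 0"
    using C1[OF at, of undefined] C2[OF at, of undefined] C3[OF at] C4[of 0] C1[OF at, of undefined] by auto
  have C5: "\<bar>v x t\<bar> \<le> C2 + C3 * C1" if "t \<in> {a..b}" for x t
  proof -
    have "\<bar>v x t\<bar> \<le> \<bar>u\<^sub>t x t\<bar> + \<bar>\<eta> t\<bar> * \<bar>u x t\<bar>" unfolding v_def abs_mult[symmetric] by (rule abs_triangle_ineq4)
    also have "\<dots> \<le> C2 + C3 * C1" using C1[OF that] C2[OF that] C3[OF that] nn by (intro add_mono mult_mono) auto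
    finally show ?thesis .
  qed
  show ?thesis
  proof (rule that[of "C1 + C2 + C3 * C1 + C4"])
    fix x t assume t: "t \<in> {a..b}"
    have "\<bar>weight x t * u x t\<bar> \<le> C4" using C1[OF t, of x] by (intro C4) (auto simp: abs_le_iff)
    then show "\<bar>u x t\<bar> \<le> C1 + C2 + C3 * C1 + C4" "\<bar>u\<^sub>t x t\<bar> \<le> C1 + C2 + C3 * C1 + C4"
      "\<bar>v x t\<bar> \<le> C1 + C2 + C3 * C1 + C4" "\<bar>weight x t * u x t\<bar> \<le> C1 + C2 + C3 * C1 + C4"
      using C1[OF t, of x] C2[OF t, of x] C5[OF t, of x] nn mult_nonneg_nonneg[OF nn(3,1)] by linarith+
  qed (use nn in auto)
qed

lemma integrable_const: "integrable \<mu> (\<lambda>x. C :: real)"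
  by (intro integrable_continuous continuous_intros)

lemma I_has_derivative:
  assumes t: "t \<in> {a..b}"
  shows "(I has_real_derivative p * (D t + \<eta> t * I t)) (at t within {a..b})"
proof -
  obtain C where C: "C \<ge> 0" "\<And>x t. t \<in> {a..b} \<Longrightarrow> \<bar>u\<^sub>t x t\<bar> \<le> C" "\<And>x t. t \<in> {a..b} \<Longrightarrow> \<bar>weight x t * u x t\<bar> \<le> C"
    using bounded_in_space_time by metis
  let ?G = "\<lambda>x t. p * (weight x t * u x t) * u\<^sub>t x t"
  have "((\<lambda>s. \<integral>x. \<bar>u x s\<bar> powr p \<partial>\<mu>) has_real_derivative (\<integral>x. ?G x t \<partial>\<mu>)) (at t within {a..b})"
  proof (rule has_derivative_integral_dominated[where G = ?G and B = "\<lambda>_. p * C * C"])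
    show "integrable \<mu> (\<lambda>x. \<bar>u x s\<bar> powr p)" if "s \<in> {a..b}" for s
      using integrable_products(3)[OF that] by (simp add: abs_pow_mult_square[OF p])
    show "((\<lambda>s. \<bar>u x s\<bar> powr p) has_real_derivative ?G x s) (at s within {a..b})" if "s \<in> {a..b}" for x s
      using DERIV_chain2[OF has_real_derivative_abs_powr[OF p] u_has_derivative[OF that]] .
    show "\<bar>?G x s\<bar> \<le> p * C * C" if "s \<in> {a..b}" for x s
      unfolding abs_mult[of _ "u\<^sub>t x s"] abs_mult[of p]
      using C(2,3)[OF that] C(1) p by (intro mult_mono) auto
    show "(\<lambda>x. ?G x t) \<in> borel_measurable \<mu>"
      by (intro borel_measurable_continuous continuous_intros weight_u_continuous u\<^sub>t_continuous t)
  qed (use t in \<open>auto intro: integrable_const\<close>)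
  moreover have "(\<integral>x. ?G x t \<partial>\<mu>) = p * (D t + \<eta> t * I t)"
  proof -
    have eq: "?G x t = p * (u x t * Lap t x + \<eta> t * (weight x t * u x t * u x t))" for x
      unfolding u_Lap[OF t] by (simp add: v_def algebra_simps)
    show ?thesis unfolding eq using integrable_products[OF t] by (simp add: D_eq I_eq)
  qed
  ultimately show ?thesis by (simp add: I_mass_def[abs_def])
qed

lemma D_upper_bound_has_derivative:
  assumes t: "t \<in> {a..b}"
  shows "((\<lambda>s. D t + p * (\<integral>x. (u x s - u x t) * Lap t x \<partial>\<mu>)) has_real_derivative p * (Q t + \<eta> t * D t))
    (at t within {a..b})"
proof -
  obtain C where C: "C \<ge> 0" "\<And>x t. t \<in> {a..b} \<Longrightarrow> \<bar>u\<^sub>t x t\<bar> \<le> C" using bounded_in_space_time by metis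
  have "((\<lambda>s. \<integral>x. (u x s - u x t) * Lap t x \<partial>\<mu>) has_real_derivative (\<integral>x. u\<^sub>t x t * Lap t x \<partial>\<mu>)) (at t within {a..b})"
  proof (rule has_derivative_integral_dominated[where G = "\<lambda>x s. u\<^sub>t x s * Lap t x" and B = "\<lambda>x. C * \<bar>Lap t x\<bar>"])
    show "integrable \<mu> (\<lambda>x. (u x s - u x t) * Lap t x)" if "s \<in> {a..b}" for s
      by (intro integrable_continuous continuous_intros Lap_continuous u_continuous t that)
    show "((\<lambda>s. (u x s - u x t) * Lap t x) has_real_derivative u\<^sub>t x s * Lap t x) (at s within {a..b})"
      if "s \<in> {a..b}" for x s
      using u_has_derivative[OF that] by (auto intro!: derivative_eq_intros)
    show "\<bar>u\<^sub>t x s * Lap t x\<bar> \<le> C * \<bar>Lap t x\<bar>" if "s \<in> {a..b}" for x s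
      unfolding abs_mult using C(2)[OF that] by (intro mult_right_mono) auto
    show "integrable \<mu> (\<lambda>x. C * \<bar>Lap t x\<bar>)"
      by (intro integrable_continuous continuous_intros Lap_continuous t)
    show "(\<lambda>x. u\<^sub>t x t * Lap t x) \<in> borel_measurable \<mu>"
      by (intro borel_measurable_continuous continuous_intros Lap_continuous u\<^sub>t_continuous t)
  qed (use t in auto)
  moreover have "(\<integral>x. u\<^sub>t x t * Lap t x \<partial>\<mu>) = Q t + \<eta> t * D t"
  proof -
    have "u\<^sub>t x t * Lap t x = v x t * Lap t x + \<eta> t * (u x t * Lap t x)" for x
      by (simp add: v_def algebra_simps)
    then show ?thesis using integrable_products[OF t] by (simp add: D_eq Q_def)
  qed
  ultimately show ?thesis by (auto intro!: derivative_eq_intros)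
qed

text \<open>The integrand \<open>|u|^(p-2) u v\<close> of \<open>D\<close> is continuous in time at each point, although \<open>\<Delta>u\<close> need
  not be for \<open>p < 2\<close>.\<close>

lemma D_continuous: "continuous_on {a..b} D"
proof -
  obtain C where C: "C \<ge> 0" "\<And>x t. t \<in> {a..b} \<Longrightarrow> \<bar>v x t\<bar> \<le> C" "\<And>x t. t \<in> {a..b} \<Longrightarrow> \<bar>weight x t * u x t\<bar> \<le> C"
    using bounded_in_space_time by metis
  have "continuous_on {a..b} (\<lambda>t. \<integral>x. weight x t * u x t * v x t \<partial>\<mu>)"
  proof (rule continuous_on_integral_dominated[where B = "\<lambda>_. C * C"])
    show "continuous_on {a..b} (\<lambda>t. weight x t * u x t * v x t)" for x
      by (intro continuous_on_mult[OF continuous_on_abs_pow_mult_self[OF p u_continuous_time] v_continuous_time])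
    show "(\<lambda>x. weight x s * u x s * v x s) \<in> borel_measurable \<mu>" if "s \<in> {a..b}" for s
      by (intro borel_measurable_continuous continuous_intros weight_u_continuous v_continuous that)
    show "\<bar>weight x s * u x s * v x s\<bar> \<le> C * C" if "s \<in> {a..b}" for x s
      unfolding abs_mult[of _ "v x s"] using C(2,3)[OF that] C(1) by (intro mult_mono) auto
  qed (rule integrable_const)
  then show ?thesis
    by (subst continuous_on_cong[OF refl, of _ _ "\<lambda>t. \<integral>x. weight x t * u x t * v x t \<partial>\<mu>"])
      (auto simp: D_eq u_Lap)
qed

lemma U_eq: "U t = D t / I t"
  by (simp add: U_freq_def)

text \<open>Divide the upper bound for \<open>D\<close> by \<open>I\<close>; in the derivative the terms with \<open>\<eta>\<close> cancel.\<close>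

lemma U_upper_support:
  assumes t: "t \<in> {a..b}"
  obtains V where "(V has_real_derivative p * (Q t * I t - (D t)\<^sup>2) / (I t)\<^sup>2) (at t within {a..b})"
    "V t = U t" "\<And>s. s \<in> {a..b} \<Longrightarrow> U s \<le> V s"
proof -
  let ?\<Phi> = "\<lambda>s. D t + p * (\<integral>x. (u x s - u x t) * Lap t x \<partial>\<mu>)"
  note der = DERIV_divide[OF D_upper_bound_has_derivative[OF t] I_has_derivative[OF t]]
  show ?thesis
  proof (rule that[of "\<lambda>s. ?\<Phi> s / I s"])
    show "((\<lambda>s. ?\<Phi> s / I s) has_real_derivative p * (Q t * I t - (D t)\<^sup>2) / (I t)\<^sup>2) (at t within {a..b})"
      by (rule DERIV_cong[OF der]) (use I_pos[OF t] in \<open>auto simp: power2_eq_square algebra_simps\<close>)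
    show "U s \<le> ?\<Phi> s / I s" if "s \<in> {a..b}" for s
      unfolding U_eq using D_upper_bound[OF t that] I_pos[OF that] by (intro divide_right_mono) auto
  qed (simp add: U_eq)
qed

theorem U_mono: "mono_on {a..b} U"
proof (rule mono_on_of_upper_support)
  have "continuous_on {a..b} I" using I_has_derivative by (intro DERIV_continuous_on)
  then show "continuous_on {a..b} U" unfolding U_eq[abs_def]
    using D_continuous I_pos by (intro continuous_intros) force+
  fix t assume t: "t \<in> {a..b}"
  obtain V where V: "(V has_real_derivative p * (Q t * I t - (D t)\<^sup>2) / (I t)\<^sup>2) (at t within {a..b})"
    "V t = U t" "\<And>s. s \<in> {a..b} \<Longrightarrow> U s \<le> V s" using U_upper_support[OF t] by blast
  have "p * (Q t * I t - (D t)\<^sup>2) / (I t)\<^sup>2 \<ge> 0" using Cauchy_Schwarz_deficit[OF t] p by auto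
  then show "\<exists>V d. (V has_real_derivative d) (at t within {a..b}) \<and> d \<ge> 0 \<and> V t = U t \<and> (\<forall>s\<in>{a..b}. U s \<le> V s)"
    using V by blast
qed

theorem log_I_convex:
  assumes "mono_on {a..b} \<eta>" shows "convex_on {a..b} (\<lambda>t. ln (I t))"
proof (rule convex_on_of_mono_derivative)
  show "((\<lambda>t. ln (I t)) has_real_derivative p * (U t + \<eta> t)) (at t within {a..b})" if t: "t \<in> {a..b}" for t
    using I_pos[OF t] by (auto intro!: derivative_eq_intros I_has_derivative[OF t] simp: U_eq field_simps)
  show "mono_on {a..b} (\<lambda>t. p * (U t + \<eta> t))"
    using mono_onD[OF U_mono] mono_onD[OF assms] p by (intro mono_onI mult_left_mono add_mono) auto
qed

text \<open>At an interior time the upper function has a local minimum, so the Cauchy--Schwarz inequality is an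
  equality, and \<open>\<integral> |u|^(p-2) (v - k u)\<^sup>2 d\<mu> = 0\<close>. The end points of the interval follow by
  continuity of \<open>(v - k u) u\<close> in time.\<close>

lemma constant_frequency_ode:
  assumes k: "\<And>t. t \<in> {a..b} \<Longrightarrow> U t = k" and t: "t \<in> {a..b}" and x: "u x t \<noteq> 0"
  shows "v x t = k * u x t"
proof -
  have interior: "(v x s - k * u x s) * u x s = 0" if s: "s \<in> {a<..<b}" for s
  proof -
    have s': "s \<in> {a..b}" using s by auto
    obtain V where V: "(V has_real_derivative p * (Q s * I s - (D s)\<^sup>2) / (I s)\<^sup>2) (at s within {a..b})"
      "V s = U s" "\<And>r. r \<in> {a..b} \<Longrightarrow> U r \<le> V r" using U_upper_support[OF s'] by blast
    have der: "(V has_real_derivative p * (Q s * I s - (D s)\<^sup>2) / (I s)\<^sup>2) (at s)"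
      using V(1) s by (simp add: at_within_Icc_at)
    have "p * (Q s * I s - (D s)\<^sup>2) / (I s)\<^sup>2 = 0"
    proof (rule DERIV_local_min[OF der, of "min (s - a) (b - s)"])
      show "\<forall>r. \<bar>s - r\<bar> < min (s - a) (b - s) \<longrightarrow> V s \<le> V r"
      proof (intro allI impI)
        fix r assume "\<bar>s - r\<bar> < min (s - a) (b - s)"
        then have "r \<in> {a..b}" by auto
        from V(3)[OF this] show "V s \<le> V r" using V(2) k[OF s'] k[OF \<open>r \<in> {a..b}\<close>] by simp
      qed
    qed (use s in auto)
    then have QI: "Q s * I s = (D s)\<^sup>2" using p I_pos[OF s'] by simp
    have DI: "D s = k * I s" using k[OF s'] I_pos[OF s'] by (simp add: U_eq field_simps)
    have "Q s = k\<^sup>2 * I s" using QI I_pos[OF s'] unfolding DI by (simp add: power2_eq_square)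
    then have zero: "(\<integral>x. weight x s * (v x s - k * u x s)\<^sup>2 \<partial>\<mu>) = 0"
      unfolding weighted_square(2)[OF s'] DI by (simp add: power2_eq_square)
    have "weight x s * (v x s - k * u x s)\<^sup>2 = 0"
      by (rule continuous_nonneg_integral_zero[OF weighted_square(1)[OF s'] _ zero])
        (intro mult_nonneg_nonneg abs_pow_nonneg zero_le_power2)
    then show ?thesis by (auto simp: abs_pow_def split: if_splits)
  qed
  have "continuous_on (closure {a<..<b}) (\<lambda>s. (v x s - k * u x s) * u x s)"
    using ab by (auto intro!: continuous_intros v_continuous_time u_continuous_time)
  from continuous_constant_on_closure[OF this interior, of t] have "(v x t - k * u x t) * u x t = 0"
    using t ab by simp
  then show ?thesis using x by simp
qed

theorem constant_frequency_eigenfunction: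
  assumes k: "\<And>t. t \<in> {a..b} \<Longrightarrow> U t = k" and t: "t \<in> {a..b}"
  shows "p_eigenfunction A g f p (\<lambda>x. u x t)"
proof -
  have "Lap t x = k * weight x t * u x t" for x
  proof -
    have cont: "continuous_on UNIV (\<lambda>x. Lap t x - k * (weight x t * u x t))"
      by (intro continuous_intros Lap_continuous weight_u_continuous t)
    have "Lap t y - k * (weight y t * u y t) = 0" if "u y t \<noteq> 0" for y
      using heat_equation[OF t, of y] constant_frequency_ode[OF k t that] that by simp
    from zero_by_closure[where t = t, OF cont this, where x = x] show ?thesis by (auto simp: mult.assoc)
  qed
  then show ?thesis
    unfolding p_eigenfunction_def using u_nonzero t u_dom[OF t] by blast
qed

text \<open>The solution of \<open>u\<^sub>t = (k + \<eta>) u\<close> is a positive multiple of the initial value, and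
  \<open>z \<mapsto> |z|^(p-2) z\<close> is homogeneous of degree \<open>p - 1\<close>.\<close>

theorem constant_frequency_formula:
  assumes k: "\<And>t. t \<in> {a..b} \<Longrightarrow> U t = k" and t: "t \<in> {a..b}"
  shows "u x t * abs_pow (u x t) (p - 2) =
    exp ((p - 1) * (U t * t - U a * a)) * (u x a * abs_pow (u x a) (p - 2)) * exp ((p - 1) * integral {a..t} \<eta>)"
proof -
  let ?K = "\<lambda>t. k * t + integral {a..t} \<eta>"
  define e where "e = ?K t - ?K a"
  have "u x t = u x a * exp (?K t - ?K a)"
  proof (rule linear_ode_off_zeros[where \<kappa> = "\<lambda>t. k + \<eta> t"])
    show "(u x has_real_derivative u\<^sub>t x t) (at t within {a..b})" if "t \<in> {a..b}" for t
      by (rule u_has_derivative[OF that])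
    show "u\<^sub>t x t = (k + \<eta> t) * u x t" if "t \<in> {a..b}" "u x t \<noteq> 0" for t
      using constant_frequency_ode[OF k that] by (simp add: v_def algebra_simps)
    show "(?K has_real_derivative k + \<eta> t) (at t within {a..b})" if "t \<in> {a..b}" for t
      by (auto intro!: derivative_eq_intros integral_has_real_derivative[OF \<eta>_continuous that])
  qed (rule t)
  then have ut: "u x t = exp e * u x a" by (simp add: e_def)
  have scale: "abs_pow (exp e * z) (p - 2) * (exp e * z) = exp ((p - 1) * e) * (abs_pow z (p - 2) * z)" for z
  proof -
    have pos_part: "max 0 (exp e * y) = exp e * max 0 y" for y :: real by (auto simp: max_def mult_le_0_iff zero_le_mult_iff)
    have "max 0 (- (exp e * z)) = exp e * max 0 (- z)" using pos_part[of "- z"] by simp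
    moreover have "exp ((p - 1) * e) = exp e powr (p - 1)" by (simp add: exp_powr_real mult.commute)
    ultimately show ?thesis unfolding abs_pow_mult_self[OF p] pos_part
      by (simp only: powr_mult right_diff_distrib)
  qed
  have e_eq: "(p - 1) * e = (p - 1) * (U t * t - U a * a) + (p - 1) * integral {a..t} \<eta>"
    using k[OF t] k[of a] ab by (simp add: e_def algebra_simps)
  show ?thesis
    using scale[of "u x a"] unfolding ut[symmetric] e_eq exp_add by (simp add: mult_ac)
qed

end

theorem theorem3p1:
  fixes A :: "('m::t2_space, 'n::finite) chart set"
    and g :: "('m, 'n) chart \<Rightarrow> 'm \<Rightarrow> real ^ 'n ^ 'n"
    and vol :: "'m measure"
    and f :: "'m \<Rightarrow> real"
    and p a b :: real
    and \<eta> :: "real \<Rightarrow> real"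
    and u :: "'m \<Rightarrow> real \<Rightarrow> real"
  assumes "closed_riemannian_manifold A g vol"
    and "smooth_function A f"
    and "1 < p"
    and "a < b"
    and "smooth_on {a..b} \<eta>"
    and "smooth_spacetime A {a..b} u"
    and "\<forall>t\<in>{a..b}. \<exists>x. u x t \<noteq> 0"
    and "p_heat_solution A g f p a b \<eta> u"
  shows "mono_on {a..b} (U_freq A g vol f p u) \<and>
         ((\<exists>k. \<forall>t\<in>{a..b}. U_freq A g vol f p u t = k) \<longrightarrow>
           (\<forall>t\<in>{a..b}. p_eigenfunction A g f p (\<lambda>x. u x t)) \<and>
           (\<forall>x. \<forall>t\<in>{a..b}.
              u x t * abs_pow (u x t) (p - 2) =
                exp ((p - 1) * (U_freq A g vol f p u t * t - U_freq A g vol f p u a * a))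
                * (u x a * abs_pow (u x a) (p - 2))
                * exp ((p - 1) * integral {a..t} \<eta>))) \<and>
         (mono_on {a..b} \<eta> \<longrightarrow> convex_on {a..b} (\<lambda>t. ln (I_mass vol f p u t)))"
proof -
  interpret p_heat_flow A g vol f p a b \<eta> u
    using assms by (simp add: p_heat_flow_def p_heat_flow_axioms_def weighted_closed_manifold_def
        weighted_closed_manifold_axioms_def)
  show ?thesis
    using U_mono log_I_convex constant_frequency_eigenfunction constant_frequency_formula by blast
qed

end
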